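(* Let $k$ be a field with $\operatorname{char} k\neq 2$, let $n$ be an odd positive integer, and let $A=Cl(\alpha,\beta_i,\gamma_i,\lambda_{ij})$ be a $2^{n+1}$-dimensional Clifford algebra over $k$. Assume that $A$ is semisimple. Then the right $E(n)$-coactions on $A$ are exactly the $k$-linear maps $\rho:A\to A\otimes E(n)$ of the form \[\rho(a)=\sum_{P\subseteq\{1,\ldots,n\}}(-1)^{\lfloor\frac{|P|+1}{2}\rfloor}\left[d_P(a)\otimes\frac{x_P+(-1)^{|P|}gx_P}{2}+c^{-1}d_P(a)c\otimes\frac{x_P+(-1)^{|P|+1}gx_P}{2}\right]\qquad(a\in A),\] where: (1) $c$ is an invertible element of $A$ such that $c^2\in k$; (2) $d_\emptyset=\mathrm{Id}_A$ and $d_P=d_{i_1}d_{i_2}\cdots d_{i_s}$ (composition) for $P=\{i_1<\cdots<i_s\}$, where $d_i:A\to A$ ($i=1,\ldots,n$) is defined by $d_i(a)=u_ia-c^{-1}acu_i$ for all $a\in A$, for elements $u_1,\ldots,u_n\in A$ such that $u_ic+cu_i=0$, $u_i^2\in k$ and $u_iu_j+u_ju_i\in k$ for all $i,j=1,\ldots,n$.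
   Context: Algebras are associative and unital; $\otimes=\otimes_k$; $k$ is identified with $k1_A\subseteq A$. Given scalars $\alpha,\beta_i,\gamma_i\in k$ ($1\le i\le n$) and $\lambda_{ij}\in k$ ($1\le i<j\le n$), $Cl(\alpha,\beta_i,\gamma_i,\lambda_{ij})$ is the unital associative $k$-algebra generated by $G,X_1,\ldots,X_n$ with relations $G^2=\alpha$, $X_i^2=\beta_i$, $GX_i+X_iG=\gamma_i$, and $X_iX_j+X_jX_i=\lambda_{ij}$ for $i<j$. It has dimension $2^{n+1}$. $E(n)$ is the $2^{n+1}$-dimensional Hopf algebra over $k$ generated by $g,x_1,\ldots,x_n$ with relations $g^2=1$, $x_i^2=0$, $gx_i=-x_ig$, $x_ix_j=-x_jx_i$, and with $\Delta(g)=g\otimes g$, $\Delta(x_i)=x_i\otimes g+1\otimes x_i$, $\varepsilon(g)=1$, $\varepsilon(x_i)=0$, $S(g)=g$, $S(x_i)=gx_i$. For $P=\{i_1<\cdots<i_s\}\subseteq\{1,\ldots,n\}$ put $x_P=x_{i_1}\cdots x_{i_s}$, with $x_\emptyset=1$. A right $H$-coaction on an algebra $A$ (a right $H$-comodule algebra structure) is a $k$-linear map $\rho:A\to A\otimes H$, $\rho(a)=a_0\otimes a_1$, making $A$ a right $H$-comodule and satisfying $\rho(ab)=a_0b_0\otimes a_1b_1$ and $\rho(1_A)=1_A\otimes 1_H$. *)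

theory Defs
  imports
    Complex_Main
    "HOL-Library.Poly_Mapping"
begin

section \<open>Algebras over a field\<close>

locale k_algebra = vector_space scale
  for scale :: "'k::field \<Rightarrow> 'a::ring_1 \<Rightarrow> 'a" +
  assumes scale_mult_left: "scale r (a * b) = scale r a * b"
    and scale_mult_right: "scale r (a * b) = a * scale r b"

definition scalars :: "('k::field \<Rightarrow> 'a::ring_1 \<Rightarrow> 'a) \<Rightarrow> 'a set" where
  "scalars scale = {scale r 1 | r. True}"

definition left_ideal :: "'a::ring_1 set \<Rightarrow> bool" where
  "left_ideal I \<longleftrightarrow>
     0 \<in> I \<and> (\<forall>x\<in>I. \<forall>y\<in>I. x - y \<in> I) \<and> (\<forall>a. \<forall>x\<in>I. a * x \<in> I)"

text \<open>A ring is semisimple iff its left regular module is a semisimple module, i.e. every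
  submodule is a direct summand. The ring is the whole type \<^typ>\<open>'a\<close>.\<close>

definition semisimple_ring :: "'a::ring_1 itself \<Rightarrow> bool" where
  "semisimple_ring _ \<longleftrightarrow>
     (\<forall>I :: 'a set. left_ideal I \<longrightarrow>
       (\<exists>J. left_ideal J \<and> I \<inter> J = {0} \<and> {x + y | x y. x \<in> I \<and> y \<in> J} = UNIV))"


section \<open>Free vector spaces\<close>

text \<open>The free vector space on a set (here: a type) consists of the finitely supported functions
  \<^typ>\<open>'x \<Rightarrow>\<^sub>0 'k\<close>; \<open>fbasis x\<close> is the basis vector belonging to \<open>x\<close>, and \<open>lin_ext scale \<phi>\<close> is the
  linear extension of \<open>\<phi>\<close> to the free vector space.\<close>

definition fscale :: "'k::field \<Rightarrow> ('x \<Rightarrow>\<^sub>0 'k) \<Rightarrow> ('x \<Rightarrow>\<^sub>0 'k)" where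
  "fscale r f = Poly_Mapping.map ((*) r) f"

definition fbasis :: "'x \<Rightarrow> ('x \<Rightarrow>\<^sub>0 'k::field)" where
  "fbasis x = Poly_Mapping.single x 1"

definition lin_ext ::
  "('k::field \<Rightarrow> 'v::ab_group_add \<Rightarrow> 'v) \<Rightarrow> ('x \<Rightarrow> 'v) \<Rightarrow> ('x \<Rightarrow>\<^sub>0 'k) \<Rightarrow> 'v" where
  "lin_ext scale \<phi> f = (\<Sum>x\<in>Poly_Mapping.keys f. scale (Poly_Mapping.lookup f x) (\<phi> x))"


section \<open>Algebras given by generators and relations\<close>

text \<open>Words form the free monoid, so that the multiplication of \<^typ>\<open>'g list \<Rightarrow>\<^sub>0 'k\<close> (convolution)
  is the one of the free algebra on \<^typ>\<open>'g\<close>.\<close>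

instantiation list :: (type) monoid_add
begin

definition zero_list :: "'a list" where "0 = []"
definition plus_list :: "'a list \<Rightarrow> 'a list \<Rightarrow> 'a list" where "xs + ys = xs @ ys"

instance by standard (simp_all add: zero_list_def plus_list_def)

end

definition free_algebra :: "'g set \<Rightarrow> ('g list \<Rightarrow>\<^sub>0 'k::field) set" where
  "free_algebra \<Gamma> = {f. Poly_Mapping.keys f \<subseteq> lists \<Gamma>}"

definition gen :: "'g \<Rightarrow> ('g list \<Rightarrow>\<^sub>0 'k::field)" where
  "gen y = fbasis [y]"

definition const :: "'k \<Rightarrow> ('g list \<Rightarrow>\<^sub>0 'k::field)" where
  "const r = fscale r 1"

text \<open>The two-sided ideal of the free algebra on \<open>\<Gamma>\<close> generated by \<open>R\<close>.\<close>

definition ideal_gen :: "'g set \<Rightarrow> ('g list \<Rightarrow>\<^sub>0 'k::field) set \<Rightarrow> ('g list \<Rightarrow>\<^sub>0 'k) set" where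
  "ideal_gen \<Gamma> R =
     module.span fscale {fbasis u * r * fbasis v | u r v. u \<in> lists \<Gamma> \<and> r \<in> R \<and> v \<in> lists \<Gamma>}"

definition eval_free ::
  "('k::field \<Rightarrow> 'a::ring_1 \<Rightarrow> 'a) \<Rightarrow> ('g \<Rightarrow> 'a) \<Rightarrow> ('g list \<Rightarrow>\<^sub>0 'k) \<Rightarrow> 'a" where
  "eval_free scale \<gamma> = lin_ext scale (\<lambda>w. prod_list (map \<gamma> w))"

text \<open>The algebra \<^typ>\<open>'a\<close> is the algebra generated by \<open>\<Gamma>\<close> with relations \<open>r = 0\<close> (\<open>r \<in> R\<close>), the
  generator \<open>y\<close> being realized by the element \<open>\<gamma> y\<close>: the canonical homomorphism from the free
  algebra induces an isomorphism of the quotient by the ideal generated by \<open>R\<close> onto \<^typ>\<open>'a\<close>.\<close>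

definition presented_algebra ::
  "('k::field \<Rightarrow> 'a::ring_1 \<Rightarrow> 'a) \<Rightarrow> 'g set \<Rightarrow> ('g list \<Rightarrow>\<^sub>0 'k) set \<Rightarrow> ('g \<Rightarrow> 'a) \<Rightarrow> bool" where
  "presented_algebra scale \<Gamma> R \<gamma> \<longleftrightarrow>
     k_algebra scale \<and>
     eval_free scale \<gamma> ` free_algebra \<Gamma> = UNIV \<and>
     (\<forall>f \<in> free_algebra \<Gamma>. eval_free scale \<gamma> f = 0 \<longleftrightarrow> f \<in> ideal_gen \<Gamma> R)"


section \<open>Clifford algebras\<close>

datatype cl_gen = Gen_G | Gen_X nat

definition cl_gens :: "nat \<Rightarrow> cl_gen set" where
  "cl_gens n = insert Gen_G (Gen_X ` {1..n})"

definition clifford_relations ::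
  "nat \<Rightarrow> 'k::field \<Rightarrow> (nat \<Rightarrow> 'k) \<Rightarrow> (nat \<Rightarrow> 'k) \<Rightarrow> (nat \<Rightarrow> nat \<Rightarrow> 'k) \<Rightarrow> (cl_gen list \<Rightarrow>\<^sub>0 'k) set" where
  "clifford_relations n \<alpha> \<beta> \<gamma> lam =
     {gen Gen_G * gen Gen_G - const \<alpha>} \<union>
     {gen (Gen_X i) * gen (Gen_X i) - const (\<beta> i) | i. i \<in> {1..n}} \<union>
     {gen Gen_G * gen (Gen_X i) + gen (Gen_X i) * gen Gen_G - const (\<gamma> i) | i. i \<in> {1..n}} \<union>
     {gen (Gen_X i) * gen (Gen_X j) + gen (Gen_X j) * gen (Gen_X i) - const (lam i j) | i j.
        i \<in> {1..n} \<and> j \<in> {1..n} \<and> i < j}"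

definition clifford_algebra ::
  "('k::field \<Rightarrow> 'a::ring_1 \<Rightarrow> 'a) \<Rightarrow> nat \<Rightarrow> 'k \<Rightarrow> (nat \<Rightarrow> 'k) \<Rightarrow> (nat \<Rightarrow> 'k) \<Rightarrow> (nat \<Rightarrow> nat \<Rightarrow> 'k) \<Rightarrow>
     'a \<Rightarrow> (nat \<Rightarrow> 'a) \<Rightarrow> bool" where
  "clifford_algebra scale n \<alpha> \<beta> \<gamma> lam G X \<longleftrightarrow>
     presented_algebra scale (cl_gens n) (clifford_relations n \<alpha> \<beta> \<gamma> lam) (case_cl_gen G X)"


section \<open>Tensor products\<close>

text \<open>\<open>V \<otimes> W\<close> is the quotient of the free vector space on \<open>V \<times> W\<close> by the subspace
  \<open>tensor_null sV sW\<close> spanned by the bilinearity relations, where \<open>sV\<close> and \<open>sW\<close> are the scalar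
  multiplications of \<open>V\<close> and \<open>W\<close>. Its elements are cosets; \<open>tclass sV sW f\<close> is the coset
  of \<open>f\<close>. The operations on cosets below are defined through arbitrary representatives \<open>rep t\<close>.\<close>

type_synonym ('k, 'v, 'w) tensor = "('v \<times> 'w \<Rightarrow>\<^sub>0 'k) set"

definition tensor_null ::
  "('k::field \<Rightarrow> 'v::ab_group_add \<Rightarrow> 'v) \<Rightarrow> ('k \<Rightarrow> 'w::ab_group_add \<Rightarrow> 'w) \<Rightarrow> ('v \<times> 'w \<Rightarrow>\<^sub>0 'k) set" where
  "tensor_null sV sW = module.span fscale
     ({fbasis (v + v', w) - fbasis (v, w) - fbasis (v', w) | v v' w. True} \<union>
      {fbasis (v, w + w') - fbasis (v, w) - fbasis (v, w') | v w w'. True} \<union>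
      {fbasis (sV r v, w) - fscale r (fbasis (v, w)) | r v w. True} \<union>
      {fbasis (v, sW r w) - fscale r (fbasis (v, w)) | r v w. True})"

definition tclass ::
  "('k::field \<Rightarrow> 'v::ab_group_add \<Rightarrow> 'v) \<Rightarrow> ('k \<Rightarrow> 'w::ab_group_add \<Rightarrow> 'w) \<Rightarrow>
     ('v \<times> 'w \<Rightarrow>\<^sub>0 'k) \<Rightarrow> ('k, 'v, 'w) tensor" where
  "tclass sV sW f = {f + z | z. z \<in> tensor_null sV sW}"

definition rep :: "'x set \<Rightarrow> 'x" where
  "rep t = (SOME f. f \<in> t)"

text \<open>The product in \<open>V \<otimes> W\<close> for algebras \<open>V\<close>, \<open>W\<close>:
  \<open>(v \<otimes> w) (v' \<otimes> w') = v v' \<otimes> w w'\<close>.\<close>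

definition tensor_mult ::
  "('k::field \<Rightarrow> 'v::ring_1 \<Rightarrow> 'v) \<Rightarrow> ('k \<Rightarrow> 'w::ring_1 \<Rightarrow> 'w) \<Rightarrow>
     ('k, 'v, 'w) tensor \<Rightarrow> ('k, 'v, 'w) tensor \<Rightarrow> ('k, 'v, 'w) tensor" where
  "tensor_mult sV sW t t' = tclass sV sW
     (lin_ext fscale (\<lambda>(v, w). lin_ext fscale (\<lambda>(v', w'). fbasis (v * v', w * w')) (rep t')) (rep t))"

definition linear_to_tensor ::
  "('k::field \<Rightarrow> 'u::ab_group_add \<Rightarrow> 'u) \<Rightarrow>
     ('k \<Rightarrow> 'v::ab_group_add \<Rightarrow> 'v) \<Rightarrow> ('k \<Rightarrow> 'w::ab_group_add \<Rightarrow> 'w) \<Rightarrow>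
     ('u \<Rightarrow> ('k, 'v, 'w) tensor) \<Rightarrow> bool" where
  "linear_to_tensor sU sV sW F \<longleftrightarrow>
     (\<forall>a. F a \<in> range (tclass sV sW)) \<and>
     (\<forall>a b. F (a + b) = tclass sV sW (rep (F a) + rep (F b))) \<and>
     (\<forall>r a. F (sU r a) = tclass sV sW (fscale r (rep (F a))))"

definition alg_hom_to_tensor ::
  "('k::field \<Rightarrow> 'u::ring_1 \<Rightarrow> 'u) \<Rightarrow> ('k \<Rightarrow> 'v::ring_1 \<Rightarrow> 'v) \<Rightarrow> ('k \<Rightarrow> 'w::ring_1 \<Rightarrow> 'w) \<Rightarrow>
     ('u \<Rightarrow> ('k, 'v, 'w) tensor) \<Rightarrow> bool" where
  "alg_hom_to_tensor sU sV sW F \<longleftrightarrow>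
     linear_to_tensor sU sV sW F \<and>
     F 1 = tclass sV sW (fbasis (1, 1)) \<and>
     (\<forall>a b. F (a * b) = tensor_mult sV sW (F a) (F b))"

text \<open>Both \<open>(U \<otimes> V) \<otimes> W\<close> and \<open>U \<otimes> (V \<otimes> W)\<close> are identified with the triple tensor product
  \<open>U \<otimes> V \<otimes> W\<close>, the quotient of the free vector space on \<open>U \<times> V \<times> W\<close> by the trilinearity
  relations.\<close>

definition tensor3_null ::
  "('k::field \<Rightarrow> 'u::ab_group_add \<Rightarrow> 'u) \<Rightarrow> ('k \<Rightarrow> 'v::ab_group_add \<Rightarrow> 'v) \<Rightarrow>
     ('k \<Rightarrow> 'w::ab_group_add \<Rightarrow> 'w) \<Rightarrow> ('u \<times> 'v \<times> 'w \<Rightarrow>\<^sub>0 'k) set" where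
  "tensor3_null sU sV sW = module.span fscale
     ({fbasis (u + u', v, w) - fbasis (u, v, w) - fbasis (u', v, w) | u u' v w. True} \<union>
      {fbasis (u, v + v', w) - fbasis (u, v, w) - fbasis (u, v', w) | u v v' w. True} \<union>
      {fbasis (u, v, w + w') - fbasis (u, v, w) - fbasis (u, v, w') | u v w w'. True} \<union>
      {fbasis (sU r u, v, w) - fscale r (fbasis (u, v, w)) | r u v w. True} \<union>
      {fbasis (u, sV r v, w) - fscale r (fbasis (u, v, w)) | r u v w. True} \<union>
      {fbasis (u, v, sW r w) - fscale r (fbasis (u, v, w)) | r u v w. True})"

definition tclass3 ::
  "('k::field \<Rightarrow> 'u::ab_group_add \<Rightarrow> 'u) \<Rightarrow> ('k \<Rightarrow> 'v::ab_group_add \<Rightarrow> 'v) \<Rightarrow>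
     ('k \<Rightarrow> 'w::ab_group_add \<Rightarrow> 'w) \<Rightarrow> ('u \<times> 'v \<times> 'w \<Rightarrow>\<^sub>0 'k) \<Rightarrow> ('u \<times> 'v \<times> 'w \<Rightarrow>\<^sub>0 'k) set" where
  "tclass3 sU sV sW f = {f + z | z. z \<in> tensor3_null sU sV sW}"


section \<open>Coactions\<close>

text \<open>\<open>map_left\<close> is \<open>\<rho> \<otimes> id : A \<otimes> H \<rightarrow> A \<otimes> H \<otimes> H\<close>, \<open>map_right\<close> is
  \<open>id \<otimes> \<Delta> : A \<otimes> H \<rightarrow> A \<otimes> H \<otimes> H\<close>, and \<open>map_counit\<close> is \<open>id \<otimes> \<epsilon> : A \<otimes> H \<rightarrow> A \<otimes> k = A\<close>.\<close>

definition map_left ::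
  "('k::field \<Rightarrow> 'a::ab_group_add \<Rightarrow> 'a) \<Rightarrow> ('k \<Rightarrow> 'h::ab_group_add \<Rightarrow> 'h) \<Rightarrow>
     ('a \<Rightarrow> ('k, 'a, 'h) tensor) \<Rightarrow> ('k, 'a, 'h) tensor \<Rightarrow> ('a \<times> 'h \<times> 'h \<Rightarrow>\<^sub>0 'k) set" where
  "map_left sA sH \<rho> t = tclass3 sA sH sH
     (lin_ext fscale (\<lambda>(a, h). lin_ext fscale (\<lambda>(a', h'). fbasis (a', h', h)) (rep (\<rho> a))) (rep t))"

definition map_right ::
  "('k::field \<Rightarrow> 'a::ab_group_add \<Rightarrow> 'a) \<Rightarrow> ('k \<Rightarrow> 'h::ab_group_add \<Rightarrow> 'h) \<Rightarrow>
     ('h \<Rightarrow> ('k, 'h, 'h) tensor) \<Rightarrow> ('k, 'a, 'h) tensor \<Rightarrow> ('a \<times> 'h \<times> 'h \<Rightarrow>\<^sub>0 'k) set" where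
  "map_right sA sH \<Delta> t = tclass3 sA sH sH
     (lin_ext fscale (\<lambda>(a, h). lin_ext fscale (\<lambda>(h', h''). fbasis (a, h', h'')) (rep (\<Delta> h))) (rep t))"

definition map_counit ::
  "('k::field \<Rightarrow> 'a::ab_group_add \<Rightarrow> 'a) \<Rightarrow> ('h \<Rightarrow> 'k) \<Rightarrow> ('k, 'a, 'h) tensor \<Rightarrow> 'a" where
  "map_counit sA \<epsilon> t = lin_ext sA (\<lambda>(a, h). sA (\<epsilon> h) a) (rep t)"

definition right_coaction ::
  "('k::field \<Rightarrow> 'a::ring_1 \<Rightarrow> 'a) \<Rightarrow> ('k \<Rightarrow> 'h::ring_1 \<Rightarrow> 'h) \<Rightarrow>
     ('h \<Rightarrow> ('k, 'h, 'h) tensor) \<Rightarrow> ('h \<Rightarrow> 'k) \<Rightarrow> ('a \<Rightarrow> ('k, 'a, 'h) tensor) \<Rightarrow> bool" where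
  "right_coaction sA sH \<Delta> \<epsilon> \<rho> \<longleftrightarrow>
     alg_hom_to_tensor sA sA sH \<rho> \<and>
     (\<forall>a. map_left sA sH \<rho> (\<rho> a) = map_right sA sH \<Delta> (\<rho> a)) \<and>
     (\<forall>a. map_counit sA \<epsilon> (\<rho> a) = a)"


section \<open>The Hopf algebra \<open>E(n)\<close>\<close>

definition E_relations :: "nat \<Rightarrow> (cl_gen list \<Rightarrow>\<^sub>0 'k::field) set" where
  "E_relations n =
     {gen Gen_G * gen Gen_G - 1} \<union>
     {gen (Gen_X i) * gen (Gen_X i) | i. i \<in> {1..n}} \<union>
     {gen Gen_G * gen (Gen_X i) + gen (Gen_X i) * gen Gen_G | i. i \<in> {1..n}} \<union>
     {gen (Gen_X i) * gen (Gen_X j) + gen (Gen_X j) * gen (Gen_X i) | i j.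
        i \<in> {1..n} \<and> j \<in> {1..n}}"

text \<open>\<open>\<Delta>\<close> and \<open>\<epsilon>\<close> are algebra homomorphisms and \<open>S\<close> is an algebra antihomomorphism, so they are
  determined by their values on the generators.\<close>

definition E_hopf_algebra ::
  "('k::field \<Rightarrow> 'h::ring_1 \<Rightarrow> 'h) \<Rightarrow> nat \<Rightarrow> 'h \<Rightarrow> (nat \<Rightarrow> 'h) \<Rightarrow>
     ('h \<Rightarrow> ('k, 'h, 'h) tensor) \<Rightarrow> ('h \<Rightarrow> 'k) \<Rightarrow> ('h \<Rightarrow> 'h) \<Rightarrow> bool" where
  "E_hopf_algebra sH n g x \<Delta> \<epsilon> S \<longleftrightarrow>
     presented_algebra sH (cl_gens n) (E_relations n) (case_cl_gen g x) \<and>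
     (alg_hom_to_tensor sH sH sH \<Delta> \<and>
      \<Delta> g = tclass sH sH (fbasis (g, g)) \<and>
      (\<forall>i\<in>{1..n}. \<Delta> (x i) = tclass sH sH (fbasis (x i, g) + fbasis (1, x i)))) \<and>
     (Vector_Spaces.linear sH (*) \<epsilon> \<and> \<epsilon> 1 = 1 \<and> (\<forall>a b. \<epsilon> (a * b) = \<epsilon> a * \<epsilon> b) \<and>
      \<epsilon> g = 1 \<and> (\<forall>i\<in>{1..n}. \<epsilon> (x i) = 0)) \<and>
     (Vector_Spaces.linear sH sH S \<and> S 1 = 1 \<and> (\<forall>a b. S (a * b) = S b * S a) \<and>
      S g = g \<and> (\<forall>i\<in>{1..n}. S (x i) = g * x i))"

text \<open>For \<open>P = {i\<^sub>1 < \<dots> < i\<^sub>s}\<close>: \<open>ordered_prod x P = x i\<^sub>1 \<cdots> x i\<^sub>s\<close> and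
  \<open>ordered_comp d P = d i\<^sub>1 \<circ> \<cdots> \<circ> d i\<^sub>s\<close>.\<close>

definition ordered_prod :: "(nat \<Rightarrow> 'a::monoid_mult) \<Rightarrow> nat set \<Rightarrow> 'a" where
  "ordered_prod x P = prod_list (map x (sorted_list_of_set P))"

definition ordered_comp :: "(nat \<Rightarrow> 'a \<Rightarrow> 'a) \<Rightarrow> nat set \<Rightarrow> 'a \<Rightarrow> 'a" where
  "ordered_comp d P = foldr (\<circ>) (map d (sorted_list_of_set P)) id"

end

theory Submission
  imports Defs "HOL-Library.Product_Plus"
begin

text \<open>
  A right coaction \<open>\<rho>\<close> of \<open>E(n)\<close> on \<open>A\<close> is studied through its slices
  \<open>R \<rho> p = (id \<otimes> p) \<circ> \<rho>\<close>, where \<open>p\<close> runs through the linear functionals on \<open>E(n)\<close>. Over a field these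
  determine \<open>\<rho>\<close> (\<open>slice_separates\<close>), and the axioms of a coaction become the statement that the
  convolution algebra of functionals acts on \<open>A\<close> with a product rule (\<open>right_coaction_iff_slices\<close>).
  That algebra is generated by the character \<open>\<chi>\<close> with \<open>\<chi> g = -1\<close>, \<open>\<chi> x\<^sub>i = 0\<close> and by the skew-primitive
  functionals \<open>\<xi>\<^sub>i\<close>. So a coaction is the same thing as an involutive automorphism \<open>\<phi>\<close> of \<open>A\<close>, the
  action of \<open>\<chi>\<close>, together with \<open>\<phi>\<close>-derivations \<open>d\<^sub>i\<close>, the actions of the \<open>\<xi>\<^sub>i\<close>, which anticommute
  with \<open>\<phi>\<close> and with each other and have square zero (\<open>right_coaction_iff_skew_system\<close>).

  The coaction belonging to such data is
  \<open>(1 + d\<^sub>1 \<otimes> g x\<^sub>1) \<circ> \<dots> \<circ> (1 + d\<^sub>n \<otimes> g x\<^sub>n)\<close> applied to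
  \<open>a \<otimes> (1 + g)/2 + \<phi> a \<otimes> (1 - g)/2\<close>. Multiplicativity and coassociativity are verified one
  factor at a time, and expanding the product gives the sum over the subsets \<open>P\<close> in the theorem
  (\<open>coact_formula\<close>). The converse, that the data determine the coaction (\<open>coaction_eqI\<close>), rests on
  partial derivatives on \<open>E(n)\<close>: an element killed by all of them lies in the span of \<open>1\<close> and \<open>g\<close>.

  It remains to determine the systems \<open>\<phi>, d\<^sub>i\<close> on a semisimple Clifford algebra with an even number
  \<open>n + 1\<close> of generators. The generators are linearly independent (\<open>clifford_independent\<close>), and an element
  of the radical of the quadratic form would generate a nilpotent ideal (\<open>clifford_radical\<close>), so \<open>A\<close> is
  generated by \<open>n + 1\<close> anticommuting elements \<open>v\<close> whose squares are nonzero scalars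
  (\<open>clifford_orthogonal_generators\<close>). For such an algebra the theorem of Skolem and Noether is
  elementary. The maps \<open>y \<mapsto> v y (\<phi> v)\<^sup>-\<^sup>1\<close> are commuting involutions. A common eigenvector becomes an
  element \<open>c\<close> with \<open>a c = c \<phi>(a)\<close> once its eigenvalues are corrected by a monomial in the \<open>v\<close>,
  which is possible because their number is even (\<open>involution_inner\<close>). Skew derivations are inner
  because they can be made inner on one generator after the other (\<open>skew_derivation_inner\<close>). The
  center of \<open>A\<close> consists of the scalars (\<open>central_scalar\<close>), and the relations satisfied by \<open>\<phi>\<close> and the
  \<open>d\<^sub>i\<close> say that \<open>c\<^sup>2\<close>, \<open>u\<^sub>i\<^sup>2\<close> and \<open>u\<^sub>i u\<^sub>j + u\<^sub>j u\<^sub>i\<close> are central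
  (\<open>skew_system_of_units\<close>, \<open>units_of_skew_system\<close>).
\<close>


section \<open>Linear maps\<close>

abbreviation linear_map where "linear_map \<equiv> Vector_Spaces.linear"

lemma linearI:
  assumes "vector_space s1" "vector_space s2"
    and "\<And>a b. f (a + b) = f a + f b" and "\<And>r a. f (s1 r a) = s2 r (f a)"
  shows "linear_map s1 s2 f"
  using assms by (simp add: Vector_Spaces.linear_iff)

lemma linear_add: "linear_map s1 s2 f \<Longrightarrow> f (a + b) = f a + f b"
  and linear_scale: "linear_map s1 s2 f \<Longrightarrow> f (s1 r a) = s2 r (f a)"
  and linear_source: "linear_map s1 s2 f \<Longrightarrow> vector_space s1"
  and linear_target: "linear_map s1 s2 f \<Longrightarrow> vector_space s2"
  by (simp_all add: Vector_Spaces.linear_iff)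

lemma linear_zero: "linear_map s1 s2 f \<Longrightarrow> f 0 = 0"
  using linear_add[of s1 s2 f 0 0] by simp

lemma linear_minus: "linear_map s1 s2 f \<Longrightarrow> f (- a) = - f a"
  using linear_add[of s1 s2 f a "- a"] linear_zero[of s1 s2 f]
  by (simp add: eq_neg_iff_add_eq_0 add.commute)

lemma linear_diff: "linear_map s1 s2 f \<Longrightarrow> f (a - b) = f a - f b"
  using linear_add[of s1 s2 f a "- b"] linear_minus[of s1 s2 f b] by simp

lemmas linear_simps = linear_add linear_scale linear_zero linear_minus linear_diff

lemma linear_sum: "linear_map s1 s2 f \<Longrightarrow> f (sum h S) = (\<Sum>x\<in>S. f (h x))"
  by (induction S rule: infinite_finite_induct) (simp_all add: linear_zero linear_add)

lemma linear_compose: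
  "linear_map s1 s2 f \<Longrightarrow> linear_map s2 s3 h \<Longrightarrow>
    linear_map s1 s3 (\<lambda>x. h (f x))"
  by (simp add: Vector_Spaces.linear_iff)

lemma linear_plus:
  "linear_map s1 s2 f \<Longrightarrow> linear_map s1 s2 h \<Longrightarrow>
    linear_map s1 s2 (\<lambda>x. f x + h x)"
  by (auto simp: Vector_Spaces.linear_iff vector_space.vector_space_assms algebra_simps)

lemma linear_scaled:
  assumes "linear_map s1 s2 f"
  shows "linear_map s1 s2 (\<lambda>x. s2 r (f x))"
proof -
  interpret vector_space s2 using assms by (rule linear_target)
  show ?thesis using assms
    by (auto simp: Vector_Spaces.linear_iff scale_right_distrib scale_scale mult.commute)
qed

lemma vector_space_field: "vector_space ((*) :: 'k::field \<Rightarrow> 'k \<Rightarrow> 'k)"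
  by unfold_locales (simp_all add: algebra_simps)

lemma vector_space_scale_zero:
  assumes "vector_space s"
  shows "s r 0 = 0"
proof -
  interpret vector_space s by fact
  show ?thesis by simp
qed

lemma (in vector_space) half_double:
  assumes "(2::'a) \<noteq> 0"
  shows "scale (1 / 2) (a + a) = a"
proof -
  have "scale (1 / 2) (a + a) = scale (1 / 2 + 1 / 2) a"
    by (simp only: scale_left_distrib scale_right_distrib)
  then show ?thesis using assms by (simp add: field_simps)
qed


section \<open>Linear extension to a free vector space\<close>

lemma lookup_fscale [simp]: "Poly_Mapping.lookup (fscale r f) x = r * Poly_Mapping.lookup f x"
  unfolding fscale_def by (simp add: Poly_Mapping.map.rep_eq when_def)

lemma vector_space_fscale: "vector_space (fscale :: 'k::field \<Rightarrow> ('x \<Rightarrow>\<^sub>0 'k) \<Rightarrow> _)"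
  by unfold_locales (auto intro!: poly_mapping_eqI simp: lookup_add algebra_simps)

interpretation free_vs: vector_space "fscale :: 'k::field \<Rightarrow> ('x \<Rightarrow>\<^sub>0 'k) \<Rightarrow> _"
  by (rule vector_space_fscale)

lemma lin_ext_superset:
  assumes "vector_space s" "finite S" "Poly_Mapping.keys f \<subseteq> S"
  shows "lin_ext s \<phi> f = (\<Sum>x\<in>S. s (Poly_Mapping.lookup f x) (\<phi> x))"
proof -
  interpret vector_space s by fact
  show ?thesis unfolding lin_ext_def
    using assms(2,3) by (intro sum.mono_neutral_left) (auto simp: in_keys_iff)
qed

lemma lin_ext_linear:
  fixes \<phi> :: "'x \<Rightarrow> 'v::ab_group_add" and s :: "'k::field \<Rightarrow> 'v \<Rightarrow> 'v"
  assumes "vector_space s"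
  shows "linear_map fscale s (lin_ext s \<phi>)"
proof (rule linearI)
  interpret vector_space s by fact
  fix f h :: "'x \<Rightarrow>\<^sub>0 'k" and r :: 'k
  let ?S = "Poly_Mapping.keys f \<union> Poly_Mapping.keys h"
  have "Poly_Mapping.keys (f + h) \<subseteq> ?S" by (rule Poly_Mapping.keys_add)
  then show "lin_ext s \<phi> (f + h) = lin_ext s \<phi> f + lin_ext s \<phi> h"
    using lin_ext_superset[OF assms, of ?S]
    by (simp add: lookup_add scale_left_distrib sum.distrib)
  have "Poly_Mapping.keys (fscale r f) \<subseteq> Poly_Mapping.keys f"
    by (auto simp: in_keys_iff)
  then show "lin_ext s \<phi> (fscale r f) = s r (lin_ext s \<phi> f)"
    using lin_ext_superset[OF assms, of "Poly_Mapping.keys f"]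
    by (simp add: scale_sum_right)
qed (fact assms vector_space_fscale)+

lemmas lin_ext_add = linear_add[OF lin_ext_linear]
  and lin_ext_diff = linear_diff[OF lin_ext_linear]
  and lin_ext_fscale = linear_scale[OF lin_ext_linear]
  and lin_ext_zero = linear_zero[OF lin_ext_linear]

lemma lin_ext_fbasis:
  assumes "vector_space s"
  shows "lin_ext s \<phi> (fbasis x) = \<phi> x"
proof -
  interpret vector_space s by fact
  show ?thesis
    using lin_ext_superset[OF assms, of "{x}" "fbasis x" \<phi>] by (simp add: fbasis_def)
qed

lemma free_expand: "f = (\<Sum>x\<in>Poly_Mapping.keys f. fscale (Poly_Mapping.lookup f x) (fbasis x))"
  by (rule poly_mapping_eqI)
    (auto simp: lookup_sum fbasis_def lookup_single when_def in_keys_iff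
       if_distrib[of "(*) _"] cong: if_cong)

text \<open>Identities between linear maps on free vector spaces, among them all the descriptions of slices
  below, are checked on basis vectors by this lemma.\<close>

lemma linear_eq_on_fbasis:
  assumes "linear_map fscale s F" "linear_map fscale s H"
    and "\<And>x. F (fbasis x) = H (fbasis x)"
  shows "F f = H f"
proof -
  have "F f = (\<Sum>x\<in>Poly_Mapping.keys f. s (Poly_Mapping.lookup f x) (F (fbasis x)))"
    by (subst free_expand) (simp add: linear_sum[OF assms(1)] linear_scale[OF assms(1)])
  also have "\<dots> = H f"
    by (subst (3) free_expand)
      (simp add: linear_sum[OF assms(2)] linear_scale[OF assms(2)] assms(3))
  finally show ?thesis .
qed

lemma linear_lin_ext:
  assumes "linear_map s s' F"
  shows "F (lin_ext s \<phi> f) = lin_ext s' (\<lambda>x. F (\<phi> x)) f"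
proof (rule linear_eq_on_fbasis)
  show "linear_map fscale s' (\<lambda>f. F (lin_ext s \<phi> f))"
    using assms linear_source[OF assms] by (intro linear_compose[OF lin_ext_linear])
  show "linear_map fscale s' (lin_ext s' (\<lambda>x. F (\<phi> x)))"
    using assms by (intro lin_ext_linear linear_target)
qed (simp add: lin_ext_fbasis linear_target[OF assms] linear_source[OF assms])

lemma lin_ext_linear_param:
  assumes "\<And>x. linear_map s s' (\<lambda>u. \<phi> u x)" "vector_space s" "vector_space s'"
  shows "linear_map s s' (\<lambda>u. lin_ext s' (\<phi> u) f)"
proof -
  interpret vector_space s' by fact
  show ?thesis unfolding lin_ext_def
  proof (rule linearI)
    fix a b r
    show "(\<Sum>x\<in>Poly_Mapping.keys f. s' (Poly_Mapping.lookup f x) (\<phi> (a + b) x)) =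
        (\<Sum>x\<in>Poly_Mapping.keys f. s' (Poly_Mapping.lookup f x) (\<phi> a x))
        + (\<Sum>x\<in>Poly_Mapping.keys f. s' (Poly_Mapping.lookup f x) (\<phi> b x))"
      by (simp add: linear_add[OF assms(1)] scale_right_distrib sum.distrib)
    show "(\<Sum>x\<in>Poly_Mapping.keys f. s' (Poly_Mapping.lookup f x) (\<phi> (s r a) x)) =
        s' r (\<Sum>x\<in>Poly_Mapping.keys f. s' (Poly_Mapping.lookup f x) (\<phi> a x))"
      by (simp add: linear_scale[OF assms(1)] scale_sum_right mult.commute)
  qed (use assms in auto)
qed

lemma lin_ext_plus_values:
  assumes "vector_space s"
  shows "lin_ext s (\<lambda>x. \<phi> x + \<psi> x) f = lin_ext s \<phi> f + lin_ext s \<psi> f"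
  by (rule linear_eq_on_fbasis[of s])
    (simp_all add: assms lin_ext_linear linear_plus lin_ext_fbasis)


section \<open>Tensors are determined by their slices\<close>

lemma tensor_null_subspace: "free_vs.subspace (tensor_null sV sW)"
  unfolding tensor_null_def by (rule free_vs.subspace_span)

lemma tensor3_null_subspace: "free_vs.subspace (tensor3_null sU sV sW)"
  unfolding tensor3_null_def by (rule free_vs.subspace_span)

lemma coset_eq_iff:
  assumes "free_vs.subspace N"
  shows "{f + z | z. z \<in> N} = {f' + z | z. z \<in> N} \<longleftrightarrow> f - f' \<in> N"
proof
  assume *: "{f + z | z. z \<in> N} = {f' + z | z. z \<in> N}"
  have "f + 0 \<in> {f + z | z. z \<in> N}" using free_vs.subspace_0[OF assms] by blast
  then obtain z where "f = f' + z" "z \<in> N" unfolding * by auto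
  then show "f - f' \<in> N" by simp
next
  assume *: "f - f' \<in> N"
  have "\<exists>w. f + z = f' + w \<and> w \<in> N" "\<exists>w. f' + z = f + w \<and> w \<in> N"
      if "z \<in> N" for z
    using free_vs.subspace_add[OF assms * that] free_vs.subspace_diff[OF assms that *]
    by (intro exI[of _ "f - f' + z"] exI[of _ "z - (f - f')"]; simp)+
  then show "{f + z | z. z \<in> N} = {f' + z | z. z \<in> N}" by blast
qed

lemma tclass_eq_iff: "tclass sV sW f = tclass sV sW f' \<longleftrightarrow> f - f' \<in> tensor_null sV sW"
  unfolding tclass_def by (rule coset_eq_iff[OF tensor_null_subspace])

lemma tclass3_eq_iff:
  "tclass3 sU sV sW f = tclass3 sU sV sW f' \<longleftrightarrow> f - f' \<in> tensor3_null sU sV sW"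
  unfolding tclass3_def by (rule coset_eq_iff[OF tensor3_null_subspace])

lemma tclass_rep:
  assumes "t \<in> range (tclass sV sW)"
  shows "tclass sV sW (rep t) = t"
proof -
  obtain f where f: "t = tclass sV sW f" using assms by blast
  have "f \<in> t" using free_vs.subspace_0[OF tensor_null_subspace, of sV sW]
    unfolding f tclass_def by (metis (mono_tags, lifting) add.right_neutral mem_Collect_eq)
  then have "rep t \<in> t" unfolding rep_def by (rule someI)
  then show ?thesis unfolding f tclass_eq_iff by (auto simp: tclass_def)
qed

definition bilinear_map where
  "bilinear_map sV sW sM B \<longleftrightarrow>
     (\<forall>w. linear_map sV sM (\<lambda>v. B v w)) \<and> (\<forall>v. linear_map sW sM (B v))"

text \<open>The universal property of the tensor product: bilinear maps kill the bilinearity relations, so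
  their linear extensions may be evaluated on arbitrary representatives.\<close>

lemma lin_ext_bilinear_null:
  assumes B: "bilinear_map sV sW sM B" and f: "f \<in> tensor_null sV sW"
  shows "lin_ext sM (\<lambda>(v, w). B v w) f = 0"
proof -
  have l: "linear_map sV sM (\<lambda>v. B v w)" "linear_map sW sM (B v)" for v w
    using B by (auto simp: bilinear_map_def)
  note vs = linear_target[OF l(1)]
  note b = lin_ext_fbasis[OF vs] lin_ext_diff[OF vs] lin_ext_fscale[OF vs]
  show ?thesis using f unfolding tensor_null_def
  proof (induction rule: free_vs.span_induct_alt)
    case base
    show ?case by (simp add: lin_ext_zero[OF vs])
  next
    case (step c x y)
    have "lin_ext sM (\<lambda>(v, w). B v w) x = 0"
      using step(1)
      by (auto simp: b linear_add[OF l(1)] linear_add[OF l(2)] linear_scale[OF l(1)]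
          linear_scale[OF l(2)])
    with step(2) show ?case
      by (simp add: lin_ext_add[OF vs] lin_ext_fscale[OF vs] vector_space_scale_zero[OF vs])
  qed
qed

lemma lin_ext_bilinear_class:
  assumes B: "bilinear_map sV sW sM B" and "tclass sV sW f = tclass sV sW f'"
  shows "lin_ext sM (\<lambda>(v, w). B v w) f = lin_ext sM (\<lambda>(v, w). B v w) f'"
proof -
  have vs: "vector_space sM" using B linear_target by (auto simp: bilinear_map_def)
  have "lin_ext sM (\<lambda>(v, w). B v w) (f - f') = 0"
    by (rule lin_ext_bilinear_null[OF B]) (use assms(2) in \<open>simp add: tclass_eq_iff\<close>)
  then show ?thesis by (simp add: lin_ext_diff[OF vs])
qed

text \<open>\<open>slice s p f\<close> is \<open>(id \<otimes> p)(f)\<close>, and \<open>slice3 s p q f\<close> is \<open>(id \<otimes> p \<otimes> q)(f)\<close>.\<close>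

definition slice where
  "slice s p f = lin_ext s (\<lambda>(v, w). s (p w) v) f"

definition slice3 where
  "slice3 s p q f = lin_ext s (\<lambda>(u, v, w). s (p v * q w) u) f"

lemma map_counit_eq_slice: "map_counit s \<epsilon> t = slice s \<epsilon> (rep t)"
  by (simp add: map_counit_def slice_def)

lemma slice_linear: "vector_space s \<Longrightarrow> linear_map fscale s (slice s p)"
  unfolding slice_def by (rule lin_ext_linear)

lemma slice_fbasis: "vector_space s \<Longrightarrow> slice s p (fbasis (v, w)) = s (p w) v"
  by (simp add: slice_def lin_ext_fbasis)

lemmas slice_add = linear_add[OF slice_linear]
  and slice_diff = linear_diff[OF slice_linear]
  and slice_fscale = linear_scale[OF slice_linear]
  and slice_sum = linear_sum[OF slice_linear]

lemma slice_bilinear: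
  assumes "vector_space sV" "linear_map sW (*) p"
  shows "bilinear_map sV sW sV (\<lambda>v w. sV (p w) v)"
proof -
  interpret vector_space sV by fact
  show ?thesis unfolding bilinear_map_def
    by (intro conjI allI linearI)
      (simp_all add: assms linear_source[OF assms(2)] linear_simps[OF assms(2)] scale_right_distrib
          scale_left_distrib mult.commute)
qed

lemma slice_class:
  assumes "vector_space sV" "linear_map sW (*) p" "tclass sV sW f = tclass sV sW f'"
  shows "slice sV p f = slice sV p f'"
  unfolding slice_def by (rule lin_ext_bilinear_class[OF slice_bilinear[OF assms(1,2)] assms(3)])

lemma slice_functional:
  assumes vs: "vector_space sV"
  shows "slice sV (\<lambda>w. p w + q w) f = slice sV p f + slice sV q f"
    and "slice sV (\<lambda>w. r * p w) f = sV r (slice sV p f)"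
proof -
  interpret vector_space sV by fact
  note l = slice_linear[OF vs]
  show "slice sV (\<lambda>w. p w + q w) f = slice sV p f + slice sV q f"
    by (rule linear_eq_on_fbasis[OF l linear_plus[OF l l]])
      (auto simp: slice_fbasis[OF vs] scale_left_distrib)
  show "slice sV (\<lambda>w. r * p w) f = sV r (slice sV p f)"
    by (rule linear_eq_on_fbasis[OF l linear_scaled[OF l]])
      (auto simp: slice_fbasis[OF vs])
qed

lemma (in vector_space) coordinate_linear:
  assumes "independent B" "span B = UNIV"
  shows "linear_map scale (*) (\<lambda>v. representation B v b)"
  by (rule linearI)
    (use assms in \<open>simp_all add: representation_add representation_scale vector_space_axioms
       vector_space_field\<close>)

lemma (in vector_space) ex_coordinates:
  shows "\<exists>B. independent B \<and> span B = UNIV"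
proof -
  obtain B where "independent B" "UNIV \<subseteq> span B"
    using maximal_independent_subset[of UNIV] by blast
  then show ?thesis by (intro exI[of _ B]) auto
qed

lemma fbasis_null:
  "fbasis (v + v', w) - fbasis (v, w) - fbasis (v', w) \<in> tensor_null sV sW"
  "fbasis (v, w + w') - fbasis (v, w) - fbasis (v, w') \<in> tensor_null sV sW"
  "fbasis (sV r v, w) - fscale r (fbasis (v, w)) \<in> tensor_null sV sW"
  "fbasis (v, sW r w) - fscale r (fbasis (v, w)) \<in> tensor_null sV sW"
  unfolding tensor_null_def by (rule free_vs.span_base; fastforce)+

lemma fbasis3_null:
  "fbasis (u + u', v, w) - fbasis (u, v, w) - fbasis (u', v, w) \<in> tensor3_null sU sV sW"
  "fbasis (u, v + v', w) - fbasis (u, v, w) - fbasis (u, v', w) \<in> tensor3_null sU sV sW"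
  "fbasis (u, v, w + w') - fbasis (u, v, w) - fbasis (u, v, w') \<in> tensor3_null sU sV sW"
  "fbasis (sU r u, v, w) - fscale r (fbasis (u, v, w)) \<in> tensor3_null sU sV sW"
  "fbasis (u, sV r v, w) - fscale r (fbasis (u, v, w)) \<in> tensor3_null sU sV sW"
  "fbasis (u, v, sW r w) - fscale r (fbasis (u, v, w)) \<in> tensor3_null sU sV sW"
  unfolding tensor3_null_def by (rule free_vs.span_base; fastforce)+

text \<open>The basis vector \<open>fbasis (v, w)\<close> is not linear in \<open>v\<close> or \<open>w\<close>, but it is linear modulo the
  bilinearity relations; this lemma replaces linearity.\<close>

lemma linear_mod_sum:
  assumes N: "free_vs.subspace N" and "vector_space s" and "finite S"
    and add: "\<And>v v'. h (v + v') - h v - h v' \<in> N"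
    and scale: "\<And>r v. h (s r v) - fscale r (h v) \<in> N"
  shows "h (\<Sum>b\<in>S. s (k b) (y b)) - (\<Sum>b\<in>S. fscale (k b) (h (y b))) \<in> N"
  using \<open>finite S\<close>
proof (induction S)
  interpret vector_space s by fact
  case empty
  show ?case using scale[of 0 0] by simp
next
  case (insert b S)
  let ?v = "\<Sum>b\<in>S. s (k b) (y b)" and ?t = "\<Sum>b\<in>S. fscale (k b) (h (y b))"
  have "(h (s (k b) (y b) + ?v) - h (s (k b) (y b)) - h ?v) +
      ((h (s (k b) (y b)) - fscale (k b) (h (y b))) + (h ?v - ?t)) \<in> N"
    by (intro free_vs.subspace_add[OF N] add scale insert.IH)
  moreover have "(h (s (k b) (y b) + ?v) - h (s (k b) (y b)) - h ?v) +
      ((h (s (k b) (y b)) - fscale (k b) (h (y b))) + (h ?v - ?t))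
      = h (s (k b) (y b) + ?v) - (fscale (k b) (h (y b)) + ?t)"
    by (simp add: algebra_simps)
  ultimately show ?case using insert.hyps by simp
qed

lemma (in vector_space) representation_expand:
  assumes "independent B" "span B = UNIV" "finite S" "{b. representation B v b \<noteq> 0} \<subseteq> S"
  shows "v = (\<Sum>b\<in>S. scale (representation B v b) b)"
proof -
  have "(\<Sum>b\<in>S. scale (representation B v b) b) =
      (\<Sum>b | representation B v b \<noteq> 0. scale (representation B v b) b)"
    by (rule sum.mono_neutral_right) (use assms in auto)
  also have "\<dots> = v" by (rule sum_nonzero_representation_eq) (use assms in auto)
  finally show ?thesis by simp
qed

text \<open>If each basis vector is, modulo \<open>N\<close>, a sum of terms \<open>h b (k b x)\<close> in which \<open>h b\<close> is linear modulo
  \<open>N\<close>, then \<open>f\<close> is modulo \<open>N\<close> the sum of the \<open>h b\<close> applied to the linear extensions of the \<open>k b\<close>.\<close>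

lemma in_null_by_coordinates:
  assumes N: "free_vs.subspace N" and vs: "vector_space s" and fin: "finite S"
    and add: "\<And>b v v'. h b (v + v') - h b v - h b v' \<in> N"
    and scale: "\<And>b r v. h b (s r v) - fscale r (h b v) \<in> N"
    and expand: "\<And>x. x \<in> Poly_Mapping.keys f \<Longrightarrow> fbasis x - (\<Sum>b\<in>S. h b (k b x)) \<in> N"
    and zero: "\<And>b. b \<in> S \<Longrightarrow> lin_ext s (k b) f = 0"
  shows "f \<in> N"
proof -
  define coord where "coord b = lin_ext fscale (\<lambda>x. h b (k b x)) f" for b
  have coord: "coord b \<in> N" if "b \<in> S" for b
  proof -
    have "h b (lin_ext s (k b) f) - coord b \<in> N"
      unfolding coord_def lin_ext_def
      by (rule linear_mod_sum[OF N vs]) (simp_all add: add scale)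
    moreover have "h b 0 \<in> N" using scale[of b 0 0] by (simp add: vector_space_scale_zero[OF vs])
    ultimately show ?thesis
      using free_vs.subspace_diff[OF N, of "h b 0" "h b 0 - coord b"] by (simp add: zero[OF that])
  qed
  have "f - (\<Sum>b\<in>S. coord b) = (\<Sum>x\<in>Poly_Mapping.keys f.
      fscale (Poly_Mapping.lookup f x) (fbasis x - (\<Sum>b\<in>S. h b (k b x))))"
    by (subst (1) free_expand[of f])
      (simp add: coord_def lin_ext_def sum.swap[of _ _ S]
        free_vs.scale_right_diff_distrib sum_subtractf free_vs.scale_sum_right)
  also have "\<dots> \<in> N"
    by (intro free_vs.subspace_sum[OF N] free_vs.subspace_scale[OF N] expand)
  finally have "f - (\<Sum>b\<in>S. coord b) + (\<Sum>b\<in>S. coord b) \<in> N"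
    by (intro free_vs.subspace_add[OF N] free_vs.subspace_sum[OF N] coord)
  then show ?thesis by simp
qed

lemma expand_factor:
  assumes N: "free_vs.subspace N" and vs: "vector_space sV" "vector_space sW"
    and B: "\<not> module.dependent sW B" "module.span sW B = UNIV" "finite S"
    and S: "{b. module.representation sW B w b \<noteq> 0} \<subseteq> S"
    and addW: "\<And>w w'. h v (w + w') - h v w - h v w' \<in> N"
    and scaleV: "\<And>r v w. h (sV r v) w - fscale r (h v w) \<in> N"
    and scaleW: "\<And>r w. h v (sW r w) - fscale r (h v w) \<in> N"
  shows "h v w - (\<Sum>b\<in>S. h (sV (module.representation sW B w b) v) b) \<in> N"
proof -
  interpret W: vector_space sW by fact
  let ?k = "W.representation B w"
  have "h v (\<Sum>b\<in>S. sW (?k b) b) - (\<Sum>b\<in>S. fscale (?k b) (h v b)) \<in> N"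
    by (rule linear_mod_sum[where y = "\<lambda>b. b"]) (simp_all add: assms)
  moreover have "(\<Sum>b\<in>S. h (sV (?k b) v) b - fscale (?k b) (h v b)) \<in> N"
    by (intro free_vs.subspace_sum[OF N] scaleV)
  ultimately have "h v (\<Sum>b\<in>S. sW (?k b) b) - (\<Sum>b\<in>S. h (sV (?k b) v) b) \<in> N"
    using free_vs.subspace_diff[OF N] by (fastforce simp: sum_subtractf)
  then show ?thesis using W.representation_expand[OF B S] by simp
qed

text \<open>Over a field the coordinate functionals with respect to a basis of the second factor already
  separate tensors: expanding every second factor in the basis turns \<open>f\<close> into
  \<open>\<Sum>b. (id \<otimes> b\<^sup>*)(f) \<otimes> b\<close>.\<close>

lemma slice_separates:
  assumes vV: "vector_space sV" and vW: "vector_space sW"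
    and eq: "\<And>p. linear_map sW (*) p \<Longrightarrow> slice sV p f = slice sV p f'"
  shows "tclass sV sW f = tclass sV sW f'"
proof -
  interpret W: vector_space sW by fact
  obtain B where B: "W.independent B" "W.span B = UNIV" using W.ex_coordinates by blast
  define S where "S = (\<Union>x\<in>Poly_Mapping.keys (f - f'). {b. W.representation B (snd x) b \<noteq> 0})"
  have finS: "finite S" unfolding S_def by (simp add: W.finite_representation)
  have "f - f' \<in> tensor_null sV sW"
  proof (rule in_null_by_coordinates[OF tensor_null_subspace vV finS,
      where h = "\<lambda>b v. fbasis (v, b)" and k = "\<lambda>b (v, w). sV (W.representation B w b) v"])
    fix x assume "x \<in> Poly_Mapping.keys (f - f')"
    then show "fbasis x - (\<Sum>b\<in>S. fbasis (case x of (v, w) \<Rightarrow> sV (W.representation B w b) v, b))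
        \<in> tensor_null sV sW"
      by (cases x, simp)
        (rule expand_factor[OF tensor_null_subspace vV vW B finS, where h = "\<lambda>v w. fbasis (v, w)"];
          force simp: S_def intro: fbasis_null)
  next
    fix b
    have "slice sV (\<lambda>w. W.representation B w b) (f - f') = 0"
      using eq[OF W.coordinate_linear[OF B]] by (simp add: slice_diff[OF vV])
    then show "lin_ext sV (\<lambda>(v, w). sV (W.representation B w b) v) (f - f') = 0"
      by (simp add: slice_def)
  qed (rule fbasis_null)+
  then show ?thesis by (simp add: tclass_eq_iff)
qed

lemma slice3_separates:
  assumes vU: "vector_space sU" and vV: "vector_space sV" and vW: "vector_space sW"
    and eq: "\<And>p q. linear_map sV (*) p \<Longrightarrow> linear_map sW (*) q \<Longrightarrow>
      slice3 sU p q f = slice3 sU p q f'"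
  shows "tclass3 sU sV sW f = tclass3 sU sV sW f'"
proof -
  interpret U: vector_space sU by fact
  interpret V: vector_space sV by fact
  interpret W: vector_space sW by fact
  obtain B where B: "V.independent B" "V.span B = UNIV" using V.ex_coordinates by blast
  obtain C where C: "W.independent C" "W.span C = UNIV" using W.ex_coordinates by blast
  let ?p = "V.representation B" and ?q = "W.representation C"
  define S where "S = (\<Union>(u, v, w)\<in>Poly_Mapping.keys (f - f'). {b. ?p v b \<noteq> 0})"
  define T where "T = (\<Union>(u, v, w)\<in>Poly_Mapping.keys (f - f'). {b. ?q w b \<noteq> 0})"
  have fin: "finite S" "finite T"
    unfolding S_def T_def by (auto simp: V.finite_representation W.finite_representation)
  let ?N = "tensor3_null sU sV sW"
  note N = tensor3_null_subspace[of sU sV sW]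
  have "f - f' \<in> ?N"
  proof (rule in_null_by_coordinates[OF N vU finite_cartesian_product[OF fin],
      where h = "\<lambda>(b, c) u. fbasis (u, b, c)" and k = "\<lambda>(b, c) (u, v, w). sU (?p v b * ?q w c) u"])
    fix x assume x: "x \<in> Poly_Mapping.keys (f - f')"
    obtain u v w where [simp]: "x = (u, v, w)" by (cases x)
    have 1: "fbasis (u', v, w) - (\<Sum>b\<in>S. fbasis (sU (?p v b) u', b, w)) \<in> ?N" for u'
      by (rule expand_factor[OF N vU vV B fin(1), where h = "\<lambda>u v. fbasis (u, v, w)"])
        (use x in \<open>force simp: S_def intro: fbasis3_null\<close>)+
    have 2: "fbasis (u', b, w) - (\<Sum>c\<in>T. fbasis (sU (?q w c) u', b, c)) \<in> ?N" for u' b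
      by (rule expand_factor[OF N vU vW C fin(2), where h = "\<lambda>u w. fbasis (u, b, w)"])
        (use x in \<open>force simp: T_def intro: fbasis3_null\<close>)+
    have "fbasis x - (\<Sum>b\<in>S. fbasis (sU (?p v b) u, b, w)) +
        (\<Sum>b\<in>S. fbasis (sU (?p v b) u, b, w)
          - (\<Sum>c\<in>T. fbasis (sU (?q w c) (sU (?p v b) u), b, c))) \<in> ?N"
      unfolding sum_subtractf[symmetric] \<open>x = (u, v, w)\<close>
      by (intro free_vs.subspace_add[OF N] free_vs.subspace_sum[OF N] 1 2)
    then show "fbasis x - (\<Sum>bc\<in>S \<times> T. (case bc of (b, c) \<Rightarrow> \<lambda>u. fbasis (u, b, c))
        ((case bc of (b, c) \<Rightarrow> \<lambda>(u, v, w). sU (?p v b * ?q w c) u) x)) \<in> ?N"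
      by (simp add: sum_subtractf sum.cartesian_product case_prod_beta mult.commute)
  next
    fix bc assume "bc \<in> S \<times> T"
    obtain b c where [simp]: "bc = (b, c)" by (cases bc)
    have "lin_ext sU (\<lambda>(u, v, w). sU (?p v b * ?q w c) u) (f - f') = 0"
      using eq[OF V.coordinate_linear[OF B] W.coordinate_linear[OF C], of b c]
      unfolding slice3_def lin_ext_diff[OF vU] by simp
    then show "lin_ext sU (case bc of (b, c) \<Rightarrow> \<lambda>(u, v, w). sU (?p v b * ?q w c) u) (f - f') = 0"
      by simp
  qed (auto intro: fbasis3_null)
  then show ?thesis by (simp add: tclass3_eq_iff)
qed

lemma slice3_class:
  assumes vU: "vector_space sU" and p: "linear_map sV (*) p"
    and q: "linear_map sW (*) q" and eq: "tclass3 sU sV sW f = tclass3 sU sV sW f'"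
  shows "slice3 sU p q f = slice3 sU p q f'"
proof -
  interpret vector_space sU by fact
  note b = lin_ext_fbasis[OF vU] lin_ext_diff[OF vU] lin_ext_fscale[OF vU] lin_ext_add[OF vU]
  note l = linear_add[OF p] linear_add[OF q] linear_scale[OF p] linear_scale[OF q]
  have "f - f' \<in> tensor3_null sU sV sW" using eq by (simp add: tclass3_eq_iff)
  then have "slice3 sU p q (f - f') = 0"
    unfolding tensor3_null_def
  proof (induction rule: free_vs.span_induct_alt)
    case base
    show ?case by (simp add: slice3_def lin_ext_zero[OF vU])
  next
    case (step c x y)
    have "slice3 sU p q x = 0"
      using step(1)
      by (elim UnE CollectE exE conjE; hypsubst)
        (simp_all add: slice3_def b l algebra_simps scale_left_distrib scale_right_distrib)
    with step(2) show ?case by (simp add: slice3_def b)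
  qed
  then show ?thesis by (simp add: slice3_def b)
qed


section \<open>Coactions in terms of slices\<close>

lemma k_algebra_vector_space: "k_algebra s \<Longrightarrow> vector_space s"
  by (rule k_algebra.axioms)

lemmas (in k_algebra) scale_out = scale_mult_left[symmetric] scale_mult_right[symmetric]

lemma linear_mult_left:
  assumes "k_algebra s"
  shows "linear_map s s (\<lambda>b. a * b)"
proof -
  interpret k_algebra s by fact
  show ?thesis
    by (rule linearI) (simp_all add: vector_space_axioms distrib_left scale_mult_right)
qed

lemma linear_mult_right:
  assumes "k_algebra s"
  shows "linear_map s s (\<lambda>b. b * a)"
proof -
  interpret k_algebra s by fact
  show ?thesis
    by (rule linearI) (simp_all add: vector_space_axioms distrib_right scale_mult_left)
qed

lemma functional_mult_left:
  "k_algebra s \<Longrightarrow> linear_map s (*) p \<Longrightarrow> linear_map s (*) (\<lambda>h. p (a * h))"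
  by (rule linear_compose[OF linear_mult_left])

lemma functional_mult_right:
  "k_algebra s \<Longrightarrow> linear_map s (*) p \<Longrightarrow> linear_map s (*) (\<lambda>h. p (h * a))"
  by (rule linear_compose[OF linear_mult_right])

lemma slice_rep_tclass:
  assumes "vector_space sV" "linear_map sW (*) p"
  shows "slice sV p (rep (tclass sV sW f)) = slice sV p f"
  by (rule slice_class[OF assms]) (simp add: tclass_rep)

lemma tensor_eq_iff_slices:
  assumes "vector_space sV" "vector_space sW"
    and "t \<in> range (tclass sV sW)" "t' \<in> range (tclass sV sW)"
  shows "t = t' \<longleftrightarrow>
    (\<forall>p. linear_map sW (*) p \<longrightarrow> slice sV p (rep t) = slice sV p (rep t'))"
  using slice_separates[OF assms(1,2), of "rep t" "rep t'"] tclass_rep[OF assms(3)]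
    tclass_rep[OF assms(4)] by auto

lemma linear_to_tensor_iff_slices:
  assumes vs: "vector_space sU" "vector_space sV" "vector_space sW"
  shows "linear_to_tensor sU sV sW F \<longleftrightarrow> (\<forall>a. F a \<in> range (tclass sV sW)) \<and>
    (\<forall>p. linear_map sW (*) p \<longrightarrow>
      linear_map sU sV (\<lambda>a. slice sV p (rep (F a))))" (is "?L \<longleftrightarrow> ?R")
proof
  assume L: ?L
  show ?R
  proof (intro conjI allI impI)
    fix p assume p: "linear_map sW (*) p"
    show "linear_map sU sV (\<lambda>a. slice sV p (rep (F a)))"
      using L slice_rep_tclass[OF vs(2) p] unfolding linear_to_tensor_def
      by (intro linearI)
        (simp_all add: vs slice_add[OF vs(2)] slice_fscale[OF vs(2)])
  qed (use L in \<open>simp add: linear_to_tensor_def\<close>)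
next
  assume R: ?R
  then have r: "F a \<in> range (tclass sV sW)" for a by blast
  have l: "linear_map sU sV (\<lambda>a. slice sV p (rep (F a)))"
    if "linear_map sW (*) p" for p using R that by blast
  show ?L unfolding linear_to_tensor_def
    by (intro conjI allI r iffD2[OF tensor_eq_iff_slices[OF vs(2,3)]] rangeI impI)
      (simp_all add: slice_rep_tclass[OF vs(2)] slice_add[OF vs(2)] slice_fscale[OF vs(2)]
        linear_simps[OF l])
qed

lemma slice_tensor_mult:
  fixes sV :: "'k::field \<Rightarrow> 'v::ring_1 \<Rightarrow> 'v" and sW :: "'k \<Rightarrow> 'w::ring_1 \<Rightarrow> 'w"
  assumes V: "k_algebra sV" and W: "k_algebra sW" and p: "linear_map sW (*) p"
  shows "slice sV p (rep (tensor_mult sV sW (tclass sV sW f) (tclass sV sW f'))) =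
    lin_ext sV (\<lambda>(v', w'). slice sV (\<lambda>h. p (h * w')) f * v') f'"
proof -
  note vV = k_algebra_vector_space[OF V] and vW = k_algebra_vector_space[OF W]
  interpret V: k_algebra sV by fact
  let ?m = "\<lambda>f f'. lin_ext fscale
    (\<lambda>(v, w). lin_ext fscale (\<lambda>(v', w'). fbasis (v * v', w * w')) f') f"
  have basis: "slice sV p (lin_ext fscale (\<lambda>(v, w). fbasis (v * v', w * w')) f) =
      slice sV (\<lambda>h. p (h * w')) f * v'" for f v' w'
    by (rule linear_eq_on_fbasis[OF
          linear_compose[OF lin_ext_linear slice_linear]
          linear_compose[OF slice_linear linear_mult_right]])
      (auto simp: vV V vector_space_fscale lin_ext_fbasis slice_fbasis V.scale_mult_left)
  have mult: "slice sV p (?m f f') = lin_ext sV (\<lambda>(v', w'). slice sV (\<lambda>h. p (h * w')) f * v') f'"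
    for f f'
  proof (rule linear_eq_on_fbasis[OF linear_compose[OF lin_ext_linear_param slice_linear]
        lin_ext_linear])
    fix x :: "'v \<times> 'w"
    obtain v w where x: "x = (v, w)" by (cases x)
    show "slice sV p (?m f (fbasis x)) =
        lin_ext sV (\<lambda>(v', w'). slice sV (\<lambda>h. p (h * w')) f * v') (fbasis x)"
      by (simp add: x lin_ext_fbasis[OF vector_space_fscale] lin_ext_fbasis[OF vV] basis
          case_prod_beta')
        (simp add: basis[unfolded case_prod_beta'])
  next
    fix x :: "'v \<times> 'w"
    show "linear_map fscale fscale
        (\<lambda>f'. case x of (v, w) \<Rightarrow> lin_ext fscale (\<lambda>(v', w'). fbasis (v *
            v', w * w')) f')"
      by (cases x) (simp add: lin_ext_linear vector_space_fscale)
  qed (simp_all add: vV vector_space_fscale)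
  have bil: "bilinear_map sV sW sV (\<lambda>v' w'. slice sV (\<lambda>h. p (h * w')) f * v')" for f
    unfolding bilinear_map_def
  proof (intro conjI allI)
    show "linear_map sV sV (\<lambda>v'. slice sV (\<lambda>h. p (h * w')) f * v')" for w'
      by (rule linear_mult_left[OF V])
    show "linear_map sW sV (\<lambda>w'. slice sV (\<lambda>h. p (h * w')) f * v')" for v'
    proof (rule linearI)
      fix w w' r
      have "sV (p (h * sW r w)) v = sV (r * p (h * w)) v" for h v
        by (simp add: linear_scale[OF functional_mult_left[OF W p]])
      then show "slice sV (\<lambda>h. p (h * sW r w)) f * v' = sV r (slice sV (\<lambda>h. p (h * w)) f * v')"
        using slice_functional(2)[OF vV, of r "\<lambda>h. p (h * w)" f]
        by (simp add: linear_scale[OF functional_mult_left[OF W p]] V.scale_mult_left)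
      show "slice sV (\<lambda>h. p (h * (w + w'))) f * v' =
          slice sV (\<lambda>h. p (h * w)) f * v' + slice sV (\<lambda>h. p (h * w')) f * v'"
        using slice_functional(1)[OF vV, of "\<lambda>h. p (h * w)" "\<lambda>h. p (h * w')" f]
        by (simp add: linear_add[OF functional_mult_left[OF W p]] distrib_right)
    qed (fact vV vW)+
  qed
  have same_class: "slice sV (\<lambda>h. p (h * w)) (rep (tclass sV sW f)) = slice sV (\<lambda>h. p (h * w)) f"
    for w by (rule slice_rep_tclass[OF vV functional_mult_right[OF W p]])
  have "slice sV p (rep (tensor_mult sV sW (tclass sV sW f) (tclass sV sW f'))) =
      lin_ext sV (\<lambda>(v', w'). slice sV (\<lambda>h. p (h * w')) f * v') (rep (tclass sV sW f'))"
    unfolding tensor_mult_def slice_rep_tclass[OF vV p] mult same_class ..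
  also have "\<dots> = lin_ext sV (\<lambda>(v', w'). slice sV (\<lambda>h. p (h * w')) f * v') f'"
    by (rule lin_ext_bilinear_class[OF bil]) (simp add: tclass_rep)
  finally show ?thesis .
qed

lemma tensor_mult_range: "tensor_mult sV sW t t' \<in> range (tclass sV sW)"
  by (simp add: tensor_mult_def)

lemma slice3_map_left:
  assumes A: "vector_space sA" and E: "vector_space sE"
    and p: "linear_map sE (*) p" and q: "linear_map sE (*) q"
    and \<rho>: "linear_to_tensor sA sA sE \<rho>"
    and eq: "map_left sA sE \<rho> t = tclass3 sA sE sE z"
  shows "slice3 sA p q z = slice sA p (rep (\<rho> (slice sA q (rep t))))"
proof -
  interpret A: vector_space sA by fact
  have l: "linear_map sA sA (\<lambda>a. slice sA p (rep (\<rho> a)))"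
    using \<rho> p linear_to_tensor_iff_slices[OF A A E] by blast
  have "slice3 sA p q z = slice3 sA p q (lin_ext fscale
      (\<lambda>(a, h). lin_ext fscale (\<lambda>(a', h'). fbasis (a', h', h)) (rep (\<rho> a)))
          (rep t))"
    by (rule slice3_class[OF A p q eq[unfolded map_left_def, symmetric]])
  also have "\<dots> = lin_ext sA (\<lambda>(a, h). slice3 sA p q
      (lin_ext fscale (\<lambda>(a', h'). fbasis (a', h', h)) (rep (\<rho> a)))) (rep t)"
    unfolding slice3_def by (subst linear_lin_ext[OF lin_ext_linear[OF A]])
      (simp add: case_prod_beta')
  also have "\<dots> = lin_ext sA (\<lambda>(a, h). sA (q h) (slice sA p (rep (\<rho> a)))) (rep t)"
  proof -
    have "slice3 sA p q (lin_ext fscale (\<lambda>(a', h'). fbasis (a', h', h)) f) =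
        sA (q h) (slice sA p f)" for f h
      unfolding slice3_def
      by (rule linear_eq_on_fbasis[OF linear_compose[OF lin_ext_linear lin_ext_linear]
            linear_scaled[OF slice_linear]])
        (auto simp: A vector_space_fscale lin_ext_fbasis slice_fbasis mult.commute)
    then show ?thesis by simp
  qed
  also have "\<dots> = slice sA p (rep (\<rho> (slice sA q (rep t))))"
    unfolding slice_def[of sA q] linear_lin_ext[OF l]
    by (simp add: case_prod_beta' linear_scale[OF l])
  finally show ?thesis .
qed

lemma slice3_map_right:
  assumes A: "vector_space sA" and E: "vector_space sE"
    and p: "linear_map sE (*) p" and q: "linear_map sE (*) q"
    and eq: "map_right sA sE \<Delta> t = tclass3 sA sE sE z"
  shows "slice3 sA p q z = slice sA (\<lambda>h. p (slice sE q (rep (\<Delta> h)))) (rep t)"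
proof -
  interpret A: vector_space sA by fact
  interpret E: vector_space sE by fact
  have "slice3 sA p q z = slice3 sA p q (lin_ext fscale
      (\<lambda>(a, h). lin_ext fscale (\<lambda>(h', h''). fbasis (a, h', h'')) (rep (\<Delta>
          h))) (rep t))"
    by (rule slice3_class[OF A p q eq[unfolded map_right_def, symmetric]])
  also have "\<dots> = lin_ext sA (\<lambda>(a, h). slice3 sA p q
      (lin_ext fscale (\<lambda>(h', h''). fbasis (a, h', h'')) (rep (\<Delta> h)))) (rep t)"
    unfolding slice3_def by (subst linear_lin_ext[OF lin_ext_linear[OF A]])
      (simp add: case_prod_beta')
  also have "\<dots> = lin_ext sA (\<lambda>(a, h). sA (p (slice sE q (rep (\<Delta> h)))) a) (rep t)"
  proof -
    have "slice3 sA p q (lin_ext fscale (\<lambda>(h', h''). fbasis (a, h', h'')) f) =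
        sA (p (slice sE q f)) a" for f a
    proof -
      have l: "linear_map (*) sA (\<lambda>r. sA r a)"
        by (rule linearI) (simp_all add: vector_space_field A A.scale_left_distrib)
      show ?thesis unfolding slice3_def
        by (rule linear_eq_on_fbasis[OF linear_compose[OF lin_ext_linear lin_ext_linear]
              linear_compose[OF linear_compose[OF slice_linear p] l]])
          (auto simp: A E vector_space_fscale lin_ext_fbasis slice_fbasis linear_scale[OF p]
            mult.commute)
    qed
    then show ?thesis by simp
  qed
  finally show ?thesis by (simp add: slice_def)
qed

text \<open>A coaction amounts to an action of the convolution algebra of linear functionals: the slice
  \<open>R p = (id \<otimes> p) \<circ> \<rho>\<close> is the action of \<open>p\<close>, coassociativity says that \<open>R p \<circ> R q\<close> is the
  action of the convolution product of \<open>p\<close> and \<open>q\<close>, and multiplicativity of \<open>\<rho>\<close> is a product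
  rule.\<close>

lemma right_coaction_iff_slices:
  fixes sA :: "'k::field \<Rightarrow> 'a::ring_1 \<Rightarrow> 'a" and sE :: "'k \<Rightarrow> 'e::ring_1 \<Rightarrow> 'e"
  assumes A: "k_algebra sA" and E: "k_algebra sE"
    and \<Delta>: "linear_to_tensor sE sE sE \<Delta>" and \<epsilon>: "linear_map sE (*) \<epsilon>"
  defines "R \<equiv> \<lambda>\<rho> p a. slice sA p (rep (\<rho> a))"
  shows "right_coaction sA sE \<Delta> \<epsilon> \<rho> \<longleftrightarrow>
    (\<forall>a. \<rho> a \<in> range (tclass sA sE)) \<and> (\<forall>a. R \<rho> \<epsilon> a =
        a) \<and>
    (\<forall>p. linear_map sE (*) p \<longrightarrow>
      linear_map sA sA (R \<rho> p) \<and>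
      R \<rho> p 1 = sA (p 1) 1 \<and>
      (\<forall>a b. R \<rho> p (a * b) =
        lin_ext sA (\<lambda>(b', h). R \<rho> (\<lambda>k. p (k * h)) a * b') (rep (\<rho> b))) \<and>
      (\<forall>q a. linear_map sE (*) q \<longrightarrow>
        R \<rho> p (R \<rho> q a) = R \<rho> (\<lambda>h. p (slice sE q (rep (\<Delta> h)))) a))"
proof -
  note vA = k_algebra_vector_space[OF A] and vE = k_algebra_vector_space[OF E]
  have lin: "linear_to_tensor sA sA sE \<rho> \<longleftrightarrow> (\<forall>a. \<rho> a \<in> range (tclass sA sE)) \<and>
      (\<forall>p. linear_map sE (*) p \<longrightarrow> linear_map sA sA (R \<rho> p))"
    unfolding R_def by (rule linear_to_tensor_iff_slices[OF vA vA vE])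
  have one: "\<rho> 1 = tclass sA sE (fbasis (1, 1)) \<longleftrightarrow>
      (\<forall>p. linear_map sE (*) p \<longrightarrow> R \<rho> p 1 = sA (p 1) 1)"
    if "\<forall>a. \<rho> a \<in> range (tclass sA sE)"
    unfolding R_def tensor_eq_iff_slices[OF vA vE that[rule_format] rangeI]
    by (simp add: slice_rep_tclass[OF vA] slice_fbasis[OF vA])
  have mult: "\<rho> (a * b) = tensor_mult sA sE (\<rho> a) (\<rho> b) \<longleftrightarrow>
      (\<forall>p. linear_map sE (*) p \<longrightarrow> R \<rho> p (a * b) =
        lin_ext sA (\<lambda>(b', h). R \<rho> (\<lambda>k. p (k * h)) a * b') (rep (\<rho> b)))"
    if r: "\<forall>a. \<rho> a \<in> range (tclass sA sE)" for a b
  proof -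
    have "tensor_mult sA sE (\<rho> a) (\<rho> b) =
        tensor_mult sA sE (tclass sA sE (rep (\<rho> a))) (tclass sA sE (rep (\<rho> b)))"
      using r by (simp add: tclass_rep)
    then show ?thesis
      using r tensor_mult_range[of sA sE "\<rho> a" "\<rho> b"]
      by (simp add: R_def tensor_eq_iff_slices[OF vA vE] slice_tensor_mult[OF A E])
  qed
  have coassoc: "map_left sA sE \<rho> (\<rho> a) = map_right sA sE \<Delta> (\<rho> a) \<longleftrightarrow>
      (\<forall>p q. linear_map sE (*) p \<longrightarrow> linear_map sE (*) q \<longrightarrow>
        R \<rho> p (R \<rho> q a) = R \<rho> (\<lambda>h. p (slice sE q (rep (\<Delta> h)))) a)"
    if \<rho>: "linear_to_tensor sA sA sE \<rho>" for a
  proof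
    obtain z z' where z: "map_left sA sE \<rho> (\<rho> a) = tclass3 sA sE sE z"
        "map_right sA sE \<Delta> (\<rho> a) = tclass3 sA sE sE z'"
      by (simp add: map_left_def map_right_def)
    note l = slice3_map_left[OF vA vE _ _ \<rho> z(1)] and r = slice3_map_right[OF vA vE _ _ z(2)]
    show "\<forall>p q. linear_map sE (*) p \<longrightarrow> linear_map sE (*) q \<longrightarrow>
        R \<rho> p (R \<rho> q a) = R \<rho> (\<lambda>h. p (slice sE q (rep (\<Delta> h)))) a"
      if "map_left sA sE \<rho> (\<rho> a) = map_right sA sE \<Delta> (\<rho> a)"
      using that slice3_class[OF vA, of sE _ sE _ z z'] by (simp add: R_def z l[symmetric] r[symmetric])
    show "map_left sA sE \<rho> (\<rho> a) = map_right sA sE \<Delta> (\<rho> a)"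
      if "\<forall>p q. linear_map sE (*) p \<longrightarrow> linear_map sE (*) q \<longrightarrow>
        R \<rho> p (R \<rho> q a) = R \<rho> (\<lambda>h. p (slice sE q (rep (\<Delta> h)))) a"
      unfolding z by (rule slice3_separates[OF vA vE vE]) (use that in \<open>simp add: R_def l r\<close>)
  qed
  have counit: "map_counit sA \<epsilon> (\<rho> a) = R \<rho> \<epsilon> a" for a
    by (simp add: map_counit_eq_slice R_def)
  show ?thesis
  proof (cases "linear_to_tensor sA sA sE \<rho>")
    case True
    then have r: "\<forall>a. \<rho> a \<in> range (tclass sA sE)" and
      l: "\<forall>p. linear_map sE (*) p \<longrightarrow> linear_map sA sA (R \<rho> p)"
      using lin by auto
    show ?thesis
      unfolding right_coaction_def alg_hom_to_tensor_def counit one[OF r] mult[OF r]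
        coassoc[OF True]
      using True r l by blast
  next
    case False
    then show ?thesis using lin by (auto simp: right_coaction_def alg_hom_to_tensor_def)
  qed
qed


section \<open>Algebras given by a presentation\<close>

lemma foldr_linear:
  assumes "\<And>y. y \<in> \<Gamma> \<Longrightarrow> linear_map s s (T y)" "vector_space s" "u \<in> lists \<Gamma>"
  shows "linear_map s s (foldr T u)"
  using assms(3)
proof (induction u)
  case Nil
  show ?case by (simp add: linearI assms(2))
next
  case (Cons y u)
  then show ?case using linear_compose[OF Cons.IH assms(1)] by (simp add: comp_def)
qed

lemma fbasis_mult: "fbasis u * fbasis v = fbasis (u @ v)"
  by (simp add: fbasis_def mult_single plus_list_def)

lemma fbasis_Nil: "fbasis [] = 1"
  by (simp add: fbasis_def single_one flip: zero_list_def)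

lemma k_algebra_free: "k_algebra (fscale :: 'k::field \<Rightarrow> ('g list \<Rightarrow>\<^sub>0 'k) \<Rightarrow> _)"
proof -
  have left: "fscale r a = Poly_Mapping.single 0 r * a" for r and a :: "'g list \<Rightarrow>\<^sub>0 'k"
    unfolding fscale_def by (rule mult_map_scale_conv_mult)
  have right: "fscale r a = a * Poly_Mapping.single 0 r" for r and a :: "'g list \<Rightarrow>\<^sub>0 'k"
  proof -
    have basis: "Poly_Mapping.single 0 r * fscale c (fbasis w) = fscale c (fbasis w) * Poly_Mapping.single 0 r"
      for c and w :: "'g list"
      unfolding left[of c] by (simp add: fbasis_def mult_single mult.commute)
    have "Poly_Mapping.single 0 r * a = a * Poly_Mapping.single 0 r"
      by (subst (1 2) free_expand[of a]) (simp add: sum_distrib_left sum_distrib_right basis)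
    then show ?thesis by (simp add: left)
  qed
  show ?thesis
  proof (intro k_algebra.intro vector_space_fscale k_algebra_axioms.intro)
    fix r and a b :: "'g list \<Rightarrow>\<^sub>0 'k"
    show "fscale r (a * b) = fscale r a * b" by (simp add: left mult.assoc)
    show "fscale r (a * b) = a * fscale r b" by (simp add: right mult.assoc)
  qed
qed

lemma presented_algebra_k_algebra: "presented_algebra s \<Gamma> R \<gamma> \<Longrightarrow> k_algebra s"
  by (simp add: presented_algebra_def)

lemma eval_free_fbasis: "vector_space s \<Longrightarrow> eval_free s \<gamma> (fbasis w) = prod_list (map \<gamma> w)"
  by (simp add: eval_free_def lin_ext_fbasis)

lemma eval_free_linear: "vector_space s \<Longrightarrow> linear_map fscale s (eval_free s \<gamma>)"
  unfolding eval_free_def by (rule lin_ext_linear)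

lemma free_algebra_linear_closed:
  "f \<in> free_algebra \<Gamma> \<Longrightarrow> f' \<in> free_algebra \<Gamma> \<Longrightarrow> f + f' \<in> free_algebra \<Gamma>"
  "f \<in> free_algebra \<Gamma> \<Longrightarrow> f' \<in> free_algebra \<Gamma> \<Longrightarrow> f - f' \<in> free_algebra \<Gamma>"
  "f \<in> free_algebra \<Gamma> \<Longrightarrow> fscale r f \<in> free_algebra \<Gamma>"
  "w \<in> lists \<Gamma> \<Longrightarrow> fbasis w \<in> free_algebra \<Gamma>"
proof -
  show "f \<in> free_algebra \<Gamma> \<Longrightarrow> f' \<in> free_algebra \<Gamma> \<Longrightarrow> f + f' \<in> free_algebra \<Gamma>"
    "f \<in> free_algebra \<Gamma> \<Longrightarrow> f' \<in> free_algebra \<Gamma> \<Longrightarrow> f - f' \<in> free_algebra \<Gamma>"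
    unfolding free_algebra_def using Poly_Mapping.keys_add[of f f'] Poly_Mapping.keys_diff[of f f']
    by blast+
  show "f \<in> free_algebra \<Gamma> \<Longrightarrow> fscale r f \<in> free_algebra \<Gamma>"
    "w \<in> lists \<Gamma> \<Longrightarrow> fbasis w \<in> free_algebra \<Gamma>"
    by (auto simp: free_algebra_def fbasis_def subset_eq in_keys_iff)
qed

lemma presented_algebra_induct:
  assumes pres: "presented_algebra s \<Gamma> R \<gamma>"
    and one: "P 1" and add: "\<And>a b. P a \<Longrightarrow> P b \<Longrightarrow> P (a + b)"
    and scale: "\<And>r a. P a \<Longrightarrow> P (s r a)" and mult: "\<And>y a. y \<in> \<Gamma> \<Longrightarrow> P a \<Longrightarrow> P (\<gamma> y * a)"
  shows "P a"
proof -
  interpret k_algebra s using pres by (rule presented_algebra_k_algebra)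
  obtain f where f: "f \<in> free_algebra \<Gamma>" and a: "a = eval_free s \<gamma> f"
    using pres unfolding presented_algebra_def by blast
  have word: "P (prod_list (map \<gamma> w))" if "w \<in> lists \<Gamma>" for w
    using that by (induction w) (simp_all add: one mult)
  have sum: "P (\<Sum>x\<in>S. s (k x) (h x))" if "finite S" "\<And>x. x \<in> S \<Longrightarrow> P (h x)" for k h S
    using that
  proof (induction S)
    case empty
    show ?case using scale[OF one, of 0] by simp
  qed (simp add: add scale)
  show ?thesis
    unfolding a eval_free_def lin_ext_def
    using f by (intro sum word) (simp_all add: free_algebra_def subsetD)
qed

lemma presented_algebra_relation:
  assumes pres: "presented_algebra s \<Gamma> R \<gamma>" and "r \<in> R" "r \<in> free_algebra \<Gamma>"
  shows "eval_free s \<gamma> r = 0"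
proof -
  have "fbasis [] * r * fbasis [] \<in> ideal_gen \<Gamma> R"
    unfolding ideal_gen_def
    by (rule free_vs.span_base) (use \<open>r \<in> R\<close> in \<open>blast intro: lists.Nil\<close>)
  then show ?thesis using assms by (simp add: fbasis_Nil presented_algebra_def)
qed

lemma gen_mult: "gen y * gen z = fbasis [y, z]"
  by (simp add: gen_def fbasis_mult)

lemma const_eq: "const r = fscale r (fbasis [])"
  by (simp add: const_def fbasis_Nil)

lemma presented_algebra_product:
  fixes s :: "'k::field \<Rightarrow> 'a::ring_1 \<Rightarrow> 'a"
  assumes pres: "presented_algebra s \<Gamma> R \<gamma>" and yz: "y \<in> \<Gamma>" "z \<in> \<Gamma>"
  shows "gen y * gen z - const b \<in> R \<Longrightarrow> \<gamma> y * \<gamma> z = s b 1"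
    and "gen y * gen z + gen z * gen y - const b \<in> R \<Longrightarrow> \<gamma> y * \<gamma> z + \<gamma> z * \<gamma> y = s b 1"
proof -
  note rel = presented_algebra_relation[OF pres]
  interpret k_algebra s using pres by (rule presented_algebra_k_algebra)
  note ev = eval_free_linear[OF vector_space_axioms, of \<gamma>]
  note ev_simps = linear_simps[OF ev] gen_mult const_eq eval_free_fbasis[OF vector_space_axioms]
  have words: "gen y * gen z \<in> (free_algebra \<Gamma> :: (_ \<Rightarrow>\<^sub>0 'k) set)"
    "gen z * gen y \<in> (free_algebra \<Gamma> :: (_ \<Rightarrow>\<^sub>0 'k) set)" "const b \<in> free_algebra \<Gamma>"
    unfolding gen_mult const_eq using yz by (auto intro!: free_algebra_linear_closed(3,4))
  show "\<gamma> y * \<gamma> z = s b 1" if "gen y * gen z - const b \<in> R"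
    using rel[OF that] words by (simp add: free_algebra_linear_closed(2) ev_simps)
  show "\<gamma> y * \<gamma> z + \<gamma> z * \<gamma> y = s b 1" if "gen y * gen z + gen z * gen y - const b \<in> R"
    using rel[OF that] words by (simp add: free_algebra_linear_closed(1,2) ev_simps)
qed

text \<open>The presented algebra acts on every module over the free algebra that is killed by the
  relations. The map \<open>L\<close> below is \<open>a \<mapsto> a \<cdot> m\<close> for such a module and one element \<open>m\<close> of it. This is
  how linear maps out of a presented algebra are obtained here.\<close>

lemma presented_algebra_lift:
  assumes pres: "presented_algebra s \<Gamma> R \<gamma>" and M: "vector_space sM"
    and T: "\<And>y. y \<in> \<Gamma> \<Longrightarrow> linear_map sM sM (T y)"
    and rel: "\<And>r m. r \<in> R \<Longrightarrow> lin_ext sM (\<lambda>w. foldr T w m) r = 0"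
  shows "\<exists>L. linear_map s sM L \<and> L 1 = m \<and> (\<forall>y\<in>\<Gamma>. \<forall>a. L (\<gamma> y * a) = T y (L a))"
proof -
  interpret k_algebra s using pres by (rule presented_algebra_k_algebra)
  interpret M: vector_space sM by fact
  define act where "act m = lin_ext sM (\<lambda>w. foldr T w m)" for m
  have act_linear: "linear_map fscale sM (act m)" for m
    unfolding act_def by (rule lin_ext_linear[OF M])
  have act_word: "act m (fbasis w) = foldr T w m" for m w
    by (simp add: act_def lin_ext_fbasis[OF M])
  have act_mult: "act m (fbasis u * r * fbasis v) = foldr T u (act (foldr T v m) r)"
    if "u \<in> lists \<Gamma>" for u v r m
  proof (rule linear_eq_on_fbasis)
    show "linear_map fscale sM (\<lambda>r. act m (fbasis u * r * fbasis v))"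
      by (intro linear_compose[OF linear_compose[OF linear_mult_left linear_mult_right] act_linear]
          k_algebra_free)
    show "linear_map fscale sM (\<lambda>r. foldr T u (act (foldr T v m) r))"
      by (rule linear_compose[OF act_linear foldr_linear[OF T M that]])
  qed (simp add: fbasis_mult act_word)
  have act_ideal: "act m f = 0" if "f \<in> ideal_gen \<Gamma> R" for m f
    using that unfolding ideal_gen_def
  proof (induction rule: free_vs.span_induct_alt)
    case base
    show ?case by (rule linear_zero[OF act_linear])
  next
    case (step c x y)
    then obtain u r v where "x = fbasis u * r * fbasis v" "u \<in> lists \<Gamma>" "r \<in> R" by blast
    moreover from this have "act (foldr T v m) r = 0" "foldr T u 0 = 0"
      using rel linear_zero[OF foldr_linear[where T = T and \<Gamma> = \<Gamma>, OF T M]]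
      by (simp_all add: act_def)
    ultimately have "act m x = 0" by (simp add: act_mult)
    with step(2) show ?case by (simp add: linear_simps[OF act_linear])
  qed
  have "\<exists>f. f \<in> free_algebra \<Gamma> \<and> eval_free s \<gamma> f = a" for a
  proof -
    have "a \<in> eval_free s \<gamma> ` free_algebra \<Gamma>" using pres by (simp add:
        presented_algebra_def)
    then show ?thesis by blast
  qed
  then obtain word where word: "\<And>a. word a \<in> free_algebra \<Gamma>" "\<And>a. eval_free s \<gamma> (word a) = a"
    by metis
  note ev = eval_free_linear[OF vector_space_axioms, of \<gamma>]
  have unique: "act m (word (eval_free s \<gamma> f)) = act m f" if "f \<in> free_algebra \<Gamma>"
      for f
  proof -
    have "eval_free s \<gamma> (word (eval_free s \<gamma> f) - f) = 0"
      by (simp add: linear_diff[OF ev] word)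
    then have "act m (word (eval_free s \<gamma> f) - f) = 0"
      using pres act_ideal free_algebra_linear_closed(2)[OF word(1) that]
      by (simp add: presented_algebra_def)
    then show ?thesis by (simp add: linear_diff[OF act_linear])
  qed
  show ?thesis
  proof (intro exI[of _ "\<lambda>a. act m (word a)"] conjI ballI allI)
    show "linear_map s sM (\<lambda>a. act m (word a))"
    proof (rule linearI)
      fix a b r
      show "act m (word (a + b)) = act m (word a) + act m (word b)"
        using unique[OF free_algebra_linear_closed(1)[OF word(1) word(1)], of a b]
        by (simp add: linear_add[OF ev] linear_add[OF act_linear] word)
      show "act m (word (s r a)) = sM r (act m (word a))"
        using unique[OF free_algebra_linear_closed(3)[OF word(1)], of r a]
        by (simp add: linear_scale[OF ev] linear_scale[OF act_linear] word)
    qed (fact vector_space_axioms M)+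
    show "act m (word 1) = m"
      using unique[OF free_algebra_linear_closed(4)[OF lists.Nil]]
      by (simp add: eval_free_fbasis[OF vector_space_axioms] act_word)
  next
    fix y a assume y: "y \<in> \<Gamma>"
    have ev_mult: "eval_free s \<gamma> (fbasis [y] * f) = \<gamma> y * eval_free s \<gamma> f" for f
      by (rule linear_eq_on_fbasis[OF linear_compose[OF linear_mult_left ev]
            linear_compose[OF ev linear_mult_left]])
        (simp_all add: k_algebra_free k_algebra_axioms fbasis_mult
          eval_free_fbasis[OF vector_space_axioms])
    have "fbasis [y] * word a \<in> free_algebra \<Gamma>"
    proof -
      have "fbasis [y] * word a = (\<Sum>x\<in>Poly_Mapping.keys (word a).
          fscale (Poly_Mapping.lookup (word a) x) (fbasis (y # x)))"
        by (subst (1) free_expand[of "word a"])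
          (simp add: sum_distrib_left k_algebra.scale_mult_right[OF k_algebra_free, symmetric]
            fbasis_mult)
      moreover have "free_vs.subspace (free_algebra \<Gamma>)"
        by (rule free_vs.subspaceI, simp add: free_algebra_def)
          (blast intro: free_algebra_linear_closed)+
      moreover have "y # x \<in> lists \<Gamma>" if "x \<in> Poly_Mapping.keys (word a)" for x
        using that y word(1)[of a] by (auto simp: free_algebra_def)
      ultimately show ?thesis
        by (simp only:) (intro free_vs.subspace_sum free_vs.subspace_scale
            free_algebra_linear_closed(4); assumption)
    qed
    from unique[OF this] have "act m (word (\<gamma> y * a)) = act m (fbasis [y] * word a)"
      by (simp add: ev_mult word)
    also have "\<dots> = T y (act m (word a))"
      using act_mult[of "[y]" m "word a" "[]"] y by (simp add: fbasis_Nil)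
    finally show "act m (word (\<gamma> y * a)) = T y (act m (word a))" .
  qed
qed


section \<open>The bialgebra E(n) and its skew-primitive functionals\<close>

locale E_hopf =
  fixes sE :: "'k::field \<Rightarrow> 'e::ring_1 \<Rightarrow> 'e" and n :: nat and g :: 'e and x
      :: "nat \<Rightarrow> 'e"
    and \<Delta> :: "'e \<Rightarrow> ('k, 'e, 'e) tensor" and \<epsilon> :: "'e \<Rightarrow> 'k"
        and S :: "'e \<Rightarrow> 'e"
  assumes E_hopf: "E_hopf_algebra sE n g x \<Delta> \<epsilon> S"
    and two: "(2::'k) \<noteq> 0"
begin

lemma presented: "presented_algebra sE (cl_gens n) (E_relations n) (case_cl_gen g x)"
  using E_hopf by (simp add: E_hopf_algebra_def)

sublocale E: k_algebra sE
  by (rule presented_algebra_k_algebra[OF presented])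

lemma vE: "vector_space sE" and kE: "k_algebra sE"
  by (rule E.vector_space_axioms E.k_algebra_axioms)+

abbreviation functional :: "('e \<Rightarrow> 'k) \<Rightarrow> bool" where
  "functional \<equiv> linear_map sE (*)"

lemma relations:
  shows gg: "g * g = 1"
    and xx: "i \<in> {1..n} \<Longrightarrow> x i * x i = 0"
    and gx: "i \<in> {1..n} \<Longrightarrow> g * x i = - (x i * g)"
    and xx_swap: "i \<in> {1..n} \<Longrightarrow> j \<in> {1..n} \<Longrightarrow> x i * x j = - (x j * x i)"
proof -
  note prod = presented_algebra_product[OF presented]
  have c: "const 0 = (0 :: cl_gen list \<Rightarrow>\<^sub>0 'k)" "const 1 = (1 :: cl_gen list \<Rightarrow>\<^sub>0 'k)"
    by (simp_all add: const_def)
  have G: "Gen_G \<in> cl_gens n" and X: "\<And>i. i \<in> {1..n} \<Longrightarrow> Gen_X i \<in> cl_gens n"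
    by (simp_all add: cl_gens_def)
  show "g * g = 1"
    using prod(1)[OF G G, of 1] by (simp add: E_relations_def c)
  show "x i * x i = 0" if "i \<in> {1..n}"
    using prod(1)[OF X[OF that] X[OF that], of 0] that by (auto simp: E_relations_def c)
  show "g * x i = - (x i * g)" if "i \<in> {1..n}"
    using prod(2)[OF G X[OF that], of 0] that by (auto simp: E_relations_def c eq_neg_iff_add_eq_0)
  show "x i * x j = - (x j * x i)" if i: "i \<in> {1..n}" and j: "j \<in> {1..n}"
  proof -
    have "gen (Gen_X i) * gen (Gen_X j) + gen (Gen_X j) * gen (Gen_X i) - const 0
        \<in> (E_relations n :: (_ \<Rightarrow>\<^sub>0 'k) set)"
      unfolding c diff_0_right E_relations_def using i j by blast
    from prod(2)[OF X[OF i] X[OF j] this] show ?thesis by (simp add: eq_neg_iff_add_eq_0)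
  qed
qed

lemma E_induct [case_names one add scale g x]:
  assumes "P 1" "\<And>a b. P a \<Longrightarrow> P b \<Longrightarrow> P (a + b)" "\<And>r a. P a \<Longrightarrow> P (sE r a)"
    and "\<And>a. P a \<Longrightarrow> P (g * a)" "\<And>i a. i \<in> {1..n} \<Longrightarrow> P a \<Longrightarrow> P (x i * a)"
  shows "P h"
  by (rule presented_algebra_induct[OF presented, of P])
    (use assms in \<open>auto simp: cl_gens_def\<close>)

lemma E_lift:
  assumes M: "vector_space sM" and T: "linear_map sM sM TG"
      "\<And>i. i \<in> {1..n} \<Longrightarrow> linear_map sM sM (TX i)"
    and rel: "\<And>m. TG (TG m) = m" "\<And>i m. i \<in> {1..n} \<Longrightarrow> TG (TX i m) = - TX i (TG m)"
      "\<And>i j m. i \<in> {1..n} \<Longrightarrow> j \<in> {1..n} \<Longrightarrow> TX i (TX j m) = 0"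
  shows "\<exists>L. linear_map sE sM L \<and> L 1 = m \<and> (\<forall>a. L (g * a) = TG (L a)) \<and>
    (\<forall>i\<in>{1..n}. \<forall>a. L (x i * a) = TX i (L a))"
proof -
  have "\<exists>L. linear_map sE sM L \<and> L 1 = m \<and>
      (\<forall>y\<in>cl_gens n. \<forall>a. L (case_cl_gen g x y * a) = case_cl_gen TG TX y (L a))"
  proof (rule presented_algebra_lift[OF presented M])
    show "linear_map sM sM (case_cl_gen TG TX y)" if "y \<in> cl_gens n" for y
      using that T by (auto simp: cl_gens_def)
    show "lin_ext sM (\<lambda>w. foldr (case_cl_gen TG TX) w m) r = 0" if "r \<in> E_relations n"
        for r m
      using that
      by (auto simp: E_relations_def gen_mult fbasis_Nil[symmetric] lin_ext_add[OF M]
          lin_ext_diff[OF M] lin_ext_fbasis[OF M] rel)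
  qed
  then show ?thesis by (auto simp: cl_gens_def)
qed

lemma counit_values:
  shows counit_linear: "functional \<epsilon>" and counit_one: "\<epsilon> 1 = 1"
    and counit_mult: "\<epsilon> (a * b) = \<epsilon> a * \<epsilon> b" and counit_g: "\<epsilon> g = 1"
    and counit_x: "i \<in> {1..n} \<Longrightarrow> \<epsilon> (x i) = 0"
  using E_hopf by (simp_all add: E_hopf_algebra_def)

text \<open>The character \<open>\<chi>\<close> with \<open>g \<mapsto> -1\<close>, \<open>x\<^sub>i \<mapsto> 0\<close>, and for each \<open>i\<close> the functional \<open>\<xi>\<^sub>i\<close> with
  \<open>\<xi>\<^sub>i (a b) = \<xi>\<^sub>i a \<epsilon> b + \<chi> a \<xi>\<^sub>i b\<close>, \<open>g \<mapsto> 0\<close>, \<open>x\<^sub>j \<mapsto> - \<delta>\<^sub>i\<^sub>j\<close>. They are matrix entries of the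
  two-dimensional representation \<open>g \<mapsto> diag(-1, 1)\<close>, \<open>x\<^sub>j \<mapsto> - \<delta>\<^sub>i\<^sub>j e\<^sub>1\<^sub>2\<close>.\<close>

lemma ex_character:
  "\<exists>\<chi>. functional \<chi> \<and> \<chi> 1 = 1 \<and> (\<forall>a. \<chi> (g * a) = - \<chi> a) \<and> (\<forall>i\<in>{1..n}. \<forall>a. \<chi> (x i * a) = 0)"
  by (rule E_lift[where TG = "\<lambda>m. - m" and TX = "\<lambda>_ _. 0"])
    (auto intro!: linearI vector_space_field)

lemma ex_skew_primitive:
  "\<exists>\<xi>. functional \<xi> \<and> \<xi> 1 = 0 \<and> (\<forall>a. \<xi> (g * a) = - \<xi> a) \<and>
    (\<forall>j\<in>{1..n}. \<forall>a. \<xi> (x j * a) = (if j = i then - \<epsilon> a else 0))"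
proof -
  define s2 :: "'k \<Rightarrow> 'k \<times> 'k \<Rightarrow> 'k \<times> 'k" where "s2 r m = (r * fst m, r * snd m)" for r m
  have vs: "vector_space s2"
    by unfold_locales (simp_all add: s2_def algebra_simps)
  have "\<exists>L. linear_map sE s2 L \<and> L 1 = (0, 1) \<and>
      (\<forall>a. L (g * a) = (- fst (L a), snd (L a))) \<and>
      (\<forall>j\<in>{1..n}. \<forall>a. L (x j * a) = (if j = i then - snd (L a) else 0, 0))"
    by (rule E_lift[where TG = "\<lambda>m. (- fst m, snd m)"
          and TX = "\<lambda>j m. (if j = i then - snd m else 0, 0)", OF vs])
      (auto intro!: linearI vs simp: s2_def zero_prod_def)
  then obtain L where L: "linear_map sE s2 L" "L 1 = (0, 1)"
      "\<And>a. L (g * a) = (- fst (L a), snd (L a))"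
      "\<And>j a. j \<in> {1..n} \<Longrightarrow> L (x j * a) = (if j = i then - snd (L a) else 0, 0)"
    by blast
  have "snd (L a) = \<epsilon> a" for a
    by (induction a rule: E_induct)
      (auto simp: L(2-4) counit_values linear_simps[OF L(1)]
        linear_simps[OF counit_linear] s2_def)
  moreover have "functional (\<lambda>a. fst (L a))"
    by (rule linearI)
      (simp_all add: vE vector_space_field linear_simps[OF L(1)] s2_def)
  ultimately show ?thesis
    by (intro exI[of _ "\<lambda>a. fst (L a)"]) (auto simp: L(2-4))
qed

definition \<chi> :: "'e \<Rightarrow> 'k" where
  "\<chi> = (SOME \<chi>. functional \<chi> \<and> \<chi> 1 = 1 \<and> (\<forall>a. \<chi> (g * a) = - \<chi> a) \<and>
    (\<forall>i\<in>{1..n}. \<forall>a. \<chi> (x i * a) = 0))"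

definition \<xi> :: "nat \<Rightarrow> 'e \<Rightarrow> 'k" where
  "\<xi> i = (SOME \<xi>. functional \<xi> \<and> \<xi> 1 = 0 \<and> (\<forall>a. \<xi> (g * a) = - \<xi> a) \<and>
    (\<forall>j\<in>{1..n}. \<forall>a. \<xi> (x j * a) = (if j = i then - \<epsilon> a else 0)))"

lemma chi:
  shows chi_linear: "functional \<chi>" and chi_one: "\<chi> 1 = 1" and chi_g: "\<chi> (g * a) = - \<chi> a"
    and chi_x: "i \<in> {1..n} \<Longrightarrow> \<chi> (x i * a) = 0"
  using someI_ex[OF ex_character] unfolding \<chi>_def by blast+

lemma xi:
  shows xi_linear: "functional (\<xi> i)" and xi_one: "\<xi> i 1 = 0" and xi_g: "\<xi> i (g * a) = - \<xi> i a"
    and xi_x: "j \<in> {1..n} \<Longrightarrow> \<xi> i (x j * a) = (if j = i then - \<epsilon> a else 0)"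
  using someI_ex[OF ex_skew_primitive, of i] unfolding \<xi>_def by blast+

lemma chi_mult: "\<chi> (a * b) = \<chi> a * \<chi> b"
  by (induction a rule: E_induct)
    (auto simp: chi distrib_right linear_simps[OF chi_linear]
      E.scale_mult_left[symmetric] mult.assoc)

lemma xi_mult: "\<xi> i (a * b) = \<xi> i a * \<epsilon> b + \<chi> a * \<xi> i b"
  by (induction a rule: E_induct)
    (auto simp: chi xi distrib_right linear_simps[OF chi_linear]
      linear_simps[OF xi_linear] counit_mult
      E.scale_mult_left[symmetric] mult.assoc algebra_simps)

text \<open>\<open>hat q\<close> is the operator \<open>(id \<otimes> q) \<circ> \<Delta>\<close>, so that \<open>p \<circ> hat q\<close> is the convolution product of the
  functionals \<open>p\<close> and \<open>q\<close>.\<close>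

definition hat :: "('e \<Rightarrow> 'k) \<Rightarrow> 'e \<Rightarrow> 'e" where
  "hat q h = slice sE q (rep (\<Delta> h))"

lemma comult:
  shows comult_linear: "linear_to_tensor sE sE sE \<Delta>"
    and comult_one: "\<Delta> 1 = tclass sE sE (fbasis (1, 1))"
    and comult_mult: "\<Delta> (a * b) = tensor_mult sE sE (\<Delta> a) (\<Delta> b)"
    and comult_g: "\<Delta> g = tclass sE sE (fbasis (g, g))"
    and comult_x: "i \<in> {1..n} \<Longrightarrow> \<Delta> (x i) = tclass sE sE (fbasis (x i, g) + fbasis (1, x i))"
  using E_hopf by (simp_all add: E_hopf_algebra_def alg_hom_to_tensor_def)

lemma comult_rep: "tclass sE sE (rep (\<Delta> h)) = \<Delta> h"
  using comult_linear by (intro tclass_rep) (simp add: linear_to_tensor_def)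

lemma hat_linear: "functional q \<Longrightarrow> linear_map sE sE (hat q)"
  using comult_linear unfolding hat_def linear_to_tensor_iff_slices[OF vE vE vE] by blast

lemma hat_functional: "functional p \<Longrightarrow> functional q \<Longrightarrow> functional (\<lambda>h. p (hat q h))"
  by (rule linear_compose[OF hat_linear])

lemma hat_one: "functional q \<Longrightarrow> hat q 1 = sE (q 1) 1"
  by (simp add: hat_def comult_one slice_rep_tclass[OF vE] slice_fbasis[OF vE])

lemma hat_mult:
  assumes "functional q" "\<Delta> a = tclass sE sE f"
  shows "hat q (a * h) = lin_ext sE (\<lambda>(v, w). slice sE (\<lambda>k. q (k * w)) f * v) (rep (\<Delta> h))"
  using slice_tensor_mult[OF kE kE assms(1), of f "rep (\<Delta> h)"]
  by (simp add: hat_def comult_mult assms(2) comult_rep)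

lemma slice_mult_left: "a * slice sE q f = lin_ext sE (\<lambda>(v, w). sE (q w) (a * v)) f"
  unfolding slice_def linear_lin_ext[OF linear_mult_left[OF kE]]
  by (simp add: case_prod_beta' E.scale_mult_right)

lemma hat_g: "functional q \<Longrightarrow> hat q (g * h) = g * hat (\<lambda>k. q (g * k)) h"
  unfolding hat_mult[OF _ comult_g] hat_def[of "\<lambda>k. q (g * k)"] slice_mult_left
  by (simp add: slice_fbasis[OF vE] E.scale_mult_left)

lemma hat_x:
  assumes "functional q" "i \<in> {1..n}"
  shows "hat q (x i * h) = x i * hat (\<lambda>k. q (g * k)) h + hat (\<lambda>k. q (x i * k)) h"
proof -
  have "hat q (x i * h) =
      lin_ext sE (\<lambda>y. (case y of (v, w) \<Rightarrow> sE (q (g * w)) (x i * v))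
        + (case y of (v, w) \<Rightarrow> sE (q (x i * w)) v)) (rep (\<Delta> h))"
    unfolding hat_mult[OF assms(1) comult_x[OF assms(2)]]
    by (simp add: slice_add[OF vE] slice_fbasis[OF vE] distrib_right E.scale_mult_left[symmetric]
        case_prod_beta')
  then show ?thesis
    unfolding lin_ext_plus_values[OF vE] hat_def slice_mult_left by (simp add: slice_def)
qed

lemma hat_counit: "hat \<epsilon> h = h"
proof (induction h rule: E_induct)
  case (x i h)
  have "(\<lambda>k. \<epsilon> (x i * k)) = (\<lambda>k. 0 * \<epsilon> k)"
    using counit_x[OF x(1)] by (simp add: counit_mult)
  then have "hat (\<lambda>k. \<epsilon> (x i * k)) h = 0"
    by (simp only: hat_def slice_functional(2)[OF vE] E.scale_zero_left)
  then show ?case using x by (simp add: hat_x counit_linear counit_mult counit_g)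
qed (simp_all add: hat_one hat_g counit_values linear_simps[OF hat_linear])

end


section \<open>Partial derivatives on E(n)\<close>

context E_hopf
begin

lemma hat_neg: "hat (\<lambda>k. - q k) h = - hat q h"
  using slice_functional(2)[OF vE, of "- 1" q "rep (\<Delta> h)"] by (simp add: hat_def)

lemma hat_zero: "hat (\<lambda>k. 0) h = 0"
  using slice_functional(2)[OF vE, of 0 "\<lambda>_. 0" "rep (\<Delta> h)"] by (simp add: hat_def)

text \<open>The operator \<open>\<sigma>\<close> is the algebra automorphism changing the sign of all generators, and \<open>part i\<close> is a
  partial derivative: up to sign the skew derivation with respect to \<open>\<sigma>\<close> that sends \<open>x\<^sub>j\<close> to
  \<open>\<delta>\<^sub>i\<^sub>j\<close> and \<open>g\<close> to \<open>0\<close>.\<close>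

definition \<sigma> :: "'e \<Rightarrow> 'e" where "\<sigma> = hat \<chi>"

definition part :: "nat \<Rightarrow> 'e \<Rightarrow> 'e" where "part i = hat (\<xi> i)"

lemma sigma_linear: "linear_map sE sE \<sigma>" and part_linear: "linear_map sE sE (part i)"
  unfolding \<sigma>_def part_def by (rule hat_linear[OF chi_linear] hat_linear[OF xi_linear])+

lemma sigma_one: "\<sigma> 1 = 1"
  and sigma_g: "\<sigma> (g * h) = - (g * \<sigma> h)"
  and sigma_x: "i \<in> {1..n} \<Longrightarrow> \<sigma> (x i * h) = - (x i * \<sigma> h)"
  unfolding \<sigma>_def
  by (simp_all only: hat_one[OF chi_linear] hat_g[OF chi_linear] hat_x[OF chi_linear] chi hat_neg
      hat_zero E.scale_one mult_minus_right add_0_right)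

lemma part_one: "part i 1 = 0"
  and part_g: "part i (g * h) = - (g * part i h)"
  and part_x: "j \<in> {1..n} \<Longrightarrow> part i (x j * h) = - (x j * part i h) - (if j = i then h else 0)"
  unfolding part_def
  by (simp_all add: hat_one[OF xi_linear] hat_g[OF xi_linear] hat_x[OF xi_linear] xi hat_neg
      hat_zero hat_counit del: atLeastAtMost_iff)

lemmas hat_simps = sigma_one sigma_g sigma_x part_one part_g part_x
  linear_simps[OF sigma_linear]
  linear_simps[OF part_linear]

lemmas functional_simps =
  linear_simps[OF chi_linear]
  linear_simps[OF xi_linear]
  linear_simps[OF counit_linear]

lemma chi_sigma: "\<chi> (\<sigma> h) = \<epsilon> h" and counit_sigma: "\<epsilon> (\<sigma> h) = \<chi> h"
  by (induction h rule: E_induct; simp add: hat_simps chi counit_values functional_simps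
      del: atLeastAtMost_iff)+

lemma counit_part: "\<epsilon> (part i h) = \<xi> i h"
  by (induction h rule: E_induct)
    (simp_all add: hat_simps chi xi counit_values functional_simps del: atLeastAtMost_iff)

lemma part_sigma: "part i (\<sigma> h) = - \<sigma> (part i h)"
  by (induction h rule: E_induct)
    (simp_all add: hat_simps algebra_simps del: atLeastAtMost_iff)

lemma part_anticommute: "part i (part j h) = - part j (part i h)"
  by (induction h rule: E_induct)
    (auto simp: hat_simps algebra_simps simp del: atLeastAtMost_iff)

lemma part_square: "part i (part i h) = 0"
proof -
  have "sE 2 (part i (part i h)) = 0"
    using part_anticommute[of i i h] E.scale_left_distrib[of 1 1 "part i (part i h)"]
    by (metis E.scale_one ab_left_minus one_add_one)
  then show ?thesis using two by (simp add: E.scale_eq_0_iff)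
qed

text \<open>On monomials, the projection \<open>proj i\<close> fixes those without the factor \<open>x\<^sub>i\<close> and kills the others;
  it is the identity on the kernel of \<open>part i\<close>. All these projections together leave only the span of
  \<open>1\<close> and \<open>g\<close>.\<close>

definition proj :: "nat \<Rightarrow> 'e \<Rightarrow> 'e" where
  "proj i h = h + x i * part i h"

lemma proj_linear: "linear_map sE sE (proj i)"
  unfolding proj_def
  by (intro linear_plus linear_compose[OF part_linear] linear_mult_left[OF kE])
    (simp add: linearI vE)

lemma projs_linear: "linear_map sE sE (foldr proj l)"
  by (rule foldr_linear[of UNIV]) (simp_all add: proj_linear vE)

lemma proj_g: "i \<in> {1..n} \<Longrightarrow> proj i (g * h) = g * proj i h"
  unfolding proj_def hat_simps
  by (simp add: distrib_left mult.assoc[symmetric] gx del: atLeastAtMost_iff)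

lemma proj_x_same: "i \<in> {1..n} \<Longrightarrow> proj i (x i * h) = 0"
  unfolding proj_def by (simp add: hat_simps right_diff_distrib mult.assoc[symmetric] xx
      del: atLeastAtMost_iff)

lemma proj_x_other:
  assumes "i \<in> {1..n}" "j \<in> {1..n}" "i \<noteq> j"
  shows "proj i (x j * h) = x j * proj i h"
  using assms(3) xx_swap[OF assms(1,2)] unfolding proj_def part_x[OF assms(2)]
  by (simp add: distrib_left mult.assoc[symmetric])

lemma projs_g: "set l \<subseteq> {1..n} \<Longrightarrow> foldr proj l (g * h) = g * foldr proj l h"
  by (induction l) (simp_all add: proj_g del: atLeastAtMost_iff)

lemma projs_x:
  assumes "set l \<subseteq> {1..n}" "j \<in> {1..n}"
  shows "foldr proj l (x j * h) = (if j \<in> set l then 0 else x j * foldr proj l h)"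
  using assms(1)
  by (induction l)
    (use assms(2) in \<open>auto simp: proj_x_same proj_x_other linear_zero[OF proj_linear]
      simp del: atLeastAtMost_iff\<close>)

lemma projs_one: "foldr proj l 1 = 1"
  by (induction l) (simp_all add: proj_def hat_simps)

lemma projs_range: "\<exists>r s. foldr proj [1..<Suc n] h = sE r 1 + sE s g"
proof -
  have l: "set [1..<Suc n] = {1..n}" by auto
  note lin = projs_linear[of "[1..<Suc n]"]
  show ?thesis
  proof (induction h rule: E_induct)
    case one
    show ?case by (intro exI[of _ 1] exI[of _ 0]) (simp only: projs_one E.scale_one
        E.scale_zero_left add_0_right)
  next
    case (add a b)
    then obtain r s r' s' where "foldr proj [1..<Suc n] a = sE r 1 + sE s g"
      "foldr proj [1..<Suc n] b = sE r' 1 + sE s' g" by blast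
    then show ?case unfolding linear_add[OF lin]
      by (intro exI[of _ "r + r'"] exI[of _ "s + s'"]) (simp add: E.scale_left_distrib)
  next
    case (scale c a)
    then obtain r s where "foldr proj [1..<Suc n] a = sE r 1 + sE s g" by blast
    then show ?case unfolding linear_scale[OF lin]
      by (intro exI[of _ "c * r"] exI[of _ "c * s"]) (simp add: E.scale_right_distrib)
  next
    case (g a)
    then obtain r s where "foldr proj [1..<Suc n] a = sE r 1 + sE s g" by blast
    then show ?case unfolding projs_g[OF eq_refl[OF l]]
      by (intro exI[of _ s] exI[of _ r])
        (simp add: distrib_left E.scale_mult_right[symmetric] gg)
  next
    case (x i a)
    then have "foldr proj [1..<Suc n] (x i * a) = 0"
      using projs_x[OF eq_refl[OF l] x(1)] l by (simp only: if_True)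
    then show ?case by (intro exI[of _ 0]) simp
  qed
qed

lemma functional_on_projs:
  assumes p: "functional p"
  defines "\<pi> \<equiv> foldr proj [1..<Suc n]"
  shows "p (\<pi> h) = (p 1 + p g) / 2 * \<epsilon> (\<pi> h) + (p 1 - p g) / 2 * \<chi> (\<pi> h)"
proof -
  obtain r s where h: "\<pi> h = sE r 1 + sE s g" using projs_range unfolding \<pi>_def by blast
  have "\<chi> g = - 1" using chi_g[of 1] by (simp add: chi_one)
  moreover have "(4::'k) \<noteq> 0" using two mult_eq_0_iff[of "2::'k" 2] by simp
  ultimately show ?thesis using two
    by (simp add: h functional_simps linear_simps[OF p] chi_one counit_one
        counit_g field_simps)
qed

end


section \<open>From coactions to skew derivations\<close>

text \<open>A system of skew derivations is what remains of an \<open>E(n)\<close>-coaction when only the actions of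
  \<open>\<chi>\<close> and of the \<open>\<xi>\<^sub>i\<close> are kept.\<close>

definition skew_system ::
  "('k::field \<Rightarrow> 'a::ring_1 \<Rightarrow> 'a) \<Rightarrow> nat set \<Rightarrow> ('a \<Rightarrow> 'a) \<Rightarrow> (nat \<Rightarrow> 'a \<Rightarrow> 'a) \<Rightarrow> bool" where
  "skew_system s I \<phi> d \<longleftrightarrow>
     linear_map s s \<phi> \<and> \<phi> 1 = 1 \<and> (\<forall>a b. \<phi> (a * b) = \<phi> a *
         \<phi> b) \<and> (\<forall>a. \<phi> (\<phi> a) = a) \<and>
     (\<forall>i\<in>I. linear_map s s (d i) \<and> (\<forall>a b. d i (a * b) = d i a * b + \<phi>
         a * d i b) \<and>
       (\<forall>a. d i (\<phi> a) = - \<phi> (d i a)) \<and> (\<forall>a. d i (d i a) = 0) \<and>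
       (\<forall>j\<in>I. \<forall>a. d i (d j a) = - d j (d i a)))"

locale E_comodule = E_hopf sE n g x \<Delta> \<epsilon> S + A: k_algebra sA
  for sE :: "'k::field \<Rightarrow> 'e::ring_1 \<Rightarrow> 'e" and n g x \<Delta> \<epsilon> S
    and sA :: "'k \<Rightarrow> 'a::ring_1 \<Rightarrow> 'a"
begin

lemma vA: "vector_space sA" and kA: "k_algebra sA"
  by (rule A.vector_space_axioms A.k_algebra_axioms)+

definition R :: "('a \<Rightarrow> ('k, 'a, 'e) tensor) \<Rightarrow> ('e \<Rightarrow> 'k) \<Rightarrow> 'a \<Rightarrow> 'a" where
  "R \<rho> p a = slice sA p (rep (\<rho> a))"

lemma R_functional: "R \<rho> (\<lambda>h. p h + q h) a = R \<rho> p a + R \<rho> q a" "R \<rho> (\<lambda>h. r * p h) a = sA r (R \<rho> p a)"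
  unfolding R_def by (rule slice_functional[OF vA])+

lemma R_neg: "R \<rho> (\<lambda>h. - p h) a = - R \<rho> p a"
  using R_functional(2)[of \<rho> "- 1" p a] by simp

lemma right_coaction_iff:
  "right_coaction sA sE \<Delta> \<epsilon> \<rho> \<longleftrightarrow>
    (\<forall>a. \<rho> a \<in> range (tclass sA sE)) \<and> (\<forall>a. R \<rho> \<epsilon> a =
        a) \<and>
    (\<forall>p. functional p \<longrightarrow>
      linear_map sA sA (R \<rho> p) \<and>
      R \<rho> p 1 = sA (p 1) 1 \<and>
      (\<forall>a b. R \<rho> p (a * b) =
        lin_ext sA (\<lambda>(b', h). R \<rho> (\<lambda>k. p (k * h)) a * b') (rep (\<rho> b))) \<and>
      (\<forall>q a. functional q \<longrightarrow> R \<rho> p (R \<rho> q a) = R \<rho>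
          (\<lambda>h. p (hat q h)) a))"
  unfolding right_coaction_iff_slices[OF kA kE comult_linear counit_linear] R_def hat_def ..

lemma coaction:
  assumes "right_coaction sA sE \<Delta> \<epsilon> \<rho>"
  shows coaction_range: "\<rho> a \<in> range (tclass sA sE)"
    and coaction_counit: "R \<rho> \<epsilon> a = a"
    and coaction_linear: "functional p \<Longrightarrow> linear_map sA sA (R \<rho> p)"
    and coaction_one: "functional p \<Longrightarrow> R \<rho> p 1 = sA (p 1) 1"
    and coaction_mult: "functional p \<Longrightarrow> R \<rho> p (a * b) =
        lin_ext sA (\<lambda>(b', h). R \<rho> (\<lambda>k. p (k * h)) a * b') (rep (\<rho> b))"
    and coaction_coassoc: "functional p \<Longrightarrow> functional q \<Longrightarrow>
        R \<rho> p (R \<rho> q a) = R \<rho> (\<lambda>h. p (hat q h)) a"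
  using assms unfolding right_coaction_iff by blast+

lemma mult_R: "c * R \<rho> p b = lin_ext sA (\<lambda>(b', h). sA (p h) (c * b')) (rep (\<rho> b))"
  unfolding R_def slice_def linear_lin_ext[OF linear_mult_left[OF kA]]
  by (simp add: case_prod_beta' A.scale_mult_right)

lemma coaction_skew_system:
  assumes \<rho>: "right_coaction sA sE \<Delta> \<epsilon> \<rho>"
  shows "skew_system sA {1..n} (R \<rho> \<chi>) (\<lambda>i. R \<rho> (\<xi> i))"
  unfolding skew_system_def
proof (intro conjI allI ballI)
  show "R \<rho> \<chi> 1 = 1" by (simp add: coaction_one[OF \<rho> chi_linear] chi_one)
  show "R \<rho> \<chi> (R \<rho> \<chi> a) = a" for a
    using coaction_coassoc[OF \<rho> chi_linear chi_linear, of a] coaction_counit[OF \<rho>, of a]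
    by (simp add: \<sigma>_def[symmetric] chi_sigma)
  show "R \<rho> \<chi> (a * b) = R \<rho> \<chi> a * R \<rho> \<chi> b" for a b
  proof -
    have "R \<rho> (\<lambda>k. \<chi> (k * h)) a = sA (\<chi> h) (R \<rho> \<chi> a)" for h
      using R_functional(2)[of \<rho> "\<chi> h" \<chi> a] by (simp add: chi_mult mult.commute)
    then show ?thesis
      by (simp add: coaction_mult[OF \<rho> chi_linear] mult_R A.scale_mult_left[symmetric])
  qed
  show "R \<rho> (\<xi> i) (a * b) = R \<rho> (\<xi> i) a * b + R \<rho> \<chi> a * R \<rho> (\<xi> i) b" for i a b
  proof -
    have "R \<rho> (\<lambda>k. \<xi> i (k * h)) a = sA (\<epsilon> h) (R \<rho> (\<xi> i) a) + sA (\<xi> i h) (R \<rho> \<chi> a)" for h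
      using R_functional(1)[of \<rho> "\<lambda>k. \<epsilon> h * \<xi> i k" "\<lambda>k. \<xi> i h * \<chi> k" a]
      by (simp add: xi_mult R_functional(2) mult.commute[of _ "\<epsilon> h"] mult.commute[of _
          "\<xi> i h"])
    then have "R \<rho> (\<xi> i) (a * b) = R \<rho> (\<xi> i) a * R \<rho> \<epsilon> b + R \<rho> \<chi> a * R \<rho> (\<xi> i) b"
      unfolding coaction_mult[OF \<rho> xi_linear] mult_R lin_ext_plus_values[OF vA, symmetric]
      by (simp add: A.scale_mult_left[symmetric] distrib_right case_prod_beta')
    then show ?thesis by (simp add: coaction_counit[OF \<rho>])
  qed
  have coassoc: "R \<rho> p (R \<rho> q a) = - R \<rho> p' (R \<rho> q' a)"
    if "functional p" "functional q" "functional p'" "functional q'"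
      "\<And>h. p (hat q h) = - p' (hat q' h)" for p q p' q' a
    using that by (simp add: coaction_coassoc[OF \<rho>] R_neg)
  show "R \<rho> (\<xi> i) (R \<rho> \<chi> a) = - R \<rho> \<chi> (R \<rho> (\<xi> i) a)" for i a
    by (rule coassoc) (simp_all add: chi_linear xi_linear \<sigma>_def[symmetric] part_def[symmetric]
        counit_part[symmetric] counit_sigma[symmetric] part_sigma functional_simps)
  show anti: "R \<rho> (\<xi> i) (R \<rho> (\<xi> j) a) = - R \<rho> (\<xi> j) (R \<rho> (\<xi> i) a)" for i j a
    by (rule coassoc) (simp_all only: chi_linear xi_linear part_def[symmetric]
        counit_part[symmetric] part_anticommute[of i j] functional_simps)
  show "R \<rho> (\<xi> i) (R \<rho> (\<xi> i) a) = 0" for i a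
    using R_functional(2)[of \<rho> 0 "\<lambda>h. 0"]
    by (simp add: coaction_coassoc[OF \<rho> xi_linear xi_linear] part_def[symmetric]
        counit_part[symmetric] part_square functional_simps)
qed (rule coaction_linear[OF \<rho> chi_linear] coaction_linear[OF \<rho> xi_linear])+

text \<open>The functionals \<open>\<chi>\<close> and \<open>\<xi>\<^sub>i\<close> generate the convolution algebra of all functionals, so a coaction
  is determined by their actions. To see this without a basis of \<open>E(n)\<close>, consider the difference \<open>D\<close>
  of two coactions that agree on \<open>\<chi>\<close> and the \<open>\<xi>\<^sub>i\<close>. Coassociativity turns \<open>D (p \<circ> part i) a\<close> into
  \<open>D p (d\<^sub>i a)\<close>. If \<open>D\<close> vanishes on all \<open>d\<^sub>i a\<close>, then \<open>p\<close> may be replaced by \<open>p \<circ> proj i\<close> for every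
  \<open>i\<close>, which leaves only the functionals \<open>\<epsilon>\<close> and \<open>\<chi>\<close>. The hypothesis on the \<open>d\<^sub>i a\<close> is removed one
  index at a time, because the \<open>d\<^sub>i\<close> anticommute and have square zero.\<close>

lemma coaction_eqI:
  assumes \<rho>: "right_coaction sA sE \<Delta> \<epsilon> \<rho>" and \<rho>': "right_coaction sA sE \<Delta> \<epsilon> \<rho>'"
    and eq_chi: "\<And>a. R \<rho> \<chi> a = R \<rho>' \<chi> a"
    and eq_xi: "\<And>i a. i \<in> {1..n} \<Longrightarrow> R \<rho> (\<xi> i) a = R \<rho>' (\<xi> i) a"
  shows "\<rho> = \<rho>'"
proof -
  define D where "D p a = R \<rho> p a - R \<rho>' p a" for p a
  define d where "d i = R \<rho> (\<xi> i)" for i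
  have D_add: "D (\<lambda>h. p h + q h) a = D p a + D q a"
    and D_scale: "D (\<lambda>h. r * p h) a = sA r (D p a)" for p q r a
    by (simp_all add: D_def R_functional A.scale_right_diff_distrib)
  have D_minus: "D p (- a) = - D p a" if "functional p" for p a
    by (simp add: D_def linear_minus[OF coaction_linear[OF \<rho> that]]
        linear_minus[OF coaction_linear[OF \<rho>' that]])
  have D_zero: "D p 0 = 0" if "functional p" for p
    by (simp add: D_def linear_zero[OF coaction_linear[OF \<rho> that]]
        linear_zero[OF coaction_linear[OF \<rho>' that]])
  have D_part: "D (\<lambda>h. p (part i h)) a = D p (d i a)" if "functional p" "i \<in> {1..n}"
      for p i a
    using coaction_coassoc[OF \<rho> that(1) xi_linear[of i], of a]
      coaction_coassoc[OF \<rho>' that(1) xi_linear[of i], of a] eq_xi[OF that(2), of a]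
    by (simp add: D_def d_def part_def)
  have d: "d i (d j a) = - d j (d i a)" "d i (d i a) = 0"
    if "i \<in> {1..n}" "j \<in> {1..n}" for i j a
    using coaction_skew_system[OF \<rho>] that unfolding skew_system_def d_def by blast+
  have base: "D p a = 0"
    if "\<And>i q. i \<in> {1..n} \<Longrightarrow> functional q \<Longrightarrow> D q (d i a) = 0"
        and "functional p" for a p
  proof -
    have projs: "D p a = D (\<lambda>h. p (foldr proj l h)) a"
      if "set l \<subseteq> {1..n}" "functional p" for l p
      using that
    proof (induction l arbitrary: p)
      case (Cons i l)
      then have i: "i \<in> {1..n}" by simp
      have "D (\<lambda>h. p (proj i h)) a = D p a + D (\<lambda>h. p (x i * part i h)) a"
        by (simp add: proj_def linear_add[OF Cons.prems(2)] D_add)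
      also have "D (\<lambda>h. p (x i * part i h)) a = 0"
        using D_part[OF functional_mult_left[OF kE Cons.prems(2)] i, of "x i" a]
          \<open>\<And>i q. i \<in> {1..n} \<Longrightarrow> functional q \<Longrightarrow> D q (d i a) = 0\<close>[OF i
            functional_mult_left[OF kE Cons.prems(2)]] by simp
      finally have "D p a = D (\<lambda>h. p (proj i h)) a" by simp
      also have "\<dots> = D (\<lambda>h. p (proj i (foldr proj l h))) a"
        by (rule Cons.IH)
          (use Cons.prems in \<open>simp_all add: linear_compose[OF proj_linear]\<close>)
      finally show ?case by simp
    qed simp
    let ?\<pi> = "foldr proj [1..<Suc n]"
    have l: "set [1..<Suc n] \<subseteq> {1..n}" by auto
    have "D p a = D (\<lambda>h. (p 1 + p g) / 2 * \<epsilon> (?\<pi> h) + (p 1 - p g) / 2 * \<chi> (?\<pi> h)) a"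
      unfolding functional_on_projs[OF that(2), symmetric] by (rule projs[OF l that(2)])
    also have "\<dots> = sA ((p 1 + p g) / 2) (D \<epsilon> a) + sA ((p 1 - p g) / 2) (D \<chi> a)"
      by (simp only: D_add D_scale projs[OF l counit_linear, symmetric]
          projs[OF l chi_linear, symmetric])
    also have "\<dots> = 0"
      by (simp add: D_def eq_chi coaction_counit[OF \<rho>] coaction_counit[OF \<rho>'])
    finally show ?thesis .
  qed
  have step: "D p a = 0"
    if "T \<subseteq> {1..n}" "\<And>i q. i \<in> {1..n} - T \<Longrightarrow> functional q \<Longrightarrow> D q (d i a) = 0" "functional p"
    for T a p
  proof -
    have "finite T" using that(1) finite_subset by blast
    then show ?thesis using that
    proof (induction T arbitrary: a p)
      case empty
      then show ?case by - (rule base; auto)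
    next
      case (insert i T)
      have i: "i \<in> {1..n}" using insert.prems(1) by simp
      have "D q (d i a) = 0" if q: "functional q" for q
      proof (rule insert.IH[OF _ _ q])
        fix j q assume j: "j \<in> {1..n} - T" and q: "functional q"
        show "D q (d j (d i a)) = 0"
        proof (cases "j = i")
          case True
          then show ?thesis by (simp add: d(2)[OF i i] D_zero[OF q])
        next
          case False
          with j have "D (\<lambda>h. q (part i h)) (d j a) = 0"
            by (intro insert.prems(2) linear_compose[OF part_linear q]) auto
          then show ?thesis using d(1)[of j i a] j i D_minus[OF q] D_part[OF q i] by simp
        qed
      qed (use insert.prems in auto)
      then have "D q (d j a) = 0" if "j \<in> {1..n} - T" "functional q" for j q
        using that insert.prems(2)[of j q] by (cases "j = i") auto
      with insert.prems show ?case by - (rule insert.IH; auto)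
    qed
  qed
  show ?thesis
  proof
    fix a
    have "R \<rho> p a = R \<rho>' p a" if "functional p" for p
      using step[of "{1..n}" a p] that by (simp add: D_def)
    then show "\<rho> a = \<rho>' a"
      unfolding tensor_eq_iff_slices[OF vA vE coaction_range[OF \<rho>] coaction_range[OF \<rho>']]
      by (simp add: R_def)
  qed
qed

end


section \<open>From skew derivations to coactions\<close>

context E_hopf
begin

text \<open>The idempotents of the group algebra of \<open>g\<close> belonging to the characters \<open>\<epsilon>\<close> and \<open>\<chi>\<close>.\<close>

definition e0 :: 'e where "e0 = sE (1 / 2) (1 + g)"
definition e1 :: 'e where "e1 = sE (1 / 2) (1 - g)"

lemma e0_plus_e1: "e0 + e1 = 1"
  unfolding e0_def e1_def E.scale_right_distrib[symmetric] using E.half_double[OF two, of 1] by simp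

lemma g_e0: "g * e0 = e0" and g_e1: "g * e1 = - e1"
  and e0_g: "e0 * g = e0" and e1_g: "e1 * g = - e1"
  unfolding e0_def e1_def
  by (simp_all add: E.scale_out distrib_left
      distrib_right right_diff_distrib left_diff_distrib gg add.commute
      E.scale_minus_right[symmetric] del: E.scale_minus_right)

lemma e_mult: "e0 * e0 = e0" "e0 * e1 = 0" "e1 * e0 = 0" "e1 * e1 = e1"
proof -
  have "e0 * a = sE (1 / 2) (a + g * a)" "e1 * a = sE (1 / 2) (a - g * a)" for a
    unfolding e0_def e1_def
    by (simp_all add: E.scale_mult_left[symmetric] distrib_right left_diff_distrib)
  then show "e0 * e0 = e0" "e0 * e1 = 0" "e1 * e0 = 0" "e1 * e1 = e1"
    by (simp_all add: g_e0 g_e1 E.half_double[OF two])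
qed

lemma x_e:
  assumes "i \<in> {1..n}"
  shows "x i * e0 = e1 * x i" "x i * e1 = e0 * x i"
  unfolding e0_def e1_def
  by (simp_all add: E.scale_out distrib_left
      distrib_right right_diff_distrib left_diff_distrib gx[OF assms])

lemma functional_e:
  assumes "functional p"
  shows "p e0 = (p 1 + p g) / 2" "p e1 = (p 1 - p g) / 2"
  unfolding e0_def e1_def
  by (simp_all add: linear_simps[OF assms])

lemma counit_e: "\<epsilon> e0 = 1" "\<epsilon> e1 = 0"
  and chi_e: "\<chi> e0 = 0" "\<chi> e1 = 1"
  and xi_e: "\<xi> i e0 = 0" "\<xi> i e1 = 0"
  using chi_g[of 1] xi_g[of i 1] two
  by (simp_all add: functional_e counit_linear chi_linear xi_linear counit_one counit_g chi_one
      xi_one)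

lemma hat_e:
  assumes q: "functional q"
  shows "hat q e0 = sE (q e0) e0 + sE (q e1) e1" "hat q e1 = sE (q e1) e0 + sE (q e0) e1"
proof -
  have "hat q g = sE (q g) g"
    using hat_g[OF q, of 1] hat_one[OF functional_mult_left[OF kE q], of g]
    by (simp add: E.scale_mult_right[symmetric])
  then have h: "hat q e0 = sE (1 / 2) (sE (q 1) 1 + sE (q g) g)"
    "hat q e1 = sE (1 / 2) (sE (q 1) 1 - sE (q g) g)"
    unfolding e0_def e1_def
    by (simp_all add: linear_simps[OF hat_linear[OF q]] hat_one[OF q])
  have one: "1 = e0 + e1" by (simp add: e0_plus_e1)
  have g: "g = e0 - e1" using arg_cong[OF one, of "\<lambda>h. g * h"] by (simp add: distrib_left
      g_e0 g_e1)
  have half: "sE (1 / 2) (sE r a) = sE (r / 2) a" for r a by simp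
  show "hat q e0 = sE (q e0) e0 + sE (q e1) e1" "hat q e1 = sE (q e1) e0 + sE (q e0) e1"
    unfolding h functional_e[OF q]
    by (subst one, subst (2) g, simp add: E.scale_right_distrib E.scale_right_diff_distrib
        E.scale_left_distrib E.scale_left_diff_distrib add_divide_distrib diff_divide_distrib)+
qed

end

locale E_skew = E_comodule sE n g x \<Delta> \<epsilon> S sA
  for sE :: "'k::field \<Rightarrow> 'e::ring_1 \<Rightarrow> 'e" and n g x \<Delta> \<epsilon> S
    and sA :: "'k \<Rightarrow> 'a::ring_1 \<Rightarrow> 'a" +
  fixes \<phi> :: "'a \<Rightarrow> 'a" and d :: "nat \<Rightarrow> 'a \<Rightarrow> 'a"
  assumes skew: "skew_system sA {1..n} \<phi> d"
begin

lemma phi_linear: "linear_map sA sA \<phi>" and phi_one: "\<phi> 1 = 1"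
  and phi_mult: "\<phi> (a * b) = \<phi> a * \<phi> b" and phi_phi: "\<phi> (\<phi> a) = a"
  and d_linear: "i \<in> {1..n} \<Longrightarrow> linear_map sA sA (d i)"
  and d_mult: "i \<in> {1..n} \<Longrightarrow> d i (a * b) = d i a * b + \<phi> a * d i b"
  and d_phi: "i \<in> {1..n} \<Longrightarrow> d i (\<phi> a) = - \<phi> (d i a)"
  and d_d: "i \<in> {1..n} \<Longrightarrow> d i (d i a) = 0"
  and d_swap: "i \<in> {1..n} \<Longrightarrow> j \<in> {1..n} \<Longrightarrow> d i (d j a) = - d j (d i a)"
  using skew unfolding skew_system_def by blast+

lemma d_one: "i \<in> {1..n} \<Longrightarrow> d i 1 = 0"
  using d_mult[of i 1 1] by (simp add: phi_one)

text \<open>The coaction is the composition of the operators \<open>1 + d\<^sub>i \<otimes> g x\<^sub>i\<close> (left multiplication by \<open>g x\<^sub>i\<close>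
  on \<open>E(n)\<close>), applied to the coaction \<open>a \<mapsto> a \<otimes> e0 + \<phi> a \<otimes> e1\<close> of the group algebra of \<open>g\<close>. These
  operators commute, and this product form, rather than the expanded sum over subsets, makes the
  axioms accessible to induction on the number of factors.\<close>

primrec tens :: "nat list \<Rightarrow> 'a \<Rightarrow> ('a \<times> 'e \<Rightarrow>\<^sub>0 'k)"
    where
  "tens [] a = fbasis (a, e0) + fbasis (\<phi> a, e1)"
| "tens (i # l) a = tens l a + lin_ext fscale (\<lambda>(b, h). fbasis (d i b, g * x i * h)) (tens l a)"

definition Q :: "nat list \<Rightarrow> ('e \<Rightarrow> 'k) \<Rightarrow> 'a \<Rightarrow> 'a" where
  "Q l p a = slice sA p (tens l a)"

lemma Q_Nil: "Q [] p a = sA (p e0) a + sA (p e1) (\<phi> a)"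
  by (simp add: Q_def slice_add[OF vA] slice_fbasis[OF vA])

lemma Q_Cons:
  assumes "i \<in> {1..n}"
  shows "Q (i # l) p a = Q l p a + d i (Q l (\<lambda>h. p (g * x i * h)) a)"
proof -
  have "slice sA p (lin_ext fscale (\<lambda>(b, h). fbasis (d i b, g * x i * h)) f) =
      d i (slice sA (\<lambda>h. p (g * x i * h)) f)" for f
    by (rule linear_eq_on_fbasis[OF linear_compose[OF lin_ext_linear slice_linear]
          linear_compose[OF slice_linear d_linear[OF assms]]])
      (auto simp: vA vector_space_fscale lin_ext_fbasis slice_fbasis
        linear_scale[OF d_linear[OF assms]])
  then show ?thesis by (simp add: Q_def slice_add[OF vA])
qed

lemma Q_functional:
  shows Q_add: "Q l (\<lambda>h. p h + q h) a = Q l p a + Q l q a"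
    and Q_neg: "Q l (\<lambda>h. - p h) a = - Q l p a"
    and Q_zero: "Q l (\<lambda>h. 0) a = 0"
  using slice_functional(1)[OF vA, of p q "tens l a"] slice_functional(2)[OF vA, of "- 1" p "tens l a"]
    slice_functional(2)[OF vA, of 0 p "tens l a"]
  by (simp_all add: Q_def)

lemma Q_linear: "set l \<subseteq> {1..n} \<Longrightarrow> linear_map sA sA (Q l p)"
proof (induction l arbitrary: p)
  case Nil
  have "linear_map sA sA (\<lambda>a. sA (p e0) a + sA (p e1) (\<phi> a))"
    by (intro linear_plus linear_scaled phi_linear) (simp add: linearI vA)
  then show ?case by (simp add: Q_Nil[abs_def])
next
  case (Cons i l)
  then have i: "i \<in> {1..n}" by simp
  have "linear_map sA sA (\<lambda>a. Q l p a + d i (Q l (\<lambda>h. p (g * x i * h)) a))"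
    using Cons by (intro linear_plus linear_compose[OF _ d_linear[OF i]] Cons.IH) simp_all
  then show ?case by (simp add: Q_Cons[OF i, abs_def])
qed

lemma gx_g: "i \<in> {1..n} \<Longrightarrow> g * x i * (g * h) = - (g * (g * x i * h))"
  and gx_gx: "i \<in> {1..n} \<Longrightarrow> j \<in> {1..n} \<Longrightarrow> g * x i * (g * x j * h) = - (g * x j * (g * x i * h))"
  and gx_square: "i \<in> {1..n} \<Longrightarrow> g * x i * (g * x i * h) = 0"
proof -
  show *: "g * x i * (g * h) = - (g * (g * x i * h))" if i: "i \<in> {1..n}" for i h
    using gx[OF i] by (simp add: mult.assoc[symmetric])
  show "g * x i * (g * x j * h) = - (g * x j * (g * x i * h))"
    if i: "i \<in> {1..n}" and j: "j \<in> {1..n}" for i j h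
    using *[OF i, of "x j * h"] *[OF j, of "x i * h"] xx_swap[OF i j]
    by (simp add: mult.assoc[symmetric]) (simp add: mult.assoc)
  show "g * x i * (g * x i * h) = 0" if i: "i \<in> {1..n}" for i h
    using *[OF i, of "x i * h"] xx[OF i]
    by (simp add: mult.assoc[symmetric]) (simp add: mult.assoc)
qed

text \<open>This is \<open>\<rho> \<circ> d\<^sub>i = (d\<^sub>i \<otimes> g) \<circ> \<rho>\<close>.\<close>

lemma Q_d:
  assumes i: "i \<in> {1..n}" and "set l \<subseteq> {1..n}" "functional p"
  shows "Q l p (d i a) = d i (Q l (\<lambda>h. p (g * h)) a)"
  using assms(2,3)
proof (induction l arbitrary: p)
  case Nil
  then show ?case
    by (simp add: Q_Nil g_e0 g_e1 linear_minus[OF Nil(2)] linear_simps[OF d_linear[OF i]] d_phi[OF i]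
        del: atLeastAtMost_iff)
next
  case (Cons j l)
  then have j: "j \<in> {1..n}" and l: "set l \<subseteq> {1..n}" by auto
  note p = Cons.prems(2)
  have "Q (j # l) p (d i a) = d i (Q l (\<lambda>h. p (g * h)) a)
      + d j (d i (Q l (\<lambda>h. p (g * x j * (g * h))) a))"
    using Cons.IH[OF l p] Cons.IH[OF l functional_mult_left[OF kE p]] by (simp add: Q_Cons[OF j])
  also have "d j (d i (Q l (\<lambda>h. p (g * x j * (g * h))) a)) =
      d i (d j (Q l (\<lambda>h. p (g * (g * x j * h))) a))"
    using d_swap[OF i j] by (simp add: gx_g[OF j] linear_minus[OF p] Q_neg
        linear_minus[OF d_linear[OF i]] linear_minus[OF d_linear[OF j]])
  finally show ?case by (simp add: Q_Cons[OF j] linear_add[OF d_linear[OF i]])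
qed

text \<open>Moving \<open>g x\<^sub>j\<close> from the left to the right of the second tensor factor costs an application of
  \<open>\<phi>\<close> to the first. This makes \<open>1 + d\<^sub>j \<otimes> g x\<^sub>j\<close> multiplicative on the image of \<open>\<rho>\<close>.\<close>

lemma phi_Q:
  assumes j: "j \<in> {1..n}" and "set l \<subseteq> {1..n}" "functional p"
  shows "\<phi> (Q l (\<lambda>h. p (g * x j * h)) a) = Q l (\<lambda>h. p (h * (g * x j))) a"
  using assms(2,3)
proof (induction l arbitrary: p)
  case Nil
  have "g * x j * e0 = e1 * (g * x j)" "g * x j * e1 = e0 * (g * x j)"
    using x_e[OF j] g_e0 g_e1 e0_g e1_g by (simp_all add: mult.assoc) (simp_all add:
        mult.assoc[symmetric])
  then show ?case
    by (simp add: Q_Nil linear_simps[OF phi_linear] phi_phi add.commute)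
next
  case (Cons i l)
  then have i: "i \<in> {1..n}" and l: "set l \<subseteq> {1..n}" by auto
  note p = Cons.prems(2)
  have "\<phi> (d i (Q l (\<lambda>h. p (g * x j * (g * x i * h))) a)) =
      - d i (\<phi> (Q l (\<lambda>h. p (g * x j * (g * x i * h))) a))"
    using d_phi[OF i] by simp
  also have "\<dots> = d i (\<phi> (Q l (\<lambda>h. p (g * x i * (g * x j * h))) a))"
    by (simp add: gx_gx[OF j i] linear_minus[OF p] Q_neg linear_minus[OF phi_linear]
        linear_minus[OF d_linear[OF i]])
  also have "\<dots> = d i (Q l (\<lambda>h. p (g * x i * (h * (g * x j)))) a)"
    using Cons.IH[OF l functional_mult_left[OF kE p]] by simp
  finally show ?case
    using Cons.IH[OF l p] by (simp add: Q_Cons[OF i] linear_add[OF phi_linear] mult.assoc)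
qed

text \<open>Both sides are built from the same factors: \<open>(1 + d\<^sub>j \<otimes> g \<otimes> g x\<^sub>j)(1 + d\<^sub>j \<otimes> g x\<^sub>j \<otimes> 1)\<close> equals
  \<open>1 + d\<^sub>j \<otimes> \<Delta> (g x\<^sub>j)\<close>, because \<open>d\<^sub>j\<close> has square zero.\<close>

lemma Q_coassoc:
  assumes "set l \<subseteq> {1..n}" "functional p" "functional q"
  shows "Q l p (Q l q a) = Q l (\<lambda>h. p (hat q h)) a"
  using assms
proof (induction l arbitrary: p q a)
  case Nil
  note p = Nil(2) and q = Nil(3)
  show ?case
    by (simp add: Q_Nil hat_e[OF q] linear_simps[OF p]
        linear_simps[OF phi_linear] phi_phi
        A.scale_right_distrib A.scale_left_distrib mult.commute)
next
  case (Cons j l)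
  then have j: "j \<in> {1..n}" and l: "set l \<subseteq> {1..n}" by auto
  note p = Cons.prems(2) and q = Cons.prems(3)
  let ?q = "\<lambda>h. q (g * x j * h)" and ?p = "\<lambda>h. p (g * x j * h)"
  have p': "functional ?p" "functional (\<lambda>h. p (g * h))" and q': "functional ?q"
    using functional_mult_left[OF kE p] functional_mult_left[OF kE q] by blast+
  note Ql = linear_add[OF Q_linear[OF l]] and dl = linear_add[OF d_linear[OF j]]
  have hat_gx: "hat q (g * x j * h) = g * x j * hat q h + g * hat ?q h" for h
  proof -
    have "(\<lambda>k. q (g * (g * k))) = q" by (simp add: mult.assoc[symmetric] gg)
    then show ?thesis
      using hat_g[OF q, of "x j * h"] hat_x[OF functional_mult_left[OF kE q, of g] j, of h]
      by (simp add: mult.assoc distrib_left)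
  qed
  have "Q (j # l) p (Q (j # l) q a) = Q l p (Q l q a) + Q l p (d j (Q l ?q a))
      + d j (Q l ?p (Q l q a)) + d j (Q l ?p (d j (Q l ?q a)))"
    by (simp add: Q_Cons[OF j] Ql dl)
  also have "Q l p (Q l q a) = Q l (\<lambda>h. p (hat q h)) a" by (rule Cons.IH[OF l p q])
  also have "Q l p (d j (Q l ?q a)) = d j (Q l (\<lambda>h. p (g * hat ?q h)) a)"
    using Q_d[OF j l p] Cons.IH[OF l p'(2) q'] by simp
  also have "Q l ?p (Q l q a) = Q l (\<lambda>h. p (g * x j * hat q h)) a" by (rule Cons.IH[OF l
      p'(1) q])
  also have "d j (Q l ?p (d j (Q l ?q a))) = 0"
    using Q_d[OF j l p'(1)] d_d[OF j] by simp
  also have "Q l (\<lambda>h. p (hat q h)) a + d j (Q l (\<lambda>h. p (g * hat ?q h)) a)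
      + d j (Q l (\<lambda>h. p (g * x j * hat q h)) a) + 0 = Q (j # l) (\<lambda>h. p (hat q h)) a"
    by (simp add: Q_Cons[OF j] hat_gx linear_add[OF p] Q_add dl add_ac)
  finally show ?case .
qed

lemma Q_counit: "set l \<subseteq> {1..n} \<Longrightarrow> Q l \<epsilon> a = a"
proof (induction l)
  case Nil
  show ?case by (simp add: Q_Nil counit_e)
next
  case (Cons i l)
  then have i: "i \<in> {1..n}" by simp
  have "\<epsilon> (g * x i * h) = 0" for h using counit_x[OF i] by (simp add: counit_mult)
  then show ?case
    using Cons by (simp add: Q_Cons[OF i] Q_zero linear_zero[OF d_linear[OF i]] del: atLeastAtMost_iff)
qed

lemma Q_one: "set l \<subseteq> {1..n} \<Longrightarrow> functional p \<Longrightarrow> Q l p 1 = sA (p 1) 1"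
proof (induction l arbitrary: p)
  case Nil
  then show ?case
    using linear_add[OF Nil(2), of e0 e1]
    by (simp add: Q_Nil phi_one e0_plus_e1 A.scale_left_distrib)
next
  case (Cons i l)
  then have i: "i \<in> {1..n}" by simp
  show ?case
    using Cons.IH[OF _ Cons.prems(2)] Cons.IH[OF _ functional_mult_left[OF kE Cons.prems(2)]]
      Cons.prems(1)
    by (simp add: Q_Cons[OF i] linear_scale[OF d_linear[OF i]] d_one[OF i] del: atLeastAtMost_iff)
qed

lemma Q_mult:
  assumes "set l \<subseteq> {1..n}" "functional p"
  shows "Q l p (a * b) = lin_ext sA (\<lambda>(b', h). Q l (\<lambda>k. p (k * h)) a * b') (tens l b)"
  using assms
proof (induction l arbitrary: p)
  case Nil
  then show ?case
    by (simp add: Q_Nil lin_ext_add[OF vA] lin_ext_fbasis[OF vA] e_mult linear_zero[OF Nil(2)]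
        phi_mult A.scale_mult_left)
next
  case (Cons j l)
  then have j: "j \<in> {1..n}" and l: "set l \<subseteq> {1..n}" by auto
  note p = Cons.prems(2)
  note dj = d_linear[OF j] and right = functional_mult_right[OF kE p]
  let ?L = "\<lambda>h. g * x j * h"
  have Q_comm: "Q l (\<lambda>k. p (?L k * h)) a = Q l (\<lambda>k. p (?L (k * h))) a" for h
    by (simp add: mult.assoc)
  \<comment> \<open>The two cross terms of the product rule: the first moves \<open>g x\<^sub>j\<close> across the second factor, the
    second contains \<open>(g x\<^sub>j)\<^sup>2 = 0\<close>.\<close>
  have third: "Q l (\<lambda>k. p (k * ?L h)) a = \<phi> (Q l (\<lambda>k. p (?L k * h)) a)" for h
    using phi_Q[OF j l right[of h]] by (simp add: mult.assoc)
  have fourth: "Q l (\<lambda>k. p (?L k * ?L h)) a = 0" for h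
  proof -
    have "Q l (\<lambda>k. p (?L k * ?L h)) a = \<phi> (Q l (\<lambda>k. p (?L (?L k) * h)) a)"
      using phi_Q[OF j l functional_mult_left[OF kE right[of h], of "g * x j"]]
      by (simp add: mult.assoc)
    then show ?thesis
      by (simp add: gx_square[OF j] linear_zero[OF p] Q_zero linear_zero[OF phi_linear])
  qed
  have "Q (j # l) p (a * b) = lin_ext sA (\<lambda>(b', h). Q l (\<lambda>k. p (k * h)) a * b') (tens l b)
      + d j (lin_ext sA (\<lambda>(b', h). Q l (\<lambda>k. p (?L (k * h))) a * b') (tens l b))"
    using Cons.IH[OF l p] Cons.IH[OF l functional_mult_left[OF kE p]] by (simp add: Q_Cons[OF j])
  also have "d j (lin_ext sA (\<lambda>(b', h). Q l (\<lambda>k. p (?L (k * h))) a * b') (tens l b)) =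
      lin_ext sA (\<lambda>(b', h). d j (Q l (\<lambda>k. p (?L k * h)) a) * b'
        + Q l (\<lambda>k. p (k * ?L h)) a * d j b') (tens l b)"
    unfolding linear_lin_ext[OF dj] by (simp add: case_prod_beta' d_mult[OF j] third Q_comm)
  also have "lin_ext sA (\<lambda>(b', h). Q l (\<lambda>k. p (k * h)) a * b') (tens l b) + \<dots> =
      lin_ext sA (\<lambda>(b', h). Q (j # l) (\<lambda>k. p (k * h)) a * b') (tens l b)
      + lin_ext sA (\<lambda>(b', h). Q (j # l) (\<lambda>k. p (k * ?L h)) a * d j b') (tens l b)"
    unfolding lin_ext_plus_values[OF vA, symmetric]
    by (simp add: case_prod_beta' Q_Cons[OF j] fourth linear_zero[OF dj] distrib_right add_ac)
  also have "lin_ext sA (\<lambda>(b', h). Q (j # l) (\<lambda>k. p (k * ?L h)) a * d j b') (tens l b) =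
      lin_ext sA (\<lambda>(b', h). Q (j # l) (\<lambda>k. p (k * h)) a * b')
        (lin_ext fscale (\<lambda>(b', h). fbasis (d j b', ?L h)) (tens l b))"
    unfolding linear_lin_ext[OF lin_ext_linear[OF vA]]
    by (simp add: case_prod_beta' lin_ext_fbasis[OF vA])
  finally show ?case by (simp add: lin_ext_add[OF vA])
qed

definition coact :: "nat list \<Rightarrow> 'a \<Rightarrow> ('k, 'a, 'e) tensor" where
  "coact l a = tclass sA sE (tens l a)"

lemma R_coact: "functional p \<Longrightarrow> R (coact l) p a = Q l p a"
  by (simp add: R_def coact_def Q_def slice_rep_tclass[OF vA])

lemma coact_right_coaction:
  assumes l: "set l \<subseteq> {1..n}"
  shows "right_coaction sA sE \<Delta> \<epsilon> (coact l)"
  unfolding right_coaction_iff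
proof (intro conjI allI impI)
  fix p assume p: "functional p"
  show "linear_map sA sA (R (coact l) p)"
    using Q_linear[OF l, of p] by (simp add: R_coact[OF p, abs_def])
  show "R (coact l) p (R (coact l) q a) = R (coact l) (\<lambda>h. p (hat q h)) a"
    if "functional q" for q a
    by (simp add: R_coact p that hat_functional Q_coassoc[OF l])
  show "R (coact l) p (a * b) =
      lin_ext sA (\<lambda>(b', h). R (coact l) (\<lambda>k. p (k * h)) a * b') (rep (coact l b))" for a b
  proof -
    have "lin_ext sA (\<lambda>(b', h). Q l (\<lambda>k. p (k * h)) a * b') (rep (coact l b)) =
        lin_ext sA (\<lambda>(b', h). Q l (\<lambda>k. p (k * h)) a * b') (tens l b)"
      using slice_tensor_mult[OF kA kE p, of "tens l a" "rep (coact l b)"]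
        slice_tensor_mult[OF kA kE p, of "tens l a" "tens l b"]
      by (simp add: Q_def coact_def tclass_rep)
    then show ?thesis
      by (simp add: R_coact p functional_mult_right[OF kE p] Q_mult[OF l p])
  qed
qed (simp_all add: coact_def[abs_def] R_coact[unfolded coact_def[abs_def]] counit_linear
    Q_counit[OF l] Q_one[OF l])

lemma Q_chi: "set l \<subseteq> {1..n} \<Longrightarrow> Q l \<chi> a = \<phi> a"
proof (induction l)
  case Nil
  show ?case by (simp add: Q_Nil chi_e)
next
  case (Cons i l)
  then have i: "i \<in> {1..n}" by simp
  have "\<chi> (g * x i * h) = 0" for h using chi_x[OF i] by (simp add: chi_g mult.assoc)
  then show ?case
    using Cons by (simp add: Q_Cons[OF i] Q_zero linear_zero[OF d_linear[OF i]] del: atLeastAtMost_iff)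
qed

lemma Q_xi: "set l \<subseteq> {1..n} \<Longrightarrow> distinct l \<Longrightarrow> Q l (\<xi> i) a = (if i \<in> set l then d i a else 0)"
proof (induction l)
  case Nil
  show ?case by (simp add: Q_Nil xi_e)
next
  case (Cons j l)
  then have j: "j \<in> {1..n}" by simp
  have "(\<lambda>h. \<xi> i (g * x j * h)) = (if j = i then \<epsilon> else (\<lambda>h. 0))"
    using xi_x[OF j] by (auto simp: xi_g mult.assoc)
  then show ?case
    using Cons Q_counit[of l a]
    by (auto simp: Q_Cons[OF j] Q_zero linear_zero[OF d_linear[OF j]] simp del: atLeastAtMost_iff)
qed

end

text \<open>A coaction and the coaction built from its skew system have the same actions of \<open>\<chi>\<close> and \<open>\<xi>\<^sub>i\<close>, so
  they coincide by \<open>coaction_eqI\<close>.\<close>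

lemma (in E_comodule) right_coaction_iff_skew_system:
  "right_coaction sA sE \<Delta> \<epsilon> \<rho> \<longleftrightarrow>
    (\<exists>\<phi> d. skew_system sA {1..n} \<phi> d \<and> \<rho> = E_skew.coact sE g x sA
        \<phi> d [1..<Suc n])"
proof
  have l: "set [1..<Suc n] = {1..n}" by auto
  assume \<rho>: "right_coaction sA sE \<Delta> \<epsilon> \<rho>"
  define \<phi> and d where "\<phi> = R \<rho> \<chi>" and "d i = R \<rho> (\<xi> i)" for i
  have skew: "skew_system sA {1..n} \<phi> d"
    using coaction_skew_system[OF \<rho>] by (simp add: \<phi>_def d_def[abs_def])
  interpret E_skew sE n g x \<Delta> \<epsilon> S sA \<phi> d by unfold_locales (fact skew)
  have "\<rho> = coact [1..<Suc n]"
  proof (rule coaction_eqI[OF \<rho> coact_right_coaction])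
    show "R \<rho> \<chi> a = R (coact [1..<Suc n]) \<chi> a" for a
      unfolding R_coact[OF chi_linear] Q_chi[OF eq_refl[OF l]] by (simp add: \<phi>_def)
    show "R \<rho> (\<xi> i) a = R (coact [1..<Suc n]) (\<xi> i) a" if "i \<in> {1..n}" for i a
      unfolding R_coact[OF xi_linear] Q_xi[OF eq_refl[OF l] distinct_upt] l
      using that by (simp add: d_def)
  qed (simp only: l)
  with skew show "\<exists>\<phi> d. skew_system sA {1..n} \<phi> d \<and> \<rho> = E_skew.coact sE g x sA \<phi> d [1..<Suc n]"
    by blast
next
  assume "\<exists>\<phi> d. skew_system sA {1..n} \<phi> d \<and> \<rho> = E_skew.coact sE g x sA \<phi> d [1..<Suc n]"
  then obtain \<phi> d where skew: "skew_system sA {1..n} \<phi> d"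
    and \<rho>: "\<rho> = E_skew.coact sE g x sA \<phi> d [1..<Suc n]" by blast
  interpret E_skew sE n g x \<Delta> \<epsilon> S sA \<phi> d by unfold_locales (fact skew)
  show "right_coaction sA sE \<Delta> \<epsilon> \<rho>" unfolding \<rho> by (rule
      coact_right_coaction) auto
qed


section \<open>The expanded formula\<close>

lemma ordered_insert:
  assumes "finite P" "\<And>j. j \<in> P \<Longrightarrow> i < j"
  shows "sorted_list_of_set (insert i P) = i # sorted_list_of_set P"
proof -
  have "i \<notin> P" using assms(2) by blast
  then have "sorted_list_of_set (insert i P) = insort i (sorted_list_of_set P)"
    using assms(1) by simp
  also have "\<dots> = i # sorted_list_of_set P"
    by (rule insort_is_Cons) (use assms in \<open>auto intro: less_imp_le\<close>)
  finally show ?thesis .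
qed

lemma minus_one_power_step:
  "(- 1 :: 'a::comm_ring_1) ^ ((Suc c + 1) div 2) = (- 1) ^ Suc c * (- 1) ^ ((c + 1) div 2)"
  by (cases "even c") (auto elim!: evenE oddE)

context E_hopf
begin

lemma g_ordered_prod:
  assumes "set l \<subseteq> {1..n}"
  shows "g * prod_list (map x l) = (- 1) ^ length l * (prod_list (map x l) * g)"
  using assms
proof (induction l)
  case (Cons i l)
  then have i: "i \<in> {1..n}" by simp
  have "g * prod_list (map x (i # l)) = - (x i * (g * prod_list (map x l)))"
    by (simp add: mult.assoc[symmetric] gx[OF i] del: atLeastAtMost_iff)
  also have "\<dots> = - (x i * ((- 1) ^ length l * (prod_list (map x l) * g)))"
    using Cons by simp
  also have "\<dots> = (- 1) ^ length (i # l) * (prod_list (map x (i # l)) * g)"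
    by (cases "even (length l)") (simp_all add: mult.assoc)
  finally show ?case .
qed simp

text \<open>The sign \<open>(-1) ^ card P\<close> in the formula is the one by which \<open>g\<close> and \<open>x\<^sub>P\<close> commute: it turns
  left multiplication by \<open>g\<close> into right multiplication.\<close>

lemma ordered_prod_e:
  assumes "P \<subseteq> {1..n}"
  shows "sE (1 / 2) (ordered_prod x P + (- 1) ^ card P * (g * ordered_prod x P)) =
      ordered_prod x P * e0"
    and "sE (1 / 2) (ordered_prod x P + (- 1) ^ (card P + 1) * (g * ordered_prod x P)) =
      ordered_prod x P * e1"
proof -
  have fin: "finite P" using assms finite_subset by blast
  have "g * ordered_prod x P = (- 1) ^ card P * (ordered_prod x P * g)"
    using g_ordered_prod[of "sorted_list_of_set P"] assms fin by (simp add: ordered_prod_def)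
  then have "(- 1) ^ card P * (g * ordered_prod x P) = ordered_prod x P * g"
    by (cases "even (card P)") simp_all
  then show "sE (1 / 2) (ordered_prod x P + (- 1) ^ card P * (g * ordered_prod x P)) =
      ordered_prod x P * e0"
    "sE (1 / 2) (ordered_prod x P + (- 1) ^ (card P + 1) * (g * ordered_prod x P)) =
      ordered_prod x P * e1"
    by (simp_all add: e0_def e1_def E.scale_mult_right[symmetric] distrib_left right_diff_distrib)
qed

lemma gx_ordered_prod_e:
  assumes "i \<in> {1..n}" "P \<subseteq> {1..n}"
  shows "g * x i * (ordered_prod x P * e0) = (- 1) ^ Suc (card P) * (x i * ordered_prod x P * e0)"
    and "g * x i * (ordered_prod x P * e1) = (- 1) ^ card P * (x i * ordered_prod x P * e1)"
proof -
  let ?l = "i # sorted_list_of_set P"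
  have fin: "finite P" using assms finite_subset by blast
  have *: "g * (x i * ordered_prod x P) = (- 1) ^ Suc (card P) * (x i * ordered_prod x P * g)"
    using g_ordered_prod[of ?l] assms fin by (simp add: ordered_prod_def)
  have "g * x i * (ordered_prod x P * h) = (- 1) ^ Suc (card P) * (x i * ordered_prod x P * (g * h))"
    for h using arg_cong[OF *, of "\<lambda>k. k * h"] by (simp add: mult.assoc)
  then show "g * x i * (ordered_prod x P * e0) = (- 1) ^ Suc (card P) * (x i * ordered_prod x P * e0)"
    "g * x i * (ordered_prod x P * e1) = (- 1) ^ card P * (x i * ordered_prod x P * e1)"
    by (simp_all add: g_e0 g_e1)
qed

end

context E_skew
begin

lemma functional_sign:
  assumes "functional p"
  shows "p ((- 1) ^ m * h) = (- 1) ^ m * p h"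
  by (cases "even m") (simp_all add: linear_minus[OF assms])

text \<open>Adding a smallest index \<open>i\<close> to \<open>P\<close> moves \<open>g\<close> past \<open>x\<^sub>i x\<^sub>P\<close>. The resulting sign
  \<open>(-1) ^ (card P + 1)\<close> is the one by which \<open>(-1) ^ ((card P + 1) div 2)\<close> changes; in the terms with
  \<open>e1\<close>, the signs from \<open>g e1 = - e1\<close> and \<open>d\<^sub>i \<phi> = - \<phi> d\<^sub>i\<close> cancel.\<close>

lemma Q_expansion:
  assumes "sorted_wrt (<) l" "set l \<subseteq> {1..n}" "functional p"
  shows "Q l p a = (\<Sum>P\<in>Pow (set l). sA ((- 1) ^ ((card P + 1) div 2))
    (sA (p (ordered_prod x P * e0)) (ordered_comp d P a) +
     sA (p (ordered_prod x P * e1)) (\<phi> (ordered_comp d P a))))"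
  using assms
proof (induction l arbitrary: p)
  case Nil
  then show ?case by (simp add: Q_Nil ordered_prod_def ordered_comp_def)
next
  case (Cons i l)
  then have i: "i \<in> {1..n}" and l: "set l \<subseteq> {1..n}" and lt: "\<And>j. j \<in> set l \<Longrightarrow> i < j"
    and sorted: "sorted_wrt (<) l" by auto
  note p = Cons.prems(3)
  define F where "F p P = sA ((- 1) ^ ((card P + 1) div 2))
    (sA (p (ordered_prod x P * e0)) (ordered_comp d P a) +
     sA (p (ordered_prod x P * e1)) (\<phi> (ordered_comp d P a)))" for p P
  have step: "d i (F (\<lambda>h. p (g * x i * h)) P) = F p (insert i P)" if "P \<subseteq> set l" for P
  proof -
    have P: "P \<subseteq> {1..n}" "finite P" "i \<notin> P" "\<And>j. j \<in> P \<Longrightarrow> i < j"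
      using that l lt finite_subset[OF that] by auto
    have ins: "ordered_prod x (insert i P) = x i * ordered_prod x P"
      "ordered_comp d (insert i P) a = d i (ordered_comp d P a)"
      by (simp_all add: ordered_prod_def ordered_comp_def ordered_insert[OF P(2,4)])
    have card: "card (insert i P) = Suc (card P)" using P by simp
    note dl = linear_simps[OF d_linear[OF i]]
    show ?thesis
      unfolding F_def ins card minus_one_power_step gx_ordered_prod_e[OF i P(1)]
        functional_sign[OF p] dl d_phi[OF i]
      by (cases "even (card P)")
        (simp_all add: A.scale_right_distrib A.scale_right_diff_distrib)
  qed
  have "Q (i # l) p a = (\<Sum>P\<in>Pow (set l). F p P) + d i (\<Sum>P\<in>Pow (set l). F (\<lambda>h. p (g * x i * h)) P)"
    using Cons.IH[OF sorted l p] Cons.IH[OF sorted l functional_mult_left[OF kE p]]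
    by (simp add: Q_Cons[OF i] F_def)
  also have "\<dots> = (\<Sum>P\<in>Pow (set l). F p P) + (\<Sum>P\<in>Pow (set l). F p (insert i P))"
    unfolding linear_sum[OF d_linear[OF i]] by (simp add: step)
  also have "(\<Sum>P\<in>Pow (set l). F p (insert i P)) = (\<Sum>P\<in>insert i ` Pow (set l). F p P)"
    using lt by (subst sum.reindex) (auto intro!: inj_onI dest: insert_ident[THEN iffD1, rotated -1])
  also have "(\<Sum>P\<in>Pow (set l). F p P) + \<dots> = (\<Sum>P\<in>Pow (set (i # l)). F p P)"
    using lt by (subst sum.union_disjoint[symmetric]) (auto simp: Pow_insert)
  finally show ?case by (simp add: F_def)
qed

lemma coact_formula:
  "coact [1..<Suc n] a = tclass sA sE
    (\<Sum>P\<in>Pow {1..n}. fscale ((- 1) ^ ((card P + 1) div 2))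
      (fbasis (ordered_comp d P a,
          sE (1 / 2) (ordered_prod x P + (- 1) ^ card P * (g * ordered_prod x P))) +
       fbasis (\<phi> (ordered_comp d P a),
          sE (1 / 2) (ordered_prod x P + (- 1) ^ (card P + 1) * (g * ordered_prod x P)))))"
  unfolding coact_def
proof (rule slice_separates[OF vA vE])
  fix p assume p: "functional p"
  have l: "set [1..<Suc n] = {1..n}" by auto
  have "slice sA p (tens [1..<Suc n] a) = (\<Sum>P\<in>Pow {1..n}. sA ((- 1) ^ ((card P + 1) div 2))
    (sA (p (ordered_prod x P * e0)) (ordered_comp d P a) +
     sA (p (ordered_prod x P * e1)) (\<phi> (ordered_comp d P a))))"
    using Q_expansion[of "[1..<Suc n]" p a] p unfolding Q_def l by (simp only: sorted_wrt_upt)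
  also have "\<dots> = slice sA p (\<Sum>P\<in>Pow {1..n}. fscale ((- 1) ^ ((card P + 1) div 2))
      (fbasis (ordered_comp d P a,
          sE (1 / 2) (ordered_prod x P + (- 1) ^ card P * (g * ordered_prod x P))) +
       fbasis (\<phi> (ordered_comp d P a),
          sE (1 / 2) (ordered_prod x P + (- 1) ^ (card P + 1) * (g * ordered_prod x P)))))"
    unfolding slice_sum[OF vA] slice_fscale[OF vA] slice_add[OF vA] slice_fbasis[OF vA]
    by (intro sum.cong refl) (simp only: Pow_iff ordered_prod_e)
  finally show "slice sA p (tens [1..<Suc n] a) = \<dots>" .
qed

end


section \<open>Algebras with anticommuting invertible generators\<close>

locale orthogonal_generators = k_algebra scale
  for scale :: "'k::field \<Rightarrow> 'a::ring_1 \<Rightarrow> 'a" +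
  fixes V :: "'a set" and q :: "'a \<Rightarrow> 'k"
  assumes two: "(2::'k) \<noteq> 0"
    and fin: "finite V" and even_card: "even (card V)"
    and square: "v \<in> V \<Longrightarrow> v * v = scale (q v) 1" and q_nonzero: "v \<in> V \<Longrightarrow> q v \<noteq> 0"
    and anticommute: "v \<in> V \<Longrightarrow> w \<in> V \<Longrightarrow> v \<noteq> w \<Longrightarrow> v * w = - (w * v)"
    and generate: "\<And>P a. P 1 \<Longrightarrow> (\<And>a b. P a \<Longrightarrow> P b \<Longrightarrow> P (a + b)) \<Longrightarrow> (\<And>r a. P a \<Longrightarrow> P (scale r a)) \<Longrightarrow>
      (\<And>v a. v \<in> V \<Longrightarrow> P a \<Longrightarrow> P (v * a)) \<Longrightarrow> P a"
begin

lemma square_left: "v \<in> V \<Longrightarrow> v * (v * a) = scale (q v) a"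
  by (simp add: mult.assoc[symmetric] square scale_mult_left[symmetric])

lemma square_right: "v \<in> V \<Longrightarrow> a * v * v = scale (q v) a"
  by (simp add: mult.assoc square scale_mult_right[symmetric])

lemma monomial_swap:
  assumes "distinct l" "set l \<subseteq> V" "v \<in> V"
  shows "prod_list l * v =
    (if even (length l) = (v \<in> set l) then - (v * prod_list l) else v * prod_list l)"
  using assms(1,2)
proof (induction l)
  case (Cons b l)
  have IH: "prod_list l * v =
      (if even (length l) = (v \<in> set l) then - (v * prod_list l) else v * prod_list l)"
    using Cons by simp
  show ?case
  proof (cases "v = b")
    case True
    then show ?thesis using Cons IH by (auto simp: mult.assoc)
  next
    case False
    then have "b * v = - (v * b)" using anticommute[of b v] Cons assms(3) by auto
    then show ?thesis using False IH by (auto simp: mult.assoc) (auto simp: mult.assoc[symmetric])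
  qed
qed simp

lemma monomial_unit:
  assumes "set l \<subseteq> V"
  shows "\<exists>w'. prod_list l * w' = 1 \<and> w' * prod_list l = 1"
  using assms
proof (induction l)
  case (Cons v l)
  then obtain w' where w': "prod_list l * w' = 1" "w' * prod_list l = 1" by auto
  have v: "v \<in> V" using Cons by simp
  let ?w = "w' * scale (1 / q v) v"
  have "v * prod_list l * ?w = scale (1 / q v) (v * (prod_list l * w') * v)"
    by (simp add: scale_mult_right[symmetric] mult.assoc)
  moreover have "?w * (v * prod_list l) = scale (1 / q v) (w' * (v * (v * prod_list l)))"
    by (simp add: scale_out mult.assoc)
  ultimately show ?case
    using w' q_nonzero[OF v]
    by (intro exI[of _ ?w]) (simp add: square[OF v] square_left[OF v] scale_mult_right[symmetric])
qed simp

text \<open>Because the number of generators is even, every choice of signs is realized by conjugation with a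
  monomial: conjugation by the product of the elements of \<open>T\<close> changes the sign of the \<open>v\<close> in
  \<open>T\<close> if \<open>card T\<close> is even, and of those outside \<open>T\<close> if it is odd.\<close>

lemma sign_unit:
  "\<exists>w w'. w * w' = 1 \<and> w' * w = 1 \<and> (\<forall>v\<in>V. w * v = (if s v then - (v * w) else v * w))"
proof -
  let ?T = "{v \<in> V. s v}"
  define T where "T = (if even (card ?T) then ?T else V - ?T)"
  have T: "finite T" "T \<subseteq> V" using fin by (auto simp: T_def)
  then obtain l where l: "set l = T" "distinct l" using finite_distinct_list by blast
  then have len: "length l = card T" using distinct_card by force
  have "card ?T \<le> card V" using fin by (intro card_mono) auto
  then have "even (card T) = even (card ?T)"
    using even_card fin by (auto simp: T_def card_Diff_subset)
  then have "(even (length l) = (v \<in> set l)) = s v" if "v \<in> V" for v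
    using that by (auto simp: len l(1) T_def)
  then have "\<forall>v\<in>V. prod_list l * v = (if s v then - (v * prod_list l) else v * prod_list l)"
    using monomial_swap[OF l(2)] l(1) T(2) by simp
  then show ?thesis using monomial_unit[of l] l(1) T(2) by blast
qed

text \<open>Commuting additive involutions have a common eigenvector: if \<open>y + \<sigma> y \<noteq> 0\<close> then \<open>\<sigma>\<close> fixes it,
  and otherwise \<open>\<sigma> y = - y\<close>.\<close>

lemma common_eigenvector:
  fixes \<sigma> :: "'b \<Rightarrow> 'a \<Rightarrow> 'a"
  assumes "finite T" and z: "z \<in> J" "z \<noteq> 0"
    and J: "\<And>a b. a \<in> J \<Longrightarrow> b \<in> J \<Longrightarrow> a + b \<in> J"
        "\<And>v a. v \<in> T \<Longrightarrow> a \<in> J \<Longrightarrow> \<sigma> v a \<in> J"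
    and add: "\<And>v a b. v \<in> T \<Longrightarrow> \<sigma> v (a + b) = \<sigma> v a + \<sigma> v b"
    and invol: "\<And>v a. v \<in> T \<Longrightarrow> \<sigma> v (\<sigma> v a) = a"
    and comm: "\<And>v w a. v \<in> T \<Longrightarrow> w \<in> T \<Longrightarrow> \<sigma> v (\<sigma> w a) = \<sigma> w (\<sigma> v a)"
  shows "\<exists>y\<in>J. y \<noteq> 0 \<and> (\<exists>s. \<forall>v\<in>T. \<sigma> v y = (if s v then - y else y))"
  using assms(1) J(2) add invol comm
proof (induction T)
  case empty
  show ?case using z by auto
next
  case (insert v T)
  have "\<exists>y\<in>J. y \<noteq> 0 \<and> (\<exists>s. \<forall>v\<in>T. \<sigma> v y = (if s v then - y else y))"
    by (rule insert.IH) (rule insert.prems; simp)+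
  then obtain y s where y: "y \<in> J" "y \<noteq> 0"
    and s: "\<And>w. w \<in> T \<Longrightarrow> \<sigma> w y = (if s w then - y else y)" by blast
  note v = insertI1[of v T]
  have "\<sigma> v 0 = 0" using insert.prems(2)[OF v, of 0 0] by simp
  then have neg: "\<sigma> v (- a) = - \<sigma> v a" for a
    using insert.prems(2)[OF v, of a "- a"] by (simp add: eq_neg_iff_add_eq_0 add.commute)
  show ?case
  proof (cases "y + \<sigma> v y = 0")
    case True
    then have "\<sigma> v y = - y" by (simp add: eq_neg_iff_add_eq_0 add.commute)
    then show ?thesis
      using y s by (intro bexI[of _ y] conjI exI[of _ "\<lambda>w. w = v \<or> s w"]) auto
  next
    case False
    have "\<sigma> w (y + \<sigma> v y) = (if s w then - (y + \<sigma> v y) else y + \<sigma> v y)"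
        if "w \<in> T" for w
    proof -
      have w: "w \<in> insert v T" using that by simp
      have "\<sigma> w (y + \<sigma> v y) = \<sigma> w y + \<sigma> v (\<sigma> w y)"
        unfolding insert.prems(2)[OF w] insert.prems(4)[OF w v] ..
      then show ?thesis by (simp add: s[OF that] neg)
    qed
    moreover have "\<sigma> v (y + \<sigma> v y) = y + \<sigma> v y"
      unfolding insert.prems(2)[OF v] insert.prems(3)[OF v] by (rule add.commute)
    ultimately show ?thesis
      using y insert.hyps(2) insert.prems(1)[OF v y(1)] False
      by (intro bexI[of _ "y + \<sigma> v y"] conjI exI[of _ "\<lambda>w. w \<noteq> v \<and> s w"]) (auto intro: J(1))
  qed
qed

definition conjugate :: "'a \<Rightarrow> 'a \<Rightarrow> 'a" where
  "conjugate v a = scale (1 / q v) (v * a * v)"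

lemma twisted_conjugation:
  assumes \<phi>: "linear_map scale scale \<phi>" "\<phi> 1 = 1" "\<And>a b. \<phi> (a * b) = \<phi> a * \<phi> b"
  defines "\<sigma> \<equiv> \<lambda>v a. scale (1 / q v) (v * a * \<phi> v)"
  shows "\<sigma> v (a + b) = \<sigma> v a + \<sigma> v b"
    and "v \<in> V \<Longrightarrow> \<sigma> v (\<sigma> v a) = a"
    and "v \<in> V \<Longrightarrow> w \<in> V \<Longrightarrow> \<sigma> v (\<sigma> w a) = \<sigma> w (\<sigma> v a)"
    and "v \<in> V \<Longrightarrow> \<sigma> v a = (if s then - a else a) \<Longrightarrow> v * a = (if s then - (a * \<phi> v) else a * \<phi> v)"
proof -
  show "\<sigma> v (a + b) = \<sigma> v a + \<sigma> v b"
    by (simp add: \<sigma>_def distrib_left distrib_right scale_right_distrib)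
  have phi_square: "b * \<phi> v * \<phi> v = scale (q v) b" if "v \<in> V" for v b
    using arg_cong[OF square[OF that], of \<phi>]
    by (simp add: \<phi>(2,3) linear_scale[OF \<phi>(1)] mult.assoc scale_mult_right[symmetric])
  show "\<sigma> v (\<sigma> v a) = a" if "v \<in> V"
  proof -
    have "\<sigma> v (\<sigma> v a) = scale (1 / q v * (1 / q v)) (v * (v * (a * \<phi> v * \<phi> v)))"
      by (simp add: \<sigma>_def scale_out mult.assoc)
    then show ?thesis
      using q_nonzero[OF that] by (simp only: phi_square[OF that] square_left[OF that]) simp
  qed
  show "\<sigma> v (\<sigma> w a) = \<sigma> w (\<sigma> v a)" if "v \<in> V" "w \<in> V"
  proof (cases "v = w")
    case False
    have vw: "v * w = - (w * v)" by (rule anticommute[OF that False])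
    have vw': "\<phi> v * \<phi> w = - (\<phi> w * \<phi> v)"
      unfolding \<phi>(3)[symmetric] vw linear_minus[OF \<phi>(1)] ..
    have "\<sigma> v (\<sigma> w a) = scale (1 / q v * (1 / q w)) ((v * w) * a * (\<phi> w * \<phi> v))"
      by (simp add: \<sigma>_def scale_out mult.assoc)
    moreover have "\<sigma> w (\<sigma> v a) = scale (1 / q v * (1 / q w)) ((w * v) * a * (\<phi> v * \<phi> w))"
      by (simp add: \<sigma>_def scale_out mult.assoc
          mult.commute[of "1 / q v"])
    ultimately show ?thesis by (simp add: vw vw')
  qed simp
  show "v * a = (if s then - (a * \<phi> v) else a * \<phi> v)"
    if v: "v \<in> V" and eq: "\<sigma> v a = (if s then - a else a)"
  proof -
    have "\<sigma> v a * \<phi> v = scale (1 / q v) (v * (a * \<phi> v * \<phi> v))"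
      by (simp add: \<sigma>_def scale_mult_left[symmetric] mult.assoc)
    also have "\<dots> = v * a"
      using q_nonzero[OF v] by (simp add: phi_square[OF v] scale_mult_right[symmetric])
    finally show ?thesis by (simp add: eq split: if_splits)
  qed
qed

lemmas conjugate_props =
  twisted_conjugation[of "\<lambda>a. a", OF _ refl refl, folded conjugate_def]

lemma id_linear: "linear_map scale scale (\<lambda>a. a)"
  by (rule linearI) (simp_all add: vector_space_axioms)

lemma conjugate_linear: "linear_map scale scale (conjugate v)"
  by (rule linearI)
    (simp_all add: vector_space_axioms conjugate_def distrib_left distrib_right scale_right_distrib
      scale_out mult.commute)

lemmas conjugate_invol = conjugate_props(2)[OF id_linear] and conjugate_comm =
    conjugate_props(3)[OF id_linear]
  and conjugate_eigen = conjugate_props(4)[OF id_linear]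

text \<open>Averaging over the conjugations by the generators is a projection onto the scalars: it fixes
  central elements, and it kills every monomial except \<open>1\<close> because, the number of generators being
  even, some generator anticommutes with it.\<close>

definition avg :: "'a list \<Rightarrow> 'a \<Rightarrow> 'a" where
  "avg = foldr (\<lambda>v a. scale (1 / 2) (a + conjugate v a))"

lemma avg_simps [simp]: "avg [] a = a" "avg (v # l) a = scale (1 / 2) (avg l a + conjugate v (avg l a))"
  by (simp_all add: avg_def)

lemma avg_linear: "linear_map scale scale (avg l)"
proof (induction l)
  case Nil
  show ?case using id_linear by (simp add: avg_def id_def)
next
  case (Cons v l)
  then have "linear_map scale scale (\<lambda>a. scale (1 / 2) (avg l a + conjugate v (avg l a)))"
    by (intro linear_scaled linear_plus linear_compose[OF _ conjugate_linear])
  then show ?case by (simp add: avg_def comp_def)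
qed

lemma avg_conjugate: "set l \<subseteq> V \<Longrightarrow> v \<in> V \<Longrightarrow> avg l (conjugate v a) = conjugate v (avg l a)"
  by (induction l)
    (auto simp: linear_simps[OF conjugate_linear] conjugate_comm)

lemma avg_anticommuting:
  assumes "set l \<subseteq> V" "v \<in> set l" "conjugate v a = - a"
  shows "avg l a = 0"
  using assms
proof (induction l)
  case (Cons u l)
  show ?case
  proof (cases "v \<in> set l")
    case True
    then show ?thesis using Cons by (simp add: linear_zero[OF conjugate_linear])
  next
    case False
    then have "v = u" using Cons by simp
    moreover have "conjugate v (avg l a) = - avg l a"
      using avg_conjugate[of l v a] Cons by (simp add: \<open>v = u\<close> linear_minus[OF avg_linear])
    ultimately show ?thesis by simp
  qed
qed simp

definition monomials :: "'a set" where
  "monomials = {prod_list l | l. distinct l \<and> set l \<subseteq> V}"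

lemma monomials_span: "a \<in> span monomials"
proof (rule generate)
  show "1 \<in> span monomials"
    by (rule span_base) (force simp: monomials_def intro: exI[of _ "[]"])
  show "v * a \<in> span monomials" if v: "v \<in> V" and "a \<in> span monomials" for v a
    using that(2)
  proof (induction rule: span_induct_alt)
    case (step c m a)
    then obtain l where l: "distinct l" "set l \<subseteq> V" and m: "m = prod_list l"
      by (auto simp: monomials_def)
    have "v * m \<in> span monomials"
    proof (cases "v \<in> set l")
      case False
      then have "v * m \<in> monomials"
        using l v unfolding monomials_def m by (intro CollectI exI[of _ "v # l"]) auto
      then show ?thesis by (rule span_base)
    next
      case True
      then obtain l1 l2 where l12: "l = l1 @ v # l2" by (meson split_list)
      have "prod_list l1 * v = v * prod_list l1 \<or> prod_list l1 * v = - (v * prod_list l1)"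
        using monomial_swap[of l1 v] l l12 v by auto
      then have "v * (prod_list l1 * v) = scale (q v) (prod_list l1) \<or>
          v * (prod_list l1 * v) = scale (- q v) (prod_list l1)"
        using square_left[OF v] by auto
      moreover have "v * m = v * (prod_list l1 * v) * prod_list l2" by (simp add: m l12 mult.assoc)
      ultimately have "v * m = scale (q v) (prod_list (l1 @ l2)) \<or>
          v * m = scale (- q v) (prod_list (l1 @ l2))"
        by (auto simp: scale_mult_left[symmetric])
      moreover have "prod_list (l1 @ l2) \<in> monomials"
        using l l12 unfolding monomials_def by (intro CollectI exI[of _ "l1 @ l2"]) auto
      ultimately show ?thesis using span_scale[OF span_base] by metis
    qed
    then show ?case
      using step by (simp add: distrib_left scale_mult_right[symmetric] span_add span_scale)
  qed (simp add: span_zero)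
qed (auto intro: span_add span_scale)

lemma avg_scalar:
  assumes l: "set l = V"
  shows "avg l a \<in> scalars scale"
  using monomials_span[of a]
proof (induction rule: span_induct_alt)
  case base
  show ?case
    using linear_zero[OF avg_linear] by (auto simp: scalars_def intro!: exI[of _ 0])
next
  case (step c m a)
  then obtain k where k: "distinct k" "set k \<subseteq> V" and m: "m = prod_list k"
    by (auto simp: monomials_def)
  have "avg l m \<in> scalars scale"
  proof (cases "k = []")
    case True
    have "avg l' 1 = 1" if "set l' \<subseteq> V" for l'
      using that
      by (induction l')
        (auto simp: conjugate_def square q_nonzero half_double[OF two, of 1, unfolded one_add_one])
    then have "avg l m = 1" using l m True by simp
    then show ?thesis by (auto simp: scalars_def intro!: exI[of _ 1])
  next
    case False
    have "\<exists>v\<in>V. even (length k) = (v \<in> set k)"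
    proof (cases "even (length k)")
      case True
      then show ?thesis using False k by (intro bexI[of _ "hd k"]) auto
    next
      case odd: False
      have "set k \<noteq> V" using odd even_card distinct_card[OF k(1)] by auto
      then show ?thesis using k odd by blast
    qed
    then obtain v where v: "v \<in> V" and "even (length k) = (v \<in> set k)" by blast
    then have "m * v = - (v * m)" using monomial_swap[OF k v] m by simp
    then have "conjugate v m = - m"
      using q_nonzero[OF v] by (simp add: conjugate_def mult.assoc square_left[OF v])
    then have "avg l m = 0" using avg_anticommuting[of l v m] l v by simp
    then show ?thesis by (auto simp: scalars_def intro!: exI[of _ 0])
  qed
  then obtain r r' where "avg l m = scale r 1" "avg l a = scale r' 1"
    using step by (auto simp: scalars_def)
  then have "avg l (scale c m + a) = scale (c * r + r') 1"
    by (simp add: linear_simps[OF avg_linear] scale_left_distrib)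
  then show ?case by (auto simp: scalars_def)
qed

lemma central_scalar:
  assumes "\<And>v. v \<in> V \<Longrightarrow> v * z = z * v"
  shows "z \<in> scalars scale"
proof -
  obtain l where l: "set l = V" using fin finite_list by blast
  have "avg k z = z" if "set k \<subseteq> V" for k
    using that
    by (induction k) (auto simp: conjugate_def assms square_right q_nonzero half_double[OF two])
  then show ?thesis using avg_scalar[OF l, of z] l by simp
qed


section \<open>Involutive automorphisms and skew derivations are inner\<close>

text \<open>A common eigenvector \<open>y\<close> of the maps \<open>y \<mapsto> v y (\<phi> v)\<^sup>-\<^sup>1\<close> intertwines \<open>\<phi>\<close> and the identity up to
  signs on the generators, and a monomial corrects the signs. The intertwiner \<open>c\<close> obtained in this
  way is invertible because the two-sided ideal \<open>c A\<close> contains, by the same argument applied to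
  ordinary conjugation, a nonzero central element.\<close>

lemma involution_inner:
  assumes \<phi>: "linear_map scale scale \<phi>" "\<phi> 1 = 1" "\<And>a b. \<phi> (a * b) = \<phi> a * \<phi> b"
    "\<And>a. \<phi> (\<phi> a) = a"
  shows "\<exists>c c'. c * c' = 1 \<and> c' * c = 1 \<and> c\<^sup>2 \<in> scalars scale \<and> (\<forall>a. \<phi> a = c' * a * c)"
proof -
  note tw = twisted_conjugation[OF \<phi>(1-3)]
  obtain y s where y: "y \<noteq> 0"
    and "\<forall>v\<in>V. scale (1 / q v) (v * y * \<phi> v) = (if s v then - y else y)"
    using common_eigenvector[OF fin, of 1 UNIV "\<lambda>v a. scale (1 / q v) (v * a * \<phi> v)"] tw
    by auto
  then have vy: "v * y = (if s v then - (y * \<phi> v) else y * \<phi> v)" if "v \<in> V" for v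
    using tw(4)[OF that] that by blast
  obtain w w' where w: "w' * w = 1" "\<And>v. v \<in> V \<Longrightarrow> w * v = (if s v then - (v * w) else v * w)"
    using sign_unit[of s] by blast
  define c where "c = w * y"
  have "w' * c = y" by (simp add: c_def mult.assoc[symmetric] w(1))
  then have "c \<noteq> 0" using y by auto
  have vc: "v * c = c * \<phi> v" if "v \<in> V" for v
  proof -
    have "c * \<phi> v = w * (y * \<phi> v)" "v * c = v * w * y" by (simp_all add: c_def mult.assoc)
    moreover have "w * (y * \<phi> v) = (if s v then - (w * v * y) else w * v * y)"
      using vy[OF that] by (auto simp: mult.assoc)
    ultimately show ?thesis using w(2)[OF that] by (auto split: if_splits)
  qed
  have ac: "a * c = c * \<phi> a" for a
  proof (rule generate[of "\<lambda>a. a * c = c * \<phi> a"])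
    show "v * a * c = c * \<phi> (v * a)" if "v \<in> V" "a * c = c * \<phi> a" for v a
      using that vc by (simp add: \<phi>(3) mult.assoc) (simp add: mult.assoc[symmetric])
  qed (auto simp: \<phi>(2) distrib_left distrib_right linear_simps[OF \<phi>(1)]
      scale_out)
  have "\<exists>c'. c * c' = 1"
  proof -
    let ?J = "range (\<lambda>b. c * b)"
    have J: "conjugate v a \<in> ?J" if "a \<in> ?J" "v \<in> V" for v a
    proof -
      from that(1) obtain b where "a = c * b" by blast
      then have "conjugate v a = c * scale (1 / q v) (\<phi> v * b * v)"
        using vc[OF that(2)] by (simp add: conjugate_def scale_mult_right[symmetric] mult.assoc)
          (simp add: mult.assoc[symmetric])
      then show ?thesis by blast
    qed
    have Jadd: "a + b \<in> ?J" if "a \<in> ?J" "b \<in> ?J" for a b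
      using that by (auto simp: distrib_left[symmetric])
    have "\<exists>y\<in>?J. y \<noteq> 0 \<and> (\<exists>s. \<forall>v\<in>V. conjugate v y = (if s v then - y else y))"
      by (rule common_eigenvector[OF fin, of c])
        (use \<open>c \<noteq> 0\<close> J Jadd linear_add[OF conjugate_linear] conjugate_invol conjugate_comm in
          \<open>auto intro: range_eqI[of _ _ 1]\<close>)
    then obtain b s where b: "c * b \<noteq> 0"
      and "\<forall>v\<in>V. conjugate v (c * b) = (if s v then - (c * b) else c * b)" by blast
    then have vb: "v * (c * b) = (if s v then - (c * b * v) else c * b * v)" if "v \<in> V" for v
      using conjugate_eigen[OF that] that by blast
    obtain w w' where w: "w * w' = 1" "\<And>v. v \<in> V \<Longrightarrow> w * v = (if s v then - (v * w) else v * w)"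
      using sign_unit[of s] by blast
    have "v * (c * b * w) = c * b * w * v" if "v \<in> V" for v
    proof -
      have "v * (c * b * w) = v * (c * b) * w" "c * b * w * v = c * b * (w * v)"
        by (simp_all add: mult.assoc)
      then show ?thesis using vb[OF that] w(2)[OF that] by (auto simp: mult.assoc)
    qed
    then obtain r where r: "c * b * w = scale r 1"
      using central_scalar unfolding scalars_def by blast
    have "c * b * w * w' = c * b" by (simp add: mult.assoc w(1))
    then have "r \<noteq> 0" using b r by auto
    then have "c * scale (1 / r) (b * w) = 1"
      using r by (simp add: scale_mult_right[symmetric] mult.assoc)
    then show ?thesis by blast
  qed
  then obtain c' where c': "c * c' = 1" by blast
  have "\<phi> c' * c = 1" using ac[of "\<phi> c'"] by (simp add: \<phi>(4) c')
  then have "\<phi> c' = c'" by (metis c' mult.assoc mult.left_neutral mult.right_neutral)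
  then have c'c: "c' * c = 1" using \<open>\<phi> c' * c = 1\<close> by simp
  have "v * c\<^sup>2 = c\<^sup>2 * v" for v
    using ac[of v] ac[of "\<phi> v"] by (simp add: power2_eq_square mult.assoc \<phi>(4)) (metis
        mult.assoc)
  then have "c\<^sup>2 \<in> scalars scale" by (rule central_scalar)
  moreover have "\<phi> a = c' * a * c" for a
    unfolding mult.assoc[of c' a c] ac[of a] by (simp add: mult.assoc[symmetric] c'c)
  ultimately show ?thesis using c' c'c by blast
qed

text \<open>A skew derivation is determined by its values on the generators, and an inner one can be made to
  agree with it on one generator after the other: for the next generator \<open>v\<close>, the element
  \<open>d v v\<^sup>-\<^sup>1 / 2\<close> gives an inner skew derivation with the right value on \<open>v\<close> which vanishes on the
  earlier generators if \<open>d\<close> does.\<close>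

lemma skew_derivation_inner:
  assumes \<phi>: "linear_map scale scale \<phi>" "\<phi> 1 = 1" "\<And>a b. \<phi> (a * b) = \<phi> a * \<phi> b"
    and d: "linear_map scale scale d" "\<And>a b. d (a * b) = d a * b + \<phi> a * d b"
  shows "\<exists>u. \<forall>a. d a = u * a - \<phi> a * u"
proof -
  have d1: "d 1 = 0" using d(2)[of 1 1] by (simp add: \<phi>(2))
  have "\<exists>u. \<forall>v\<in>T. d v = u * v - \<phi> v * u" if "finite T" "T \<subseteq> V" for T
    using that
  proof (induction T)
    case (insert v T)
    then obtain u where u: "\<And>v. v \<in> T \<Longrightarrow> d v = u * v - \<phi> v * u" by auto
    have v: "v \<in> V" using insert by simp
    define D where "D a = d a - (u * a - \<phi> a * u)" for a
    have D_mult: "D (a * b) = D a * b + \<phi> a * D b" for a b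
      by (simp add: D_def d(2) \<phi>(3) algebra_simps)
    have D_linear: "linear_map scale scale D"
      by (rule linearI)
        (simp_all add: D_def vector_space_axioms linear_simps[OF d(1)]
          linear_simps[OF \<phi>(1)] scale_right_diff_distrib algebra_simps
          scale_out)
    have D1: "D 1 = 0" by (simp add: D_def d1 \<phi>(2))
    let ?r = "1 / (2 * q v)"
    define t where "t = scale ?r (D v * v)"
    have r: "scale ?r (scale (q v) a) = scale (1 / 2) a" for a
      using q_nonzero[OF v] by simp
    have "D (v * v) = 0" by (simp add: square[OF v] linear_scale[OF D_linear] D1)
    then have Dv: "\<phi> v * D v = - (D v * v)"
      by (simp add: D_mult eq_neg_iff_add_eq_0 add.commute)
    have "t * v = scale (1 / 2) (D v)"
      by (simp add: t_def scale_mult_left[symmetric] square_right[OF v] r del: scale_scale)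
    moreover have "\<phi> v * t = - scale (1 / 2) (D v)"
    proof -
      have "\<phi> v * t = scale ?r (\<phi> v * D v * v)"
        by (simp add: t_def scale_mult_right[symmetric] mult.assoc)
      also have "\<dots> = - scale ?r (D v * v * v)" by (simp add: Dv)
      finally show ?thesis by (simp add: square_right[OF v] r del: scale_scale)
    qed
    ultimately have tv: "t * v - \<phi> v * t = D v"
      using half_double[OF two, of "D v"] by (simp add: scale_right_distrib)
    have tw: "t * w - \<phi> w * t = 0" if "w \<in> T" for w
    proof -
      have w: "w \<in> V" "w \<noteq> v" using that insert by auto
      have Dw: "D w = 0" using u[OF that] by (simp add: D_def)
      have "D (w * v) + D (v * w) = 0"
        using anticommute[OF w(1) v w(2)] by (simp add: linear_minus[OF D_linear])
      then have *: "\<phi> w * D v = - (D v * w)" by (simp add: D_mult Dw eq_neg_iff_add_eq_0)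
      have "\<phi> w * t = scale ?r (\<phi> w * D v * v)"
        by (simp add: t_def scale_mult_right[symmetric] mult.assoc)
      also have "\<dots> = scale ?r (- (D v * w * v))" unfolding * by simp
      finally have "t * w - \<phi> w * t = scale ?r (D v * (v * w + w * v))"
        by (simp add: t_def scale_mult_left[symmetric] distrib_left mult.assoc scale_right_distrib)
      then show ?thesis using anticommute[OF w(1) v w(2)] by simp
    qed
    have "d w = (u + t) * w - \<phi> w * (u + t)" if "w \<in> insert v T" for w
      using that tv tw[of w] u[of w] by (auto simp: D_def algebra_simps)
    then show ?case by blast
  qed simp
  from this[OF fin subset_refl] obtain u where u: "\<And>v. v \<in> V \<Longrightarrow> d v = u * v - \<phi> v * u" by blast
  have "d a = u * a - \<phi> a * u" for a
  proof (rule generate[of "\<lambda>a. d a = u * a - \<phi> a * u"])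
    show "d (v * a) = u * (v * a) - \<phi> (v * a) * u" if "v \<in> V" "d a = u * a - \<phi> a * u"
        for v a
      unfolding d(2) \<phi>(3) u[OF that(1)] that(2) by (simp add: algebra_simps)
    show "d (scale r a) = u * scale r a - \<phi> (scale r a) * u" if "d a = u * a - \<phi> a * u"
        for r a
      unfolding linear_scale[OF d(1)] linear_scale[OF \<phi>(1)] that
      by (simp add: scale_out scale_right_diff_distrib)
  qed (simp_all add: d1 \<phi>(2) linear_add[OF d(1)] linear_add[OF \<phi>(1)] algebra_simps)
  then show ?thesis by blast
qed

end


section \<open>Semisimple Clifford algebras\<close>

lemma (in k_algebra) scalars_subspace: "subspace (scalars scale)"
  unfolding scalars_def
proof (rule subspaceI)
  show "0 \<in> {scale r 1 | r. True}" by (auto intro: exI[of _ 0])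
  show "x + y \<in> {scale r 1 | r. True}" if "x \<in> {scale r 1 | r. True}" "y \<in> {scale r 1 | r. True}"
    for x y using that by (auto simp: scale_left_distrib[symmetric])
  show "scale c x \<in> {scale r 1 | r. True}" if "x \<in> {scale r 1 | r. True}" for c x
    using that by auto
qed

text \<open>A subspace of an algebra whose elements have scalar squares carries the quadratic form
  \<open>w \<mapsto> w\<^sup>2\<close>, with polar form \<open>v w + w v\<close>. If this form is nondegenerate, an orthogonal set of vectors
  with nonzero squares that has the largest possible size spans the subspace: the vectors
  orthogonal to it have square zero, hence are orthogonal to each other, hence lie in the
      radical.\<close>

lemma (in k_algebra) ex_orthogonal_basis:
  assumes two: "(2::'k) \<noteq> 0" and Y: "finite Y" "independent Y"
    and polar: "\<And>v w. v \<in> span Y \<Longrightarrow> w \<in> span Y \<Longrightarrow> v * w + w * v \<in> scalars scale"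
    and square: "\<And>w. w \<in> span Y \<Longrightarrow> w * w \<in> scalars scale"
    and nondegenerate: "\<And>w. w \<in> span Y \<Longrightarrow> (\<And>v. v \<in> span Y \<Longrightarrow> v * w + w * v = 0) \<Longrightarrow> w = 0"
  shows "\<exists>V. finite V \<and> card V = card Y \<and> V \<subseteq> span Y \<and> Y \<subseteq> span V \<and>
    (\<forall>v\<in>V. v * v \<noteq> 0) \<and> (\<forall>v\<in>V. \<forall>w\<in>V. v \<noteq> w
        \<longrightarrow> v * w + w * v = 0)"
proof -
  define orth where "orth V \<longleftrightarrow> V \<subseteq> span Y \<and> (\<forall>v\<in>V. v * v \<noteq> 0) \<and>
    (\<forall>v\<in>V. \<forall>w\<in>V. v \<noteq> w \<longrightarrow> v * w + w * v = 0)" for V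
  have double: "a = 0" if "a + a = 0" for a :: 'a
  proof -
    have "scale 2 a = 0" using that scale_left_distrib[of 1 1 a] by simp
    then show ?thesis using two by simp
  qed
  have commuting_subspace: "subspace {z. z * v + v * z = 0}" for v
  proof (rule subspaceI)
    fix y z c assume y: "y \<in> {z. z * v + v * z = 0}" and z: "z \<in> {z. z * v + v * z = 0}"
    have "(y + z) * v + v * (y + z) = (y * v + v * y) + (z * v + v * z)"
      by (simp add: algebra_simps)
    then show "y + z \<in> {z. z * v + v * z = 0}" using y z by simp
    have "scale c z * v + v * scale c z = scale c (z * v + v * z)"
      by (simp add: scale_out scale_right_distrib)
    then show "scale c z \<in> {z. z * v + v * z = 0}" using z by simp
  qed simp
  have bound: "finite V \<and> card V \<le> card Y" if "orth V" for V
  proof (rule independent_span_bound[OF Y(1)])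
    show "independent V"
    proof
      assume "dependent V"
      then obtain v where v: "v \<in> V" "v \<in> span (V - {v})" by (auto simp: dependent_def)
      have "V - {v} \<subseteq> {z. z * v + v * z = 0}"
        using that v(1) by (auto simp: orth_def)
      then have "v * v + v * v = 0"
        using v(2) span_minimal[OF _ commuting_subspace] by blast
      then have "v * v = 0" by (rule double)
      then show False using that v(1) unfolding orth_def by blast
    qed
  qed (use that in \<open>simp add: orth_def\<close>)
  \<comment> \<open>Orthogonal vectors with nonzero squares are independent, so their number is bounded.\<close>
  have "orth {}" by (simp add: orth_def)
  then obtain V where V: "orth V" and max: "\<And>V'. orth V' \<Longrightarrow> card V' \<le> card V"
    using ex_has_greatest_nat[of orth "{}" card "Suc (card Y)"] bound by (meson le_imp_less_Suc)
  have finV: "finite V" using bound[OF V] by blast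
  have orthV: "V \<subseteq> span Y" "\<And>v. v \<in> V \<Longrightarrow> v * v \<noteq> 0"
    "\<And>v w. v \<in> V \<Longrightarrow> w \<in> V \<Longrightarrow> v \<noteq> w \<Longrightarrow> v * w + w * v = 0"
    using V by (auto simp: orth_def)
  let ?C = "{z \<in> span Y. \<forall>v\<in>V. z * v + v * z = 0}"
  have decompose: "\<exists>z\<in>?C. w - z \<in> span V" if w: "w \<in> span Y" for w
  proof -
    have "\<exists>r. w * v + v * w = scale r (v * v + v * v)" if v: "v \<in> V" for v
    proof -
      have vY: "v \<in> span Y" using orthV(1) v by blast
      obtain b where b: "w * v + v * w = scale b 1"
        using polar[OF w vY] by (auto simp: scalars_def)
      obtain q where q: "v * v = scale q 1" using square[OF vY] by (auto simp: scalars_def)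
      have "q \<noteq> 0" using orthV(2)[OF v] q by auto
      then show ?thesis
        using two b q
        by (intro exI[of _ "b / (2 * q)"]) (simp add: scale_left_distrib[symmetric])
    qed
    then obtain r where r: "\<And>v. v \<in> V \<Longrightarrow> w * v + v * w = scale (r v) (v * v + v * v)" by metis
    define p where "p = (\<Sum>v\<in>V. scale (r v) v)"
    have p: "p \<in> span V" unfolding p_def by (intro span_sum span_scale span_base)
    have "p * v + v * p = scale (r v) (v * v + v * v)" if v: "v \<in> V" for v
    proof -
      have "p * v + v * p = (\<Sum>u\<in>V. scale (r u) (u * v + v * u))"
        by (simp add: p_def sum_distrib_left sum_distrib_right sum.distrib[symmetric]
            scale_out scale_right_distrib)
      also have "\<dots> = (\<Sum>u\<in>{v}. scale (r u) (u * v + v * u))"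
        by (rule sum.mono_neutral_right) (use finV v orthV(3) in auto)
      finally show ?thesis by simp
    qed
    moreover have "(w - p) * v + v * (w - p) = (w * v + v * w) - (p * v + v * p)" for v
      by (simp add: algebra_simps)
    ultimately have "(w - p) * v + v * (w - p) = 0" if "v \<in> V" for v
      using r[OF that] that by simp
    moreover have "p \<in> span Y" using p span_minimal[OF orthV(1) subspace_span] by blast
    ultimately show ?thesis
      using w p by (intro bexI[of _ "w - p"]) (auto intro: span_diff)
  qed
  have isotropic: "z * z = 0" if z: "z \<in> ?C" for z
  proof (rule ccontr)
    assume nz: "z * z \<noteq> 0"
    have "z \<notin> V" using z nz double by blast
    have "\<forall>v\<in>V. v * z + z * v = 0" "\<forall>v\<in>V. z * v + v * z = 0"
      using z by (simp_all add: add.commute)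
    then have "orth (insert z V)" using V z nz unfolding orth_def by blast
    from max[OF this] show False using \<open>z \<notin> V\<close> finV by simp
  qed
  have radical: "z = 0" if z: "z \<in> ?C" for z
  proof (rule nondegenerate)
    fix w assume "w \<in> span Y"
    then obtain z' where z': "z' \<in> ?C" and "w - z' \<in> span V" using decompose by blast
    have "z + z' \<in> ?C"
    proof -
      have "(z + z') * v + v * (z + z') = (z * v + v * z) + (z' * v + v * z')" for v
        by (simp add: algebra_simps)
      then show ?thesis using z z' by (auto intro: span_add)
    qed
    then have "z * z' + z' * z = 0"
      using isotropic[of "z + z'"] isotropic[OF z] isotropic[OF z'] by (simp add: algebra_simps)
    moreover have "(w - z') * z + z * (w - z') = 0"
    proof -
      have "V \<subseteq> {y. y * z + z * y = 0}" using z by (auto simp: add.commute)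
      then show ?thesis using \<open>w - z' \<in> span V\<close> span_minimal[OF _ commuting_subspace] by blast
    qed
    ultimately show "w * z + z * w = 0" by (simp add: algebra_simps)
  qed (use z in blast)
  have "Y \<subseteq> span V"
  proof
    fix y assume "y \<in> Y"
    then obtain z where z: "z \<in> ?C" "y - z \<in> span V" using decompose[OF span_base] by blast
    then show "y \<in> span V" using radical[OF z(1)] by simp
  qed
  moreover have "card Y \<le> card V" using independent_span_bound[OF finV Y(2) \<open>Y \<subseteq> span V\<close>] by simp
  ultimately have "card V = card Y" using bound[OF V] by (simp add: le_antisym)
  then show ?thesis
    using finV V \<open>Y \<subseteq> span V\<close> unfolding orth_def by (intro exI[of _ V]) blast
qed

text \<open>If \<open>I\<close> has a complement \<open>J\<close> and \<open>1 = e + f\<close> accordingly, then \<open>x = x e + x f = x f\<close> for every \<open>x\<close>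
  in \<open>I\<close>, so that \<open>x\<close> also lies in \<open>J\<close>.\<close>

lemma semisimple_no_square_zero:
  fixes I :: "'a::ring_1 set"
  assumes "semisimple_ring TYPE('a)" and I: "left_ideal I"
    and zero: "\<And>x y. x \<in> I \<Longrightarrow> y \<in> I \<Longrightarrow> x * y = 0" and x:
        "x \<in> I"
  shows "x = 0"
proof -
  obtain J where J: "left_ideal J" "I \<inter> J = {0}" "{x + y | x y. x \<in> I \<and> y \<in> J} = UNIV"
    using assms(1)[unfolded semisimple_ring_def, rule_format, OF I] by auto
  have "1 \<in> {x + y | x y. x \<in> I \<and> y \<in> J}" unfolding J(3) by (rule UNIV_I)
  then obtain e f where ef: "1 = e + f" "e \<in> I" "f \<in> J" by blast
  have "x * f = x * e + x * f" unfolding zero[OF x ef(2)] by simp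
  also have "\<dots> = x" unfolding distrib_left[symmetric] ef(1)[symmetric] by simp
  finally have "x * f = x" .
  moreover have "x * f \<in> J" using J(1) ef(3) unfolding left_ideal_def by blast
  ultimately have "x \<in> J" by simp
  then show ?thesis using J(2) x by blast
qed

lemma clifford_presented:
  "clifford_algebra s n \<alpha> \<beta> \<gamma> lam G X \<Longrightarrow>
    presented_algebra s (cl_gens n) (clifford_relations n \<alpha> \<beta> \<gamma> lam)
        (case_cl_gen G X)"
  by (simp add: clifford_algebra_def)

text \<open>The four families of relations have two shapes: the value of a square and the value of a polar
  product of generators.\<close>

lemma clifford_relation_cases:
  assumes "r \<in> clifford_relations n \<alpha> \<beta> \<gamma> lam"
  obtains y b where "y \<in> cl_gens n" "r = gen y * gen y - const b"
  | y z b where "y \<in> cl_gens n" "z \<in> cl_gens n" "r = gen y * gen z + gen z * gen y - const b"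
proof -
  have G: "Gen_G \<in> cl_gens n" and X: "\<And>i. i \<in> {1..n} \<Longrightarrow> Gen_X i \<in> cl_gens n"
    by (simp_all add: cl_gens_def)
  consider "r = gen Gen_G * gen Gen_G - const \<alpha>"
    | i where "i \<in> {1..n}" "r = gen (Gen_X i) * gen (Gen_X i) - const (\<beta> i)"
    | i where "i \<in> {1..n}" "r = gen Gen_G * gen (Gen_X i) + gen (Gen_X i) * gen Gen_G - const (\<gamma> i)"
    | i j where "i \<in> {1..n}" "j \<in> {1..n}"
        "r = gen (Gen_X i) * gen (Gen_X j) + gen (Gen_X j) * gen (Gen_X i) - const (lam i j)"
    using assms unfolding clifford_relations_def by blast
  then show thesis
    by cases (use that(1)[OF G] that(1)[OF X] that(2)[OF G X] that(2)[OF X X] in blast)+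
qed

lemma clifford_polar:
  assumes cl: "clifford_algebra s n \<alpha> \<beta> \<gamma> lam G X" and "y \<in> cl_gens n" "z \<in> cl_gens n"
  defines "\<iota> \<equiv> case_cl_gen G X"
  shows "\<iota> y * \<iota> z + \<iota> z * \<iota> y \<in> scalars s"
proof -
  interpret k_algebra s using clifford_presented[OF cl] by (rule presented_algebra_k_algebra)
  note ev = presented_algebra_product[OF clifford_presented[OF cl], folded \<iota>_def]
  have sc: "s b 1 \<in> scalars s" for b by (auto simp: scalars_def)
  have sq: "\<iota> y * \<iota> y + \<iota> y * \<iota> y \<in> scalars s"
    if "y \<in> cl_gens n" "gen y * gen y - const b \<in> clifford_relations n \<alpha> \<beta> \<gamma> lam" for y b
    unfolding ev(1)[OF that(1,1,2)] scale_left_distrib[symmetric] by (rule sc)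
  have pol: "\<iota> y * \<iota> z + \<iota> z * \<iota> y \<in> scalars s" "\<iota> z * \<iota> y + \<iota> y * \<iota> z \<in> scalars s"
    if "y \<in> cl_gens n" "z \<in> cl_gens n"
      "gen y * gen z + gen z * gen y - const b \<in> clifford_relations n \<alpha> \<beta> \<gamma> lam" for y z b
    using ev(2)[OF that] sc[of b] by (simp_all add: add.commute)
  have G: "gen Gen_G * gen Gen_G - const \<alpha> \<in> clifford_relations n \<alpha> \<beta> \<gamma> lam"
    by (simp add: clifford_relations_def)
  have X: "gen (Gen_X i) * gen (Gen_X i) - const (\<beta> i) \<in> clifford_relations n \<alpha> \<beta> \<gamma> lam"
    if "i \<in> {1..n}" for i
    using that unfolding clifford_relations_def by blast
  have GX: "gen Gen_G * gen (Gen_X i) + gen (Gen_X i) * gen Gen_G - const (\<gamma> i)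
      \<in> clifford_relations n \<alpha> \<beta> \<gamma> lam"
    if "i \<in> {1..n}" for i
    using that unfolding clifford_relations_def by blast
  have XX: "gen (Gen_X i) * gen (Gen_X j) + gen (Gen_X j) * gen (Gen_X i) - const (lam i j)
      \<in> clifford_relations n \<alpha> \<beta> \<gamma> lam"
    if "i \<in> {1..n}" "j \<in> {1..n}" "i < j" for i j
    using that unfolding clifford_relations_def by blast
  have idx: "i \<in> {1..n}" if "Gen_X i \<in> cl_gens n" for i
    using that by (auto simp: cl_gens_def)
  show ?thesis
  proof (cases y)
    case y: Gen_G
    show ?thesis
    proof (cases z)
      case Gen_G
      then show ?thesis using sq[OF assms(2)] G y by blast
    next
      case (Gen_X j)
      then have "j \<in> {1..n}" using idx assms(3) by blast
      from GX[OF this] show ?thesis using Gen_X y pol(1)[OF assms(2,3)] by blast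
    qed
  next
    case y: (Gen_X i)
    then have i: "i \<in> {1..n}" using idx assms(2) by blast
    show ?thesis
    proof (cases z)
      case Gen_G
      then show ?thesis using GX[OF i] y pol(2)[OF assms(3,2)] by blast
    next
      case z: (Gen_X j)
      then have j: "j \<in> {1..n}" using idx assms(3) by blast
      consider "i = j" | "i < j" | "j < i" by linarith
      then show ?thesis
      proof cases
        case 1
        then show ?thesis using sq[OF assms(2)] X[OF i] y z by blast
      next
        case 2
        then show ?thesis using XX[OF i j] y z pol(1)[OF assms(2,3)] by blast
      next
        case 3
        then show ?thesis using XX[OF j i] y z pol(2)[OF assms(3,2)] by blast
      qed
    qed
  qed
qed

text \<open>The generators are linearly independent. For coefficients \<open>f\<close>, the assignment
  \<open>y \<mapsto> (y, f y; 0, - y)\<close> of \<open>2 \<times> 2\<close> matrices over the algebra preserves the relations, because the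
  relations only prescribe the scalars \<open>y z + z y\<close>. The upper right entry therefore is a linear map
  on the algebra with the prescribed value \<open>f y\<close> at each generator \<open>y\<close>.\<close>

lemma clifford_coordinate:
  fixes s :: "'k::field \<Rightarrow> 'a::ring_1 \<Rightarrow> 'a" and f :: "cl_gen \<Rightarrow> 'k"
  assumes cl: "clifford_algebra s n \<alpha> \<beta> \<gamma> lam G X"
  shows "\<exists>L. linear_map s s L \<and> (\<forall>y\<in>cl_gens n. L (case_cl_gen G X y) = s (f y) 1)"
proof -
  define \<iota> where "\<iota> = case_cl_gen G X"
  have pres: "presented_algebra s (cl_gens n) (clifford_relations n \<alpha> \<beta> \<gamma> lam) \<iota>"
    using cl by (simp add: clifford_algebra_def \<iota>_def)
  interpret k_algebra s using pres by (rule presented_algebra_k_algebra)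
  define s2 :: "'k \<Rightarrow> 'a \<times> 'a \<Rightarrow> 'a \<times> 'a" where "s2 r m = (s r (fst m), s r (snd m))" for r m
  have vs2: "vector_space s2"
    by unfold_locales (simp_all add: s2_def scale_right_distrib scale_left_distrib)
  define T :: "cl_gen \<Rightarrow> 'a \<times> 'a \<Rightarrow> 'a \<times> 'a"
    where "T y m = (\<iota> y * fst m + s (f y) (snd m), - (\<iota> y * snd m))" for y m
  have TT: "T y (T z m) + T z (T y m) = s2 b m" if "\<iota> y * \<iota> z + \<iota> z * \<iota> y = s b 1" for y z b m
  proof -
    have "\<iota> y * (\<iota> z * a) + \<iota> z * (\<iota> y * a) = s b a" for a
      using arg_cong[OF that, of "\<lambda>t. t * a"]
      by (simp add: distrib_right mult.assoc scale_mult_left[symmetric])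
    from this[of "fst m"] this[of "snd m"] show ?thesis
      by (simp add: T_def s2_def prod_eq_iff scale_mult_right[symmetric] algebra_simps)
  qed
  have T_square: "T y (T y m) = s2 b m" if "\<iota> y * \<iota> y = s b 1" for y b m
  proof -
    have sq: "\<iota> y * (\<iota> y * a) = s b a" for a
      using that by (simp add: mult.assoc[symmetric] scale_mult_left[symmetric])
    show ?thesis
      by (simp add: T_def s2_def prod_eq_iff distrib_left sq scale_mult_right[symmetric])
  qed
  have act: "lin_ext s2 (\<lambda>w. foldr T w m) r = 0" if r: "r \<in> clifford_relations n \<alpha> \<beta> \<gamma> lam" for r m
    using r
  proof (cases rule: clifford_relation_cases)
    case (1 y b)
    then have "\<iota> y * \<iota> y = s b 1" using presented_algebra_product(1)[OF pres, of y y b]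
        r by (simp add: \<iota>_def)
    then show ?thesis
      unfolding 1 gen_mult const_eq lin_ext_diff[OF vs2] lin_ext_fscale[OF vs2] lin_ext_fbasis[OF vs2]
      by (simp add: T_square)
  next
    case (2 y z b)
    then have "\<iota> y * \<iota> z + \<iota> z * \<iota> y = s b 1"
      using presented_algebra_product(2)[OF pres, of y z b] r by (simp add: \<iota>_def)
    then show ?thesis
      unfolding 2 gen_mult const_eq lin_ext_diff[OF vs2] lin_ext_add[OF vs2] lin_ext_fscale[OF vs2]
        lin_ext_fbasis[OF vs2]
      by (simp add: TT)
  qed
  have "\<exists>L. linear_map s s2 L \<and> L 1 = (0, 1) \<and>
      (\<forall>y\<in>cl_gens n. \<forall>a. L (\<iota> y * a) = T y (L a))"
  proof (rule presented_algebra_lift[OF pres vs2 _ act])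
    show "linear_map s2 s2 (T y)" for y
      by (rule linearI)
        (simp_all add: vs2 T_def s2_def distrib_left scale_right_distrib
          scale_mult_right[symmetric] mult.commute)
  qed
  then obtain L where L: "linear_map s s2 L" "L 1 = (0, 1)"
    "\<And>y a. y \<in> cl_gens n \<Longrightarrow> L (\<iota> y * a) = T y (L a)" by blast
  have "linear_map s s (\<lambda>a. fst (L a))"
    by (rule linearI) (simp_all add: vector_space_axioms linear_simps[OF L(1)] s2_def)
  moreover have "fst (L (\<iota> y)) = s (f y) 1" if "y \<in> cl_gens n" for y
    using L(3)[OF that, of 1] by (simp add: L(2) T_def)
  ultimately show ?thesis unfolding \<iota>_def by (intro exI[of _ "\<lambda>a. fst (L a)"]) simp
qed

text \<open>Nondegeneracy of the form: an element \<open>w\<close> of its radical anticommutes with the generators, so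
  that \<open>A w\<close> is a two-sided ideal, and \<open>w\<^sup>2 = 0\<close>, so that this ideal has square zero.\<close>

lemma clifford_radical:
  fixes s :: "'k::field \<Rightarrow> 'a::ring_1 \<Rightarrow> 'a"
  assumes two: "(2::'k) \<noteq> 0" and pres: "presented_algebra s \<Gamma> R \<iota>"
    and ss: "semisimple_ring TYPE('a)"
    and w: "w * w + w * w = 0" "\<And>y. y \<in> \<Gamma> \<Longrightarrow> \<iota> y * w + w * \<iota> y = 0"
  shows "w = 0"
proof -
  interpret k_algebra s using pres by (rule presented_algebra_k_algebra)
  have "s 2 (w * w) = 0" using w(1) scale_left_distrib[of 1 1 "w * w"] by simp
  then have ww: "w * w = 0" using two by simp
  let ?I = "range (\<lambda>a. a * w)"
  have swap: "\<exists>b. w * a = b * w" for a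
  proof (rule presented_algebra_induct[OF pres, of "\<lambda>a. \<exists>b. w * a = b * w"])
    show "\<exists>b. w * 1 = b * w" by (rule exI[of _ 1]) simp
    show "\<exists>b. w * (a + a') = b * w" if "\<exists>b. w * a = b * w" "\<exists>b. w * a' = b * w" for a a'
      using that by (metis distrib_left distrib_right)
    show "\<exists>b. w * s r a = b * w" if "\<exists>b. w * a = b * w" for r a
      using that by (metis scale_mult_left scale_mult_right)
    show "\<exists>b. w * (\<iota> y * a) = b * w" if y: "y \<in> \<Gamma>" and ex: "\<exists>b. w * a = b * w" for y a
    proof -
      obtain b where b: "w * a = b * w" using ex by blast
      have "w * \<iota> y = - (\<iota> y * w)" using w(2)[OF y] by (simp add: eq_neg_iff_add_eq_0
          add.commute)
      then have "w * (\<iota> y * a) = - (\<iota> y * (w * a))" by (simp add: mult.assoc[symmetric])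
      then have "w * (\<iota> y * a) = (- (\<iota> y * b)) * w" by (simp add: b mult.assoc)
      then show ?thesis by blast
    qed
  qed
  have I: "left_ideal ?I"
    unfolding left_ideal_def
  proof (intro conjI ballI allI)
    show "0 \<in> ?I" by (rule range_eqI[of _ _ 0]) simp
    show "a - b \<in> ?I" if "a \<in> ?I" "b \<in> ?I" for a b
      using that by (auto simp: left_diff_distrib[symmetric])
    show "a * b \<in> ?I" if "b \<in> ?I" for a b
      using that by (auto simp: mult.assoc[symmetric])
  qed
  have zero: "a * b = 0" if "a \<in> ?I" "b \<in> ?I" for a b
  proof -
    from that obtain a' b' where ab: "a = a' * w" "b = b' * w" by blast
    obtain b'' where "w * b' = b'' * w" using swap by blast
    then have "a * b = a' * (b'' * (w * w))" by (simp add: ab mult.assoc) (simp add: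
        mult.assoc[symmetric])
    then show ?thesis by (simp add: ww)
  qed
  show ?thesis
    by (rule semisimple_no_square_zero[OF ss I zero]) (auto intro: range_eqI[of _ _ 1])
qed

lemma clifford_independent:
  assumes cl: "clifford_algebra s n \<alpha> \<beta> \<gamma> lam G X"
  defines "\<iota> \<equiv> case_cl_gen G X"
  shows "inj_on \<iota> (cl_gens n)" "\<not> module.dependent s (\<iota> ` cl_gens n)"
proof -
  interpret k_algebra s using clifford_presented[OF cl] by (rule presented_algebra_k_algebra)
  have coord: "\<exists>L. linear_map s s L \<and> (\<forall>y\<in>cl_gens n. L (\<iota> y) = (if y = z then 1 else 0))"
    for z
    using clifford_coordinate[OF cl, of "\<lambda>y. if y = z then 1 else 0"]
    by (simp add: \<iota>_def if_distrib[of "\<lambda>r. s r _"] cong: if_cong)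
  show inj: "inj_on \<iota> (cl_gens n)"
  proof (rule inj_onI, rule ccontr)
    fix y z assume yz: "y \<in> cl_gens n" "z \<in> cl_gens n" "\<iota> y = \<iota> z" "y \<noteq> z"
    obtain L where "\<forall>y\<in>cl_gens n. L (\<iota> y) = (if y = z then 1 else 0 :: 'b)" using
        coord by blast
    then show False using yz by (metis zero_neq_one)
  qed
  show "independent (\<iota> ` cl_gens n)"
  proof
    assume "dependent (\<iota> ` cl_gens n)"
    then obtain z where z: "z \<in> cl_gens n" "\<iota> z \<in> span (\<iota> ` cl_gens n - {\<iota> z})"
      by (auto simp: dependent_def)
    obtain L where L: "linear_map s s L"
      "\<And>y. y \<in> cl_gens n \<Longrightarrow> L (\<iota> y) = (if y = z then 1 else 0)"
      using coord by blast
    have "L a = 0" if "a \<in> span (\<iota> ` cl_gens n - {\<iota> z})" for a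
      using that
    proof (induction rule: span_induct_alt)
      case (step c v b)
      then have "L v = 0" using L(2) by auto
      then show ?case using step by (simp add: linear_simps[OF L(1)])
    qed (rule linear_zero[OF L(1)])
    then have "L (\<iota> z) = 0" using z(2) by blast
    then show False using L(2)[OF z(1)] by simp
  qed
qed

lemma card_cl_gens: "finite (cl_gens n)" "card (cl_gens n) = Suc n"
proof -
  have "card (Gen_X ` {1..n}) = n" by (subst card_image) (auto simp: inj_on_def)
  then show "finite (cl_gens n)" "card (cl_gens n) = Suc n"
    unfolding cl_gens_def by (auto simp: card_insert_if)
qed

lemma clifford_orthogonal_generators:
  fixes s :: "'k::field \<Rightarrow> 'a::ring_1 \<Rightarrow> 'a"
  assumes two: "(2::'k) \<noteq> 0" and "odd n" and cl: "clifford_algebra s n \<alpha> \<beta> \<gamma> lam G X"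
    and ss: "semisimple_ring TYPE('a)"
  shows "\<exists>V q. orthogonal_generators s V q"
proof -
  define \<iota> where "\<iota> = case_cl_gen G X"
  note pres = clifford_presented[OF cl, folded \<iota>_def]
  interpret k_algebra s using pres by (rule presented_algebra_k_algebra)
  note indep = clifford_independent[OF cl, folded \<iota>_def]
  define Y where "Y = \<iota> ` cl_gens n"
  have Y: "finite Y" "independent Y" "card Y = Suc n"
    using card_cl_gens[of n] indep by (auto simp: Y_def card_image)
  have polar: "v * w + w * v \<in> scalars s" if v: "v \<in> span Y" and w: "w \<in> span Y" for v w
  proof -
    have left: "v * w + w * v \<in> scalars s"
      if "v \<in> span Z" "\<And>y. y \<in> Z \<Longrightarrow> y * w + w * y \<in> scalars s" for v w Z
      using that(1)
    proof (induction rule: span_induct_alt)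
      case base
      show ?case using subspace_0[OF scalars_subspace] by simp
    next
      case (step c y b)
      have "(s c y + b) * w + w * (s c y + b) = s c (y * w + w * y) + (b * w + w * b)"
        by (simp add: algebra_simps scale_out
            scale_right_distrib)
      then show ?case
        using step that(2) subspace_add[OF scalars_subspace] subspace_scale[OF scalars_subspace]
        by simp
    qed
    have "y * z + z * y \<in> scalars s" if "y \<in> Y" "z \<in> Y" for y z
      using that clifford_polar[OF cl, folded \<iota>_def] by (auto simp: Y_def)
    then have "w * y + y * w \<in> scalars s" if "y \<in> Y" for y
      using left[OF w] that by blast
    then have "y * w + w * y \<in> scalars s" if "y \<in> Y" for y
      using that by (simp only: add.commute[of "y * w"])
    then show ?thesis using left v by blast
  qed
  have square: "w * w \<in> scalars s" if "w \<in> span Y" for w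
  proof -
    from subspace_scale[OF scalars_subspace polar[OF that that], of "1 / 2"] show ?thesis
      by (simp only: half_double[OF two])
  qed
  have nondegenerate: "w = 0" if "w \<in> span Y" "\<And>v. v \<in> span Y \<Longrightarrow> v * w + w * v = 0" for w
    by (rule clifford_radical[OF two pres ss])
      (use that span_base[of _ Y] in \<open>auto simp: Y_def\<close>)
  obtain V where V: "finite V" "card V = card Y" "V \<subseteq> span Y" "Y \<subseteq> span V"
    "\<forall>v\<in>V. v * v \<noteq> 0" "\<forall>v\<in>V. \<forall>w\<in>V. v \<noteq> w \<longrightarrow> v * w + w * v = 0"
    using ex_orthogonal_basis[OF two Y(1,2) polar square nondegenerate] by blast
  have "\<exists>r. v * v = s r 1" if "v \<in> V" for v
    using square[of v] V(3) that by (auto simp: scalars_def)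
  then obtain q where q: "\<And>v. v \<in> V \<Longrightarrow> v * v = s (q v) 1" by metis
  have "orthogonal_generators s V q"
  proof unfold_locales
    show "(2::'k) \<noteq> 0" by (rule two)
    show "finite V" "even (card V)" using V Y \<open>odd n\<close> by simp_all
    show "v * v = s (q v) 1" if "v \<in> V" for v by (rule q[OF that])
    show "q v \<noteq> 0" if "v \<in> V" for v using V(5) that q[OF that] by auto
    show "v * w = - (w * v)" if "v \<in> V" "w \<in> V" "v \<noteq> w" for v w
      using V(6) that by (simp add: eq_neg_iff_add_eq_0)
    show "P a" if one: "P 1" and add: "\<And>a b. P a \<Longrightarrow> P b \<Longrightarrow> P (a + b)"
      and scale: "\<And>r a. P a \<Longrightarrow> P (s r a)" and mult: "\<And>v a. v \<in> V \<Longrightarrow> P a \<Longrightarrow> P (v * a)" for P a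
    proof (rule presented_algebra_induct[OF pres, of P])
      show "P (\<iota> y * a)" if "y \<in> cl_gens n" "P a" for y a
      proof -
        have "P (v * a)" if "v \<in> span V" for v
          using that
        proof (induction rule: span_induct_alt)
          case base
          show ?case using scale[OF \<open>P a\<close>, of 0] by simp
        next
          case (step c v b)
          then show ?case
            using add scale mult[OF step(1) \<open>P a\<close>]
            by (simp add: distrib_right scale_mult_left[symmetric])
        qed
        then show ?thesis using V(4) that(1) by (auto simp: Y_def)
      qed
    qed (fact one add scale)+
  qed
  then show ?thesis by blast
qed


section \<open>Coactions on semisimple Clifford algebras\<close>

lemma (in k_algebra) inner_linear:
  "linear_map scale scale (\<lambda>a. c' * a * c)"
  by (rule linearI)
    (simp_all add: vector_space_axioms distrib_left distrib_right scale_out)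

lemma (in k_algebra) scalar_commutes: "z \<in> scalars scale \<Longrightarrow> z * a = a * z"
  by (auto simp: scalars_def scale_out)

text \<open>Elements \<open>c\<close> and \<open>u\<^sub>i\<close> as in the theorem give the automorphism \<open>a \<mapsto> c\<^sup>-\<^sup>1 a c\<close> and the inner skew
  derivations \<open>d\<^sub>i\<close>. With \<open>\<phi> u\<^sub>i = - u\<^sub>i\<close> one finds \<open>d\<^sub>i (d\<^sub>j a) + d\<^sub>j (d\<^sub>i a) = [u\<^sub>i u\<^sub>j + u\<^sub>j u\<^sub>i, a]\<close>
  and \<open>d\<^sub>i (d\<^sub>i a) = [u\<^sub>i\<^sup>2, a]\<close>; this is where the scalar conditions come from.\<close>

lemma skew_commutator:
  fixes \<phi> :: "'a::ring_1 \<Rightarrow> 'a"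
  assumes "\<And>a b. \<phi> (a * b) = \<phi> a * \<phi> b" "\<And>a. \<phi> (\<phi> a) = a"
      "\<And>a b. \<phi> (a - b) = \<phi> a - \<phi> b"
    and "\<phi> v = - v"
  shows "u * (v * a - \<phi> a * v) - \<phi> (v * a - \<phi> a * v) * u =
    (u * v) * a - a * (v * u) + (v * \<phi> a * u - u * \<phi> a * v)"
  by (simp add: assms algebra_simps)

lemma (in k_algebra) skew_system_of_units:
  fixes u :: "nat \<Rightarrow> 'a"
  assumes c: "c * c' = 1" "c' * c = 1" "c\<^sup>2 \<in> scalars scale"
    and u: "\<And>i. i \<in> I \<Longrightarrow> u i * c + c * u i = 0" "\<And>i. i \<in> I \<Longrightarrow> (u i)\<^sup>2 \<in> scalars scale"
    and uu: "\<And>i j. i \<in> I \<Longrightarrow> j \<in> I \<Longrightarrow> u i * u j + u j * u i \<in> scalars scale"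
  shows "skew_system scale I (\<lambda>a. c' * a * c) (\<lambda>i a. u i * a - c' * a * c * u i)"
proof -
  define \<phi> where "\<phi> a = c' * a * c" for a
  have \<phi>_linear: "linear_map scale scale \<phi>"
    unfolding \<phi>_def by (rule inner_linear)
  have \<phi>_one: "\<phi> 1 = 1" by (simp add: \<phi>_def c)
  have \<phi>_mult: "\<phi> (a * b) = \<phi> a * \<phi> b" for a b
  proof -
    have "\<phi> a * \<phi> b = c' * a * (c * c') * b * c" by (simp add: \<phi>_def mult.assoc)
    then show ?thesis by (simp add: \<phi>_def c mult.assoc)
  qed
  have \<phi>_\<phi>: "\<phi> (\<phi> a) = a" for a
  proof -
    have "\<phi> (\<phi> a) = c' * c' * (a * c\<^sup>2)" by (simp add: \<phi>_def mult.assoc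
        power2_eq_square)
    also have "\<dots> = c' * c' * (c\<^sup>2 * a)" unfolding scalar_commutes[OF c(3)] ..
    also have "\<dots> = c' * (c' * c) * c * a" by (simp add: mult.assoc power2_eq_square)
    finally show ?thesis by (simp add: c)
  qed
  have \<phi>_u: "\<phi> (u i) = - u i" if "i \<in> I" for i
  proof -
    have "u i * c = - (c * u i)" using u(1)[OF that] by (simp add: eq_neg_iff_add_eq_0)
    then have "\<phi> (u i) = - (c' * c * u i)" by (simp add: \<phi>_def mult.assoc)
    then show ?thesis by (simp add: c)
  qed
  note comm = skew_commutator[of \<phi>, OF \<phi>_mult \<phi>_\<phi> linear_diff[OF \<phi>_linear]]
  show ?thesis
    unfolding skew_system_def \<phi>_def[symmetric]
  proof (intro conjI allI ballI)
    fix i a b assume i: "i \<in> I"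
    show "linear_map scale scale (\<lambda>a. u i * a - \<phi> a * u i)"
      by (rule linearI)
        (simp_all add: vector_space_axioms linear_simps[OF \<phi>_linear]
          algebra_simps scale_out
          scale_right_diff_distrib)
    show "u i * (a * b) - \<phi> (a * b) * u i = (u i * a - \<phi> a * u i) * b + \<phi> a * (u i * b - \<phi> b * u i)"
      by (simp add: \<phi>_mult algebra_simps)
    show "u i * \<phi> a - \<phi> (\<phi> a) * u i = - \<phi> (u i * a - \<phi> a * u i)"
      by (simp add: linear_diff[OF \<phi>_linear] \<phi>_mult \<phi>_\<phi> \<phi>_u[OF i])
    show "u i * (u i * a - \<phi> a * u i) - \<phi> (u i * a - \<phi> a * u i) * u i = 0"
      using scalar_commutes[OF u(2)[OF i], of a]
      unfolding comm[OF \<phi>_u[OF i]] by (simp add: power2_eq_square mult.assoc)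
    fix j assume j: "j \<in> I"
    show "u i * (u j * a - \<phi> a * u j) - \<phi> (u j * a - \<phi> a * u j) * u i =
        - (u j * (u i * a - \<phi> a * u i) - \<phi> (u i * a - \<phi> a * u i) * u j)"
      using scalar_commutes[OF uu[OF i j], of a]
      unfolding comm[OF \<phi>_u[OF i]] comm[OF \<phi>_u[OF j]] by (simp add: algebra_simps)
  qed (fact \<phi>_linear \<phi>_one \<phi>_mult \<phi>_\<phi>)+
qed

text \<open>Conversely, the element \<open>u\<close> defining an inner skew derivation that anticommutes with \<open>\<phi>\<close> may be
  replaced by \<open>(u - \<phi> u) / 2\<close>, which \<open>\<phi>\<close> maps to its negative, and the commutator formulas show that
  the relevant elements are central, hence scalars.\<close>

lemma (in orthogonal_generators) units_of_skew_system:
  assumes skew: "skew_system scale I \<phi> d"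
  shows "\<exists>c c' u. c * c' = 1 \<and> c' * c = 1 \<and> c\<^sup>2 \<in> scalars scale \<and>
    (\<forall>i\<in>I. u i * c + c * u i = 0 \<and> (u i)\<^sup>2 \<in> scalars scale) \<and>
    (\<forall>i\<in>I. \<forall>j\<in>I. u i * u j + u j * u i \<in> scalars scale) \<and>
    (\<forall>a. \<phi> a = c' * a * c) \<and> (\<forall>i\<in>I. \<forall>a. d i a = u i * a - c'
        * a * c * u i)"
proof -
  have \<phi>: "linear_map scale scale \<phi>" "\<phi> 1 = 1" "\<And>a b. \<phi> (a * b) = \<phi> a * \<phi> b"
    "\<And>a. \<phi> (\<phi> a) = a"
    and d: "\<And>i. i \<in> I \<Longrightarrow> linear_map scale scale (d i)"
      "\<And>i a b. i \<in> I \<Longrightarrow> d i (a * b) = d i a * b + \<phi> a * d i b"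
      "\<And>i a. i \<in> I \<Longrightarrow> d i (\<phi> a) = - \<phi> (d i a)" "\<And>i a. i \<in> I \<Longrightarrow> d i (d i a) = 0"
      "\<And>i j a. i \<in> I \<Longrightarrow> j \<in> I \<Longrightarrow> d i (d j a) = - d j (d i a)"
    using skew unfolding skew_system_def by blast+
  obtain c c' where c: "c * c' = 1" "c' * c = 1" "c\<^sup>2 \<in> scalars scale" "\<And>a. \<phi> a = c' * a * c"
    using involution_inner[OF \<phi>] by blast
  have "\<exists>u. \<phi> u = - u \<and> (\<forall>a. d i a = u * a - \<phi> a * u)" if i: "i \<in> I" for i
  proof -
    obtain u0 where u0: "\<And>a. d i a = u0 * a - \<phi> a * u0"
      using skew_derivation_inner[OF \<phi>(1-3) d(1,2)[OF i]] by blast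
    define u where "u = scale (1 / 2) (u0 - \<phi> u0)"
    have "\<phi> u = - u"
      unfolding u_def linear_simps[OF \<phi>(1)] \<phi>(4) scale_minus_right[symmetric]
      by simp
    moreover have "d i a = u * a - \<phi> a * u" for a
    proof -
      have "d i a = - \<phi> (d i (\<phi> a))" using d(3)[OF i, of "\<phi> a"] by (simp add: \<phi>(4))
      also have "\<dots> = - (\<phi> u0 * a - \<phi> a * \<phi> u0)"
        unfolding u0 by (simp add: \<phi>(3,4) linear_diff[OF \<phi>(1)])
      finally have "d i a = - (\<phi> u0 * a - \<phi> a * \<phi> u0)" .
      from arg_cong2[where f = "(+)", OF u0[of a] this]
      have "d i a + d i a = (u0 - \<phi> u0) * a - \<phi> a * (u0 - \<phi> u0)"
        by (simp add: algebra_simps)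
      then have "scale (1 / 2) (d i a + d i a) =
          scale (1 / 2) ((u0 - \<phi> u0) * a - \<phi> a * (u0 - \<phi> u0))" by simp
      then show ?thesis
        unfolding half_double[OF two] u_def scale_out
        by (simp only: scale_right_diff_distrib)
    qed
    ultimately show ?thesis by blast
  qed
  then obtain u where u: "\<And>i. i \<in> I \<Longrightarrow> \<phi> (u i) = - u i"
    "\<And>i a. i \<in> I \<Longrightarrow> d i a = u i * a - \<phi> a * u i" by metis
  note comm = skew_commutator[of \<phi>, OF \<phi>(3,4) linear_diff[OF \<phi>(1)]]
  have "u i * c + c * u i = 0" if "i \<in> I" for i
  proof -
    have "c * \<phi> (u i) = u i * c" by (simp add: c(4) mult.assoc[symmetric] c(1))
    then show ?thesis using u(1)[OF that] by (simp add: eq_neg_iff_add_eq_0[symmetric])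
  qed
  moreover have "(u i)\<^sup>2 \<in> scalars scale" if i: "i \<in> I" for i
  proof (rule central_scalar)
    fix v
    have "d i (d i v) = (u i)\<^sup>2 * v - v * (u i)\<^sup>2"
      unfolding u(2)[OF i] comm[OF u(1)[OF i]] by (simp add: power2_eq_square)
    then show "v * (u i)\<^sup>2 = (u i)\<^sup>2 * v" using d(4)[OF i] by simp
  qed
  moreover have "u i * u j + u j * u i \<in> scalars scale" if i: "i \<in> I" and j: "j \<in> I" for i j
  proof (rule central_scalar)
    fix v
    have "d i (d j v) + d j (d i v) = (u i * u j + u j * u i) * v - v * (u i * u j + u j * u i)"
      unfolding u(2)[OF i] u(2)[OF j] comm[OF u(1)[OF i]] comm[OF u(1)[OF j]]
      by (simp add: algebra_simps)
    then show "v * (u i * u j + u j * u i) = (u i * u j + u j * u i) * v"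
      using d(5)[OF i j, of v] by simp
  qed
  ultimately show ?thesis
    using c u(2)
    by (intro exI[of _ c] exI[of _ c'] exI[of _ u] conjI ballI allI) (simp_all flip: c(4))
qed

lemma ordered_comp_cong:
  assumes "\<And>i. i \<in> P \<Longrightarrow> d i = d' i"
  shows "ordered_comp d P = ordered_comp d' P"
proof (cases "finite P")
  case True
  then have "map d (sorted_list_of_set P) = map d' (sorted_list_of_set P)" using assms by simp
  then show ?thesis by (simp only: ordered_comp_def)
qed (simp add: ordered_comp_def)

theorem theorem5p2:
  fixes scaleA :: "'k::field \<Rightarrow> 'a::ring_1 \<Rightarrow> 'a"
    and scaleE :: "'k \<Rightarrow> 'e::ring_1 \<Rightarrow> 'e"
    and n :: nat
    and \<alpha> :: 'k and \<beta> \<gamma> :: "nat \<Rightarrow> 'k" and lam :: "nat \<Rightarrow> nat \<Rightarrow> 'k"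
    and G :: 'a and X :: "nat \<Rightarrow> 'a"
    and g :: 'e and x :: "nat \<Rightarrow> 'e"
    and \<Delta> :: "'e \<Rightarrow> ('k, 'e, 'e) tensor" and \<epsilon> :: "'e \<Rightarrow> 'k"
        and S :: "'e \<Rightarrow> 'e"
    and \<rho> :: "'a \<Rightarrow> ('k, 'a, 'e) tensor"
  assumes "CHAR('k) \<noteq> 2"
    and "odd n"
    and "clifford_algebra scaleA n \<alpha> \<beta> \<gamma> lam G X"
    and "semisimple_ring TYPE('a)"
    and "E_hopf_algebra scaleE n g x \<Delta> \<epsilon> S"
  shows "right_coaction scaleA scaleE \<Delta> \<epsilon> \<rho> \<longleftrightarrow>
    (\<exists>c c' u.
       c * c' = 1 \<and> c' * c = 1 \<and> c\<^sup>2 \<in> scalars scaleA \<and>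
       (\<forall>i\<in>{1..n}. u i * c + c * u i = 0 \<and> (u i)\<^sup>2 \<in> scalars scaleA) \<and>
       (\<forall>i\<in>{1..n}. \<forall>j\<in>{1..n}. u i * u j + u j * u i \<in> scalars scaleA) \<and>
       (let d = ordered_comp (\<lambda>i a. u i * a - c' * a * c * u i);
            xx = ordered_prod x
        in \<forall>a. \<rho> a = tclass scaleA scaleE
             (\<Sum>P\<in>Pow {1..n}. fscale ((- 1) ^ ((card P + 1) div 2))
                (fbasis (d P a, scaleE (1 / 2) (xx P + (- 1) ^ card P * (g * xx P))) +
                 fbasis (c' * d P a * c,
                         scaleE (1 / 2) (xx P + (- 1) ^ (card P + 1) * (g * xx P)))))))"
proof -
  have "(2::'k) \<noteq> 0"
  proof
    assume "(2::'k) = 0"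
    then have "CHAR('k) dvd 2" using of_nat_eq_0_iff_char_dvd[where 'a = 'k, of 2] by simp
    moreover have "\<not> CHAR('k) dvd 1"
      using of_nat_eq_0_iff_char_dvd[where 'a = 'k, of 1] by simp
    moreover have "m = 2" if "m dvd 2" "\<not> m dvd 1" for m :: nat
    proof -
      have "m \<le> 2" "m \<noteq> 0" "m \<noteq> 1" using that dvd_imp_le[of m 2] by (auto intro:
          Nat.gr0I)
      then show ?thesis by linarith
    qed
    ultimately show False using assms(1) by blast
  qed
  interpret A: k_algebra scaleA
    by (rule presented_algebra_k_algebra[OF clifford_presented[OF assms(3)]])
  interpret E_comodule scaleE n g x \<Delta> \<epsilon> S scaleA
    by unfold_locales (fact assms(5) \<open>(2::'k) \<noteq> 0\<close>)+
  obtain V q where "orthogonal_generators scaleA V q"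
    using clifford_orthogonal_generators[OF two assms(2,3,4)] by blast
  then interpret orthogonal_generators scaleA V q .
  let ?formula = "\<lambda>c c' u a. tclass scaleA scaleE
    (\<Sum>P\<in>Pow {1..n}. fscale ((- 1) ^ ((card P + 1) div 2))
      (fbasis (ordered_comp (\<lambda>i a. u i * a - c' * a * c * u i) P a,
          scaleE (1 / 2) (ordered_prod x P + (- 1) ^ card P * (g * ordered_prod x P))) +
       fbasis (c' * ordered_comp (\<lambda>i a. u i * a - c' * a * c * u i) P a * c,
          scaleE (1 / 2) (ordered_prod x P + (- 1) ^ (card P + 1) * (g * ordered_prod x P)))))"
  let ?units = "\<lambda>c c' u. c * c' = 1 \<and> c' * c = 1 \<and> c\<^sup>2 \<in> scalars scaleA \<and>
    (\<forall>i\<in>{1..n}. u i * c + c * u i = 0 \<and> (u i)\<^sup>2 \<in> scalars scaleA) \<and>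
    (\<forall>i\<in>{1..n}. \<forall>j\<in>{1..n}. u i * u j + u j * u i \<in> scalars scaleA)"
  have "right_coaction scaleA scaleE \<Delta> \<epsilon> \<rho> \<longleftrightarrow> (\<exists>c c' u. ?units c c' u \<and> (\<forall>a. \<rho> a = ?formula c c' u a))"
  proof
    assume "right_coaction scaleA scaleE \<Delta> \<epsilon> \<rho>"
    then obtain \<phi> d where skew: "skew_system scaleA {1..n} \<phi> d"
      and \<rho>: "\<rho> = E_skew.coact scaleE g x scaleA \<phi> d [1..<Suc n]"
      using right_coaction_iff_skew_system by blast
    interpret E_skew scaleE n g x \<Delta> \<epsilon> S scaleA \<phi> d by unfold_locales (fact skew)
    obtain c c' u where units: "?units c c' u" and \<phi>: "\<And>a. \<phi> a = c' * a * c"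
      and d: "\<And>i a. i \<in> {1..n} \<Longrightarrow> d i a = u i * a - c' * a * c * u i"
      using units_of_skew_system[OF skew] by blast
    have comp: "ordered_comp d P = ordered_comp (\<lambda>i a. u i * a - c' * a * c * u i) P"
      if "P \<in> Pow {1..n}" for P
      using that by (intro ordered_comp_cong ext d) blast
    have "\<rho> a = ?formula c c' u a" for a
      unfolding \<rho> coact_formula \<phi> by (simp only: comp cong: sum.cong)
    with units show "\<exists>c c' u. ?units c c' u \<and> (\<forall>a. \<rho> a = ?formula c c' u a)" by blast
  next
    assume "\<exists>c c' u. ?units c c' u \<and> (\<forall>a. \<rho> a = ?formula c c' u a)"
    then obtain c c' u where units: "?units c c' u" and \<rho>: "\<And>a. \<rho> a = ?formula c c' u a" by blast
    let ?\<phi> = "\<lambda>a. c' * a * c" and ?d = "\<lambda>i a. u i * a - c' * a * c * u i"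
    have skew: "skew_system scaleA {1..n} ?\<phi> ?d"
      by (rule A.skew_system_of_units) (use units in blast)+
    interpret E_skew scaleE n g x \<Delta> \<epsilon> S scaleA ?\<phi> ?d by unfold_locales (fact skew)
    have "\<rho> = coact [1..<Suc n]" by (rule ext) (simp only: \<rho> coact_formula)
    then show "right_coaction scaleA scaleE \<Delta> \<epsilon> \<rho>"
      using right_coaction_iff_skew_system skew by blast
  qed
  then show ?thesis by (simp only: Let_def conj_assoc)
qed

end
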